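(* Given a partial-observation stochastic game $G$ with $n$ states and $m$ transitions and a parity objective $\mathrm{Parity}(p)$ for player 1 with $d$ priorities, one can construct in time $O((n+m)\cdot d)$ a three-player game $\overline{G}$ with a parity objective $\mathrm{Parity}(\overline{p})$, where player 1 has partial observation and players 2 and 3 have perfect observation, such that: there is a finite-memory almost-sure winning strategy for player 1 in $G$ (from a state $s$) if and only if there is a finite-memory observation-based strategy $\overline{\sigma}$ for player 1 in $\overline{G}$ such that in the two-player game $\overline{G}_{\overline{\sigma}}$ obtained by fixing $\overline\sigma$, player 3 has a sure winning strategy for $\mathrm{Parity}(\overline{p})$ (from the corresponding state $\overline{s}$). Moreover $\overline{G}$ has $O(n\cdot d)$ states and $O(m\cdot d)$ transitions, and $\overline{p}$ has at most $d+1$ priorities.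
   Context: A partial-observation stochastic game is $G=(S_1,S_2,S_P,A_1,\delta,E,\mathsf{Obs},\mathsf{obs})$: finite state set $S=S_1\cup S_2\cup S_P$ (player-1, player-2, probabilistic states); finite action set $A_1$; $\delta:S_1\times A_1\to S_2$; for $s\in S_P$, $\delta(s)$ is a probability distribution on $S_1$; edges $E=\{(s,t)\mid s\in S_P,\delta(s)(t)>0\}\cup E'$, $E'\subseteq S_2\times S_P$; observation map $\mathsf{obs}:S\to\mathsf{Obs}$. Player 1 chooses actions and is restricted to pure observation-based strategies (equal action on histories with equal observation sequences); a finite-memory strategy is given by a finite transducer $(M,m_0,\sigma_u:M\times\mathsf{Obs}\to M,\sigma_n:M\to A_1)$. Player 2 has perfect observation and chooses edges with arbitrary strategies. $\mathrm{Parity}(p)$, for $p:S\to\{0,\dots,d\}$, is the set of plays whose minimal priority visited infinitely often is even. A strategy $\sigma$ is almost-sure winning from $s$ if for every player-2 strategy $\pi$, $\Pr^{\sigma,\pi}_s(\mathrm{Parity}(p))=1$. A three-player turn-based game has player-1 states (partial observation, actions via a transition function into player-2 states) and player-2 and player-3 states (perfect observation, choosing edges); fixing a finite-memory player-1 strategy $\overline\sigma$ yields a two-player perfect-observation game $\overline{G}_{\overline\sigma}$ between players 2 and 3, and player 3 has a sure winning strategy if some player-3 strategy ensures that every resulting play satisfies the parity objective against all player-2 strategies. *)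

theory Defs
  imports "HOL-Probability.Probability"
begin

section \<open>Game graphs\<close>

text \<open>
  The common shape of both kinds of games.  \<open>SX\<close> is the third class of states: the probabilistic
  states of a stochastic game, the player-3 states of a three-player game.  The function
  \<open>act\<close> is only meaningful on \<open>S1\<close> and \<open>A1\<close>.
\<close>

record ('s, 'a, 'o) game =
  S1 :: "'s set"
  S2 :: "'s set"
  SX :: "'s set"
  A1 :: "'a set"
  act :: "'s \<Rightarrow> 'a \<Rightarrow> 's"
  E :: "('s \<times> 's) set"
  Obs :: "'o set"
  obs :: "'s \<Rightarrow> 'o"

definition states :: "('s, 'a, 'o, 'z) game_scheme \<Rightarrow> 's set" where
  "states G = S1 G \<union> S2 G \<union> SX G"

definition num_transitions :: "('s, 'a, 'o, 'z) game_scheme \<Rightarrow> nat" where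
  "num_transitions G = card (S1 G) * card (A1 G) + card (E G)"

definition game_graph :: "('s, 'a, 'o, 'z) game_scheme \<Rightarrow> bool" where
  "game_graph G \<longleftrightarrow>
     finite (states G) \<and> states G \<noteq> {} \<and>
     S1 G \<inter> S2 G = {} \<and> S1 G \<inter> SX G = {} \<and> S2 G \<inter> SX G = {} \<and>
     finite (A1 G) \<and> A1 G \<noteq> {} \<and>
     (\<forall>s\<in>S1 G. \<forall>a\<in>A1 G. act G s a \<in> S2 G) \<and>
     E G \<subseteq> (S2 G \<union> SX G) \<times> states G \<and>
     (\<forall>s\<in>S2 G \<union> SX G. \<exists>t. (s, t) \<in> E G) \<and>
     finite (Obs G) \<and> (\<forall>s\<in>states G. obs G s \<in> Obs G)"

abbreviation three_player_game :: "('s, 'a, 'o) game \<Rightarrow> bool" where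
  "three_player_game \<equiv> game_graph"

record ('s, 'a, 'o) stochastic_game = "('s, 'a, 'o) game" +
  trans_prob :: "'s \<Rightarrow> 's pmf"

definition stochastic_game :: "('s, 'a, 'o) stochastic_game \<Rightarrow> bool" where
  "stochastic_game G \<longleftrightarrow> game_graph G \<and>
     (\<forall>s\<in>SX G. set_pmf (trans_prob G s) \<subseteq> S1 G) \<and>
     (\<exists>E'. E' \<subseteq> S2 G \<times> SX G \<and>
           E G = {(s, t). s \<in> SX G \<and> pmf (trans_prob G s) t > 0} \<union> E')"


section \<open>Parity objectives\<close>

definition parity :: "('s \<Rightarrow> nat) \<Rightarrow> (nat \<Rightarrow> 's) set" where
  "parity p = {\<rho>. even (LEAST k. infinite {i. p (\<rho> i) = k})}"


section \<open>Strategies of player 1\<close>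

text \<open>A history is the nonempty list of the states visited so far, the current state last.\<close>

definition observation_based :: "('s, 'a, 'o, 'z) game_scheme \<Rightarrow> ('s list \<Rightarrow> 'a) \<Rightarrow> bool" where
  "observation_based G \<sigma> \<longleftrightarrow>
     (\<forall>h h'. map (obs G) h = map (obs G) h' \<longrightarrow> \<sigma> h = \<sigma> h')"

text \<open>
  Every finite memory set can be renamed to a set of natural numbers.  The memory is updated with
  the observation of every visited state, including the current one, before the next action
  is chosen.
\<close>

record ('a, 'o) transducer =
  mem :: "nat set"
  init :: nat
  upd :: "nat \<Rightarrow> 'o \<Rightarrow> nat"
  nxt :: "nat \<Rightarrow> 'a"

definition transducer :: "('s, 'a, 'o, 'z) game_scheme \<Rightarrow> ('a, 'o) transducer \<Rightarrow> bool" where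
  "transducer G T \<longleftrightarrow> finite (mem T) \<and> init T \<in> mem T \<and>
     (\<forall>m\<in>mem T. \<forall>b\<in>Obs G. upd T m b \<in> mem T) \<and> (\<forall>m\<in>mem T. nxt T m \<in> A1 G)"

definition transducer_strategy ::
    "('s, 'a, 'o, 'z) game_scheme \<Rightarrow> ('a, 'o) transducer \<Rightarrow> 's list \<Rightarrow> 'a" where
  "transducer_strategy G T h = nxt T (foldl (upd T) (init T) (map (obs G) h))"

lemma observation_based_transducer_strategy:
  "observation_based G (transducer_strategy G T)"
  by (simp add: observation_based_def transducer_strategy_def)


section \<open>Almost-sure winning in stochastic games\<close>

text \<open>Strategies of player 2 see the whole history and may randomise.\<close>

definition player2_strategy ::
    "('s, 'a, 'o) stochastic_game \<Rightarrow> ('s list \<Rightarrow> 's pmf) \<Rightarrow> bool" where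
  "player2_strategy G \<pi> \<longleftrightarrow>
     (\<forall>h. h \<noteq> [] \<and> last h \<in> S2 G \<longrightarrow> set_pmf (\<pi> h) \<subseteq> {t. (last h, t) \<in> E G})"

definition next_state ::
    "('s, 'a, 'o) stochastic_game \<Rightarrow> ('s list \<Rightarrow> 'a) \<Rightarrow> ('s list \<Rightarrow> 's pmf) \<Rightarrow> 's list \<Rightarrow> 's pmf" where
  "next_state G \<sigma> \<pi> h =
     (if last h \<in> S1 G then return_pmf (act G (last h) (\<sigma> h))
      else if last h \<in> S2 G then \<pi> h
      else trans_prob G (last h))"

definition play_kernel ::
    "('s, 'a, 'o) stochastic_game \<Rightarrow> ('s list \<Rightarrow> 'a) \<Rightarrow> ('s list \<Rightarrow> 's pmf) \<Rightarrow> 's \<Rightarrow>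
     nat \<Rightarrow> (nat \<Rightarrow> 's) \<Rightarrow> 's measure" where
  "play_kernel G \<sigma> \<pi> s i \<omega> =
     measure_pmf (if i = 0 then return_pmf s else next_state G \<sigma> \<pi> (map \<omega> [0..<i]))"

text \<open>
  The measure on plays is the Ionescu-Tulcea extension of the one-step kernels, on the product
  sigma-algebra (generated by the cylinders) over the discrete state space.
\<close>

definition play_measure ::
    "('s::countable, 'a, 'o) stochastic_game \<Rightarrow> ('s list \<Rightarrow> 'a) \<Rightarrow> ('s list \<Rightarrow> 's pmf) \<Rightarrow> 's \<Rightarrow>
     (nat \<Rightarrow> 's) measure" where
  "play_measure G \<sigma> \<pi> s =
     projective_family.lim UNIV
       (Ionescu_Tulcea.CI (play_kernel G \<sigma> \<pi> s) (\<lambda>_. count_space UNIV)) (\<lambda>_. count_space UNIV)"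

lemma Ionescu_Tulcea_play_kernel:
  fixes G :: "('s::countable, 'a, 'o) stochastic_game"
  shows "Ionescu_Tulcea (play_kernel G \<sigma> \<pi> s) (\<lambda>_. count_space UNIV)"
proof (rule Ionescu_Tulcea.intro)
  fix i :: nat
  define N where "N = PiM {0..<i} (\<lambda>_. count_space (UNIV :: 's set))"
  have coord: "{\<omega> \<in> space N. \<omega> j = x} \<in> sets N" if "j \<in> {0..<i}" for j and x :: 's
  proof -
    have "(\<lambda>\<omega>. \<omega> j) \<in> measurable N (count_space UNIV)"
      unfolding N_def by (rule measurable_component_singleton[OF that])
    then have "(\<lambda>\<omega>. \<omega> j) -` {x} \<inter> space N \<in> sets N"
      by (rule measurable_sets) simp
    also have "(\<lambda>\<omega>. \<omega> j) -` {x} \<inter> space N = {\<omega> \<in> space N. \<omega> j = x}"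
      by blast
    finally show ?thesis .
  qed
  have hist: "(\<lambda>\<omega>. map \<omega> [0..<i]) -` {xs} \<inter> space N \<in> sets N" for xs :: "'s list"
  proof (cases "length xs = i")
    case True
    have "map \<omega> [0..<i] = xs \<longleftrightarrow> (\<forall>j\<in>{0..<i}. \<omega> j = xs ! j)" for \<omega>
      unfolding list_eq_iff_nth_eq using True by (simp add: Ball_def)
    then have "(\<lambda>\<omega>. map \<omega> [0..<i]) -` {xs} \<inter> space N = {\<omega> \<in> space N. \<forall>j\<in>{0..<i}. \<omega> j = xs ! j}"
      by blast
    also have "\<dots> \<in> sets N"
      by (rule sets.sets_Collect_finite_All[OF coord]) simp_all
    finally show ?thesis .
  next
    case False
    then have "map \<omega> [0..<i] \<noteq> xs" for \<omega>
      by auto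
    then have "(\<lambda>\<omega>. map \<omega> [0..<i]) -` {xs} \<inter> space N = {}"
      by blast
    then show ?thesis
      by (metis sets.empty_sets)
  qed
  have "(\<lambda>\<omega>. map \<omega> [0..<i]) \<in> measurable N (count_space UNIV)"
    unfolding measurable_count_space_eq_countable[OF countableI_type]
    using hist by simp
  moreover have "(\<lambda>h. measure_pmf (if i = 0 then return_pmf s else next_state G \<sigma> \<pi> h))
      \<in> measurable (count_space UNIV) (subprob_algebra (count_space UNIV))"
    by (simp add: measure_pmf_in_subprob_algebra)
  ultimately have "(\<lambda>\<omega>. measure_pmf (if i = 0 then return_pmf s else next_state G \<sigma> \<pi> (map \<omega> [0..<i])))
      \<in> measurable N (subprob_algebra (count_space UNIV))"
    by (rule measurable_compose)
  then show "play_kernel G \<sigma> \<pi> s i \<in>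
      measurable (PiM {0..<i} (\<lambda>_. count_space UNIV)) (subprob_algebra (count_space UNIV))"
    by (simp add: play_kernel_def[abs_def] N_def)
next
  fix i and x :: "nat \<Rightarrow> 's"
  show "prob_space (play_kernel G \<sigma> \<pi> s i x)"
    unfolding play_kernel_def by (rule measure_pmf.prob_space_axioms)
qed

definition almost_sure_winning ::
    "('s::countable, 'a, 'o) stochastic_game \<Rightarrow> ('s \<Rightarrow> nat) \<Rightarrow> ('s list \<Rightarrow> 'a) \<Rightarrow> 's \<Rightarrow> bool" where
  "almost_sure_winning G p \<sigma> s \<longleftrightarrow>
     (\<forall>\<pi>. player2_strategy G \<pi> \<longrightarrow> measure (play_measure G \<sigma> \<pi> s) (parity p) = 1)"


section \<open>Fixing a strategy of player 1 in a three-player game\<close>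

record 'v two_player_game =
  V2 :: "'v set"
  V3 :: "'v set"
  edges :: "('v \<times> 'v) set"

definition strategy :: "'v two_player_game \<Rightarrow> 'v set \<Rightarrow> ('v list \<Rightarrow> 'v) \<Rightarrow> bool" where
  "strategy H V \<tau> \<longleftrightarrow> (\<forall>h. h \<noteq> [] \<and> last h \<in> V \<longrightarrow> (last h, \<tau> h) \<in> edges H)"

definition outcome ::
    "'v two_player_game \<Rightarrow> ('v list \<Rightarrow> 'v) \<Rightarrow> ('v list \<Rightarrow> 'v) \<Rightarrow> 'v \<Rightarrow> (nat \<Rightarrow> 'v) \<Rightarrow> bool" where
  "outcome H \<tau> \<pi> v \<rho> \<longleftrightarrow> \<rho> 0 = v \<and>
     (\<forall>i. (\<rho> i \<in> V3 H \<longrightarrow> \<rho> (Suc i) = \<tau> (map \<rho> [0..<Suc i])) \<and>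
          (\<rho> i \<in> V2 H \<longrightarrow> \<rho> (Suc i) = \<pi> (map \<rho> [0..<Suc i])))"

definition player3_sure_winning :: "'v two_player_game \<Rightarrow> ('v \<Rightarrow> nat) \<Rightarrow> 'v \<Rightarrow> bool" where
  "player3_sure_winning H q v \<longleftrightarrow>
     (\<exists>\<tau>. strategy H (V3 H) \<tau> \<and>
        (\<forall>\<pi>. strategy H (V2 H) \<pi> \<longrightarrow> (\<forall>\<rho>. outcome H \<tau> \<pi> v \<rho> \<longrightarrow> \<rho> \<in> parity q)))"

text \<open>
  In a vertex \<open>(s, m)\<close> the memory \<open>m\<close> has already been updated with the observation of \<open>s\<close>.
  A player-1 state has exactly one successor there, so it does not matter that these
  vertices are given to player 2.
\<close>

definition fix_player1 ::
    "('s, 'a, 'o) game \<Rightarrow> ('a, 'o) transducer \<Rightarrow> ('s \<times> nat) two_player_game" where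
  "fix_player1 G T =
     \<lparr>V2 = (S1 G \<union> S2 G) \<times> mem T,
      V3 = SX G \<times> mem T,
      edges = {((s, m), (t, upd T m (obs G t))) | s m t. m \<in> mem T \<and>
                 (s \<in> S1 G \<and> t = act G s (nxt T m) \<or> (s, t) \<in> E G)}\<rparr>"

definition initial_vertex ::
    "('s, 'a, 'o) game \<Rightarrow> ('a, 'o) transducer \<Rightarrow> 's \<Rightarrow> 's \<times> nat" where
  "initial_vertex G T s = (s, upd T (init T) (obs G s))"


section \<open>Random access machines\<close>

text \<open>
  Structured programs for a random access machine with indirect addressing.  There is no
  multiplication, so charging one unit per operation is the usual uniform cost measure.
\<close>

datatype ram_program =
    Const nat nat
  | Add nat nat nat
  | Sub nat nat nat
  | Load nat nat
  | Store nat nat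
  | Write nat
  | Seq ram_program ram_program
  | IfLess nat nat ram_program ram_program
  | WhileLess nat nat ram_program

record ram =
  reg :: "nat \<Rightarrow> nat"
  memory :: "nat \<Rightarrow> nat"
  written :: "nat list"

inductive exec :: "ram_program \<Rightarrow> ram \<Rightarrow> nat \<Rightarrow> ram \<Rightarrow> bool" where
  Const: "exec (Const r c) s 1 (s\<lparr>reg := (reg s)(r := c)\<rparr>)"
| Add: "exec (Add r a b) s 1 (s\<lparr>reg := (reg s)(r := reg s a + reg s b)\<rparr>)"
| Sub: "exec (Sub r a b) s 1 (s\<lparr>reg := (reg s)(r := reg s a - reg s b)\<rparr>)"
| Load: "exec (Load r a) s 1 (s\<lparr>reg := (reg s)(r := memory s (reg s a))\<rparr>)"
| Store: "exec (Store a r) s 1 (s\<lparr>memory := (memory s)(reg s a := reg s r)\<rparr>)"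
| Write: "exec (Write r) s 1 (s\<lparr>written := written s @ [reg s r]\<rparr>)"
| Seq: "exec P s t s' \<Longrightarrow> exec Q s' t' s'' \<Longrightarrow> exec (Seq P Q) s (t + t') s''"
| IfTrue: "reg s a < reg s b \<Longrightarrow> exec P s t s' \<Longrightarrow> exec (IfLess a b P Q) s (1 + t) s'"
| IfFalse: "\<not> reg s a < reg s b \<Longrightarrow> exec Q s t s' \<Longrightarrow> exec (IfLess a b P Q) s (1 + t) s'"
| WhileTrue: "reg s a < reg s b \<Longrightarrow> exec P s t s' \<Longrightarrow> exec (WhileLess a b P) s' t' s'' \<Longrightarrow>
    exec (WhileLess a b P) s (1 + t + t') s''"
| WhileFalse: "\<not> reg s a < reg s b \<Longrightarrow> exec (WhileLess a b P) s 1 s"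

definition computes_in :: "ram_program \<Rightarrow> nat list \<Rightarrow> nat list \<Rightarrow> nat \<Rightarrow> bool" where
  "computes_in P xs ys t \<longleftrightarrow>
     (\<exists>s'. exec P \<lparr>reg = (\<lambda>_. 0), memory = (\<lambda>i. if i < length xs then xs ! i else 0), written = []\<rparr> t s'
        \<and> written s' = ys)"

text \<open>
  Adjacency-list presentation of a game with a priority function, whose states, actions and
  observations are numbered from \<open>0\<close>.  The successors of a player-1 state are listed in the
  order of the actions, those of other states in any order.  Everything except the transition
  probabilities is determined by the list; of these, it only gives the supports.
\<close>

definition state_class :: "('s, 'a, 'o, 'z) game_scheme \<Rightarrow> 's \<Rightarrow> nat" where
  "state_class G s = (if s \<in> S1 G then 0 else if s \<in> S2 G then 1 else 2)"

definition encodes :: "nat list \<Rightarrow> (nat, nat, nat, 'z) game_scheme \<Rightarrow> (nat \<Rightarrow> nat) \<Rightarrow> bool" where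
  "encodes xs G p \<longleftrightarrow>
     (\<exists>n k l succs.
        states G = {..<n} \<and> A1 G = {..<k} \<and> Obs G = {..<l} \<and>
        (\<forall>s\<in>S1 G. succs s = map (act G s) [0..<k]) \<and>
        (\<forall>s\<in>S2 G \<union> SX G. distinct (succs s) \<and> set (succs s) = {t. (s, t) \<in> E G}) \<and>
        xs = [n, k, l] @
          concat (map (\<lambda>s. [state_class G s, obs G s, p s, length (succs s)] @ succs s) [0..<n]))"

end

theory Submission
  imports Defs
begin

text \<open>
  Fixing a finite-memory strategy of player 1 turns \<open>G\<close> into a finite Markov decision process of
  player 2.  The strategy wins almost surely iff no reachable end component has an odd minimal
  priority: almost surely the set of vertices visited infinitely often is an end component, and
  player 2 realises a given end component with positive probability by choosing uniformly among the
  edges inside it.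

  In the three-player game a probabilistic state lets player 3 choose a threshold \<open>i\<close>, after which
  player 2 either pays with the even priority \<open>2 * i\<close> and picks the successor, or gets the odd
  priority \<open>2 * i + 1\<close> and leaves the choice to player 3.  In an odd end component with minimal priority
  \<open>2 * k + 1\<close>, player 2 picks the successor exactly for \<open>i > k\<close> and so wins.  If there is no such
  component, player 3 wins by recursion on sub-processes: on the attractor of the vertices of
  minimal priority \<open>c\<close> (for even \<open>c\<close>), or of the vertices that cannot reach priority \<open>c\<close> (for
  odd \<open>c\<close>; these exist, since otherwise a bottom component would be an odd end component), he uses
  the threshold \<open>c div 2\<close> and approaches the target.

  Observations made inside a gadget are constant and two in number, so memory can be transferred
  between the two games.
\<close>

section \<open>The measure on plays\<close>

text \<open>Plays of the two games are never compared. With player 1 fixed, both games are reduced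
  to finite graphs on pairs of a state of \<open>G\<close> and a memory value, and the equivalence
  passes through one property of such a graph: no reachable odd end component. This also bridges two
  kinds of strategies: a given strategy of player 3 may depend on the whole history and is refuted
  by a positional player 2, while the strategy built for player 3 is positional. The obstacle is
  memory. A gadget shows player 1 two extra observations, so the two graphs differ in the memory
  update at random states. In one direction the new observation is ignored; in the other a
  transducer for \<open>G\<close> must know when a random state has been left, which its
  observations need not reveal. Priorities are capped at the largest priority \<open>D\<close> of
  the input, so at most \<open>D + 1\<close> values occur. The cap may change a parity, but the
  result is then \<open>D\<close> itself: this is at least the minimum \<open>c\<close> of a
  component, which suffices for player 2, and player 3 uses only thresholds with
  \<open>2 * i \<le> D\<close>.\<close>

lemma measurable_map_upt:
  assumes "{0..<n} \<subseteq> J"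
  shows "(\<lambda>\<omega>. map \<omega> [0..<n]) \<in>
    measurable (PiM J (\<lambda>_. count_space (UNIV :: 's::countable set))) (count_space UNIV)"
  using assms
proof (induction n)
  case (Suc n)
  then have "{0..<n} \<subseteq> J" "n \<in> J" by auto
  then have "(\<lambda>\<omega>. (map \<omega> [0..<n], \<omega> n)) \<in>
      measurable (PiM J (\<lambda>_. count_space (UNIV :: 's set))) (count_space UNIV \<Otimes>\<^sub>M count_space UNIV)"
    by (intro measurable_Pair measurable_component_singleton Suc.IH)
  then have "(\<lambda>\<omega>. (\<lambda>(h, x). h @ [x]) (map \<omega> [0..<n], \<omega> n)) \<in>
      measurable (PiM J (\<lambda>_. count_space (UNIV :: 's set))) (count_space UNIV)"
    by (rule measurable_compose) (simp add: pair_measure_countable)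
  then show ?case by simp
qed simp

text \<open>The fairness lemma rests on a martingale that grows by the factor \<open>r\<close> at every visit
  without a step to \<open>w\<close> after time \<open>N\<close>, and vanishes after such a step; the history is reversed.\<close>

primrec fairness_martingale ::
    "('s list \<Rightarrow> bool) \<Rightarrow> 's \<Rightarrow> real \<Rightarrow> nat \<Rightarrow> 's list \<Rightarrow> real" where
  "fairness_martingale V w r N [] = 1"
| "fairness_martingale V w r N (x # h) =
     (if N \<le> length h \<and> V (rev h) then if x = w then 0 else r * fairness_martingale V w r N h
      else fairness_martingale V w r N h)"

lemma fairness_martingale_nonneg: "0 \<le> r \<Longrightarrow> 0 \<le> fairness_martingale V w r N h"
  by (induction h) auto

section \<open>One-step recursion, total mass and fairness of the play measure\<close>

context
  fixes G :: "('s::countable, 'a, 'o) stochastic_game" and \<sigma> :: "'s list \<Rightarrow> 'a"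
    and \<pi> :: "'s list \<Rightarrow> 's pmf" and s :: 's
begin

interpretation IT: Ionescu_Tulcea "play_kernel G \<sigma> \<pi> s" "\<lambda>_. count_space UNIV"
  by (rule Ionescu_Tulcea_play_kernel)

lemma sets_play_measure [measurable_cong]:
  "sets (play_measure G \<sigma> \<pi> s) = sets (PiM UNIV (\<lambda>_. count_space UNIV))"
  by (simp add: play_measure_def)

lemma space_play_measure [simp]: "space (play_measure G \<sigma> \<pi> s) = UNIV"
  using sets_eq_imp_space_eq[OF sets_play_measure] by (simp add: space_PiM)

lemma measurable_play_history [measurable]:
  "(\<lambda>\<omega>. map \<omega> [0..<n]) \<in> measurable (play_measure G \<sigma> \<pi> s) (count_space UNIV)"
  using measurable_map_upt[of n UNIV] by (simp add: measurable_cong_sets[OF sets_play_measure refl])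

lemma measurable_play_component [measurable]:
  "(\<lambda>\<omega>. \<omega> n) \<in> measurable (play_measure G \<sigma> \<pi> s) (count_space UNIV)"
  by (simp add: measurable_cong_sets[OF sets_play_measure refl] measurable_component_singleton)

text \<open>Total mass is preserved by taking marginals, and the marginal on the empty index set is
  already known to be a probability measure.\<close>

lemma prob_space_play_measure: "prob_space (play_measure G \<sigma> \<pi> s)"
proof -
  let ?r = "\<lambda>\<omega> :: nat \<Rightarrow> 's. restrict \<omega> {}"
  have "?r \<in> measurable (play_measure G \<sigma> \<pi> s) (PiM {} (\<lambda>_. count_space UNIV))"
    by (simp add: measurable_cong_sets[OF sets_play_measure refl])
  moreover have "distr (play_measure G \<sigma> \<pi> s) (PiM {} (\<lambda>_. count_space UNIV)) ?r =
      IT.CI {}"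
    using IT.distr_lim[of "{}"] by (simp add: play_measure_def)
  ultimately show ?thesis
    using prob_space_distrD[of ?r "play_measure G \<sigma> \<pi> s" "PiM {} (\<lambda>_. count_space UNIV)"]
      IT.PF.prob_space_P[of "{}"] by simp
qed

text \<open>The limit measure is accessible only through its finite marginals. The marginal on the
  first \<open>n\<close> coordinates is the iterated kernel \<open>C 0 n\<close>, which, unlike the
  limit, unfolds one step at a time.\<close>

lemma nn_integral_play_measure_C:
  fixes f :: "'s list \<Rightarrow> ennreal"
  shows "(\<integral>\<^sup>+\<omega>. f (map \<omega> [0..<n]) \<partial>play_measure G \<sigma> \<pi> s) =
    (\<integral>\<^sup>+\<omega>. f (map \<omega> [0..<n]) \<partial>IT.C 0 n (\<lambda>_. undefined))"
proof -
  have CI: "IT.CI {0..<n} = IT.C 0 n (\<lambda>_. undefined)"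
  proof (rule measure_eqI)
    show "sets (IT.CI {0..<n}) = sets (IT.C 0 n (\<lambda>_. undefined))"
      by (simp add: IT.sets_C IT.CI_def)
    fix A assume "A \<in> sets (IT.CI {0..<n})"
    then have A: "A \<in> sets (PiM {0..<n} (\<lambda>_. count_space UNIV))"
      by (simp add: IT.CI_def)
    then have "prod_emb {0..<n} (\<lambda>_. count_space UNIV) {0..<n} A = A"
      using sets.sets_into_space[OF A] by (intro prod_emb_id) (simp add: space_PiM)
    then show "emeasure (IT.CI {0..<n}) A = emeasure (IT.C 0 n (\<lambda>_. undefined)) A"
      using IT.emeasure_CI[OF order_refl A] by simp
  qed
  have m: "(\<lambda>\<omega>. f (map \<omega> [0..<n])) \<in> borel_measurable (PiM {0..<n} (\<lambda>_. count_space UNIV))"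
    by (rule measurable_compose[OF measurable_map_upt]) simp_all
  have "(\<integral>\<^sup>+\<omega>. f (map \<omega> [0..<n]) \<partial>IT.C 0 n (\<lambda>_. undefined)) =
     (\<integral>\<^sup>+\<omega>. f (map \<omega> [0..<n]) \<partial>distr IT.PF.lim (PiM {0..<n} (\<lambda>_. count_space UNIV)) (\<lambda>x. restrict x {0..<n}))"
    using IT.distr_lim[of "{0..<n}"] by (simp add: CI)
  also have "\<dots> = (\<integral>\<^sup>+\<omega>. f (map (restrict \<omega> {0..<n}) [0..<n]) \<partial>IT.PF.lim)"
    by (rule nn_integral_distr)
       (use m in \<open>auto simp: measurable_cong_sets[OF IT.PF.sets_lim refl] intro!: measurable_restrict\<close>)
  also have "(\<lambda>\<omega>. f (map (restrict \<omega> {0..<n}) [0..<n])) = (\<lambda>\<omega>. f (map \<omega> [0..<n]))"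
    by (intro ext arg_cong[where f = f]) simp
  finally show ?thesis by (simp add: play_measure_def)
qed

text \<open>Conditioning on the history of length \<open>n\<close>. All later probabilistic facts
  are derived from this equation. The first state is drawn by a kernel of its own, whence the case
  distinction on \<open>n\<close>.\<close>

lemma nn_integral_play_measure_Suc:
  fixes f :: "'s list \<Rightarrow> ennreal"
  shows "(\<integral>\<^sup>+\<omega>. f (map \<omega> [0..<Suc n]) \<partial>play_measure G \<sigma> \<pi> s) =
    (\<integral>\<^sup>+\<omega>. (\<integral>\<^sup>+x. f (map \<omega> [0..<n] @ [x])
        \<partial>measure_pmf (if n = 0 then return_pmf s else next_state G \<sigma> \<pi> (map \<omega> [0..<n]))) \<partial>play_measure G \<sigma> \<pi> s)"
proof -
  let ?M = "\<lambda>n. PiM {0..<n} (\<lambda>_. count_space (UNIV :: 's set))"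
  let ?N = "\<lambda>n h. measure_pmf (if n = 0 then return_pmf s else next_state G \<sigma> \<pi> h)"
  have m: "(\<lambda>\<omega>. f (map \<omega> [0..<n])) \<in> borel_measurable (?M n)" for n
    by (rule measurable_compose[OF measurable_map_upt]) simp_all
  have sp: "space (IT.C 0 n (\<lambda>_. undefined)) = space (?M n)"
    by (subst IT.space_C) simp_all
  have "(\<integral>\<^sup>+\<omega>. f (map \<omega> [0..<Suc n]) \<partial>play_measure G \<sigma> \<pi> s) =
      (\<integral>\<^sup>+\<omega>. f (map \<omega> [0..<Suc n]) \<partial>(IT.C 0 n (\<lambda>_. undefined) \<bind> IT.eP n))"
    unfolding nn_integral_play_measure_C by simp
  also have "\<dots> = (\<integral>\<^sup>+\<omega>. (\<integral>\<^sup>+\<omega>'. f (map \<omega>' [0..<Suc n]) \<partial>IT.eP n \<omega>) \<partial>IT.C 0 n (\<lambda>_. undefined))"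
    by (rule nn_integral_bind[OF m])
       (use IT.measurable_eP[of n] in \<open>simp add: measurable_cong_sets[OF IT.sets_C]\<close>)
  also have "\<dots> = (\<integral>\<^sup>+\<omega>. (\<integral>\<^sup>+x. f (map \<omega> [0..<n] @ [x]) \<partial>?N n (map \<omega> [0..<n])) \<partial>IT.C 0 n (\<lambda>_. undefined))"
  proof (rule nn_integral_cong)
    fix \<omega> assume "\<omega> \<in> space (IT.C 0 n (\<lambda>_. undefined))"
    then have \<omega>: "\<omega> \<in> space (?M n)" by (simp only: sp)
    have upd: "map (fun_upd \<omega> n x) [0..<Suc n] = map \<omega> [0..<n] @ [x]" for x by simp
    show "(\<integral>\<^sup>+\<omega>'. f (map \<omega>' [0..<Suc n]) \<partial>IT.eP n \<omega>) =
        (\<integral>\<^sup>+x. f (map \<omega> [0..<n] @ [x]) \<partial>?N n (map \<omega> [0..<n]))"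
      unfolding IT.nn_integral_eP[OF \<omega> m] upd play_kernel_def ..
  qed
  also have "\<dots> = (\<integral>\<^sup>+\<omega>. (\<integral>\<^sup>+x. f (map \<omega> [0..<n] @ [x]) \<partial>?N n (map \<omega> [0..<n])) \<partial>play_measure G \<sigma> \<pi> s)"
    by (rule nn_integral_play_measure_C[symmetric])
  finally show ?thesis .
qed

lemma AE_play_start: "AE \<omega> in play_measure G \<sigma> \<pi> s. \<omega> 0 = s"
proof -
  have "(\<integral>\<^sup>+\<omega>. indicator {h. h \<noteq> [s]} (map \<omega> [0..<Suc 0]) \<partial>play_measure G \<sigma> \<pi> s) = (0 :: ennreal)"
    unfolding nn_integral_play_measure_Suc by (simp add: nn_integral_return)
  then show ?thesis
    by (subst (asm) nn_integral_0_iff_AE) (auto split: split_indicator_asm)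
qed

lemma AE_play_step:
  "AE \<omega> in play_measure G \<sigma> \<pi> s. \<forall>n>0. \<omega> n \<in> set_pmf (next_state G \<sigma> \<pi> (map \<omega> [0..<n]))"
proof -
  have "AE \<omega> in play_measure G \<sigma> \<pi> s. n > 0 \<longrightarrow> \<omega> n \<in> set_pmf (next_state G \<sigma> \<pi> (map \<omega> [0..<n]))" for n
  proof (cases "n = 0")
    case False
    let ?B = "{h. last h \<notin> set_pmf (next_state G \<sigma> \<pi> (butlast h))}"
    have "(\<integral>\<^sup>+x. indicator ?B (h @ [x]) \<partial>measure_pmf (next_state G \<sigma> \<pi> h)) = (0 :: ennreal)" for h
      by (subst nn_integral_0_iff_AE) (auto simp: AE_measure_pmf_iff)
    then have "(\<integral>\<^sup>+\<omega>. indicator ?B (map \<omega> [0..<Suc n]) \<partial>play_measure G \<sigma> \<pi> s) = (0 :: ennreal)"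
      unfolding nn_integral_play_measure_Suc using False by simp
    then show ?thesis
      by (subst (asm) nn_integral_0_iff_AE) (auto simp: butlast_append split: split_indicator_asm)
  qed simp
  then show ?thesis by (simp add: AE_all_countable)
qed

text \<open>Iterated along a finite path, this shows that a path all of whose steps have positive
  probability is itself followed with positive probability.\<close>

lemma emeasure_play_history_pos:
  assumes "emeasure (play_measure G \<sigma> \<pi> s) {\<omega>. map \<omega> [0..<n] = h} > 0" and "n > 0"
    and "x \<in> set_pmf (next_state G \<sigma> \<pi> h)"
  shows "emeasure (play_measure G \<sigma> \<pi> s) {\<omega>. map \<omega> [0..<Suc n] = h @ [x]} > 0"
proof -
  let ?M = "play_measure G \<sigma> \<pi> s" and ?p = "next_state G \<sigma> \<pi> h"
  have [measurable]: "{\<omega>. map \<omega> [0..<k] = g} \<in> sets ?M" for k g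
    using measurable_sets[OF measurable_play_history[of k], of "{g}"] by (simp add: vimage_def)
  have "emeasure ?M {\<omega>. map \<omega> [0..<Suc n] = h @ [x]} =
      (\<integral>\<^sup>+\<omega>. indicator {h @ [x]} (map \<omega> [0..<Suc n]) \<partial>?M)"
  proof -
    have "(\<lambda>\<omega>. indicator {h @ [x]} (map \<omega> [0..<Suc n]) :: ennreal) =
        indicator {\<omega>. map \<omega> [0..<Suc n] = h @ [x]}"
      by (intro ext) (simp add: indicator_def del: upt_Suc)
    then show ?thesis by (simp del: upt_Suc)
  qed
  also have "\<dots> = (\<integral>\<^sup>+\<omega>. emeasure ?p {x} * indicator {\<omega>. map \<omega> [0..<n] = h} \<omega> \<partial>?M)"
    unfolding nn_integral_play_measure_Suc
  proof (intro nn_integral_cong)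
    fix \<omega> :: "nat \<Rightarrow> 's"
    show "(\<integral>\<^sup>+ y. indicator {h @ [x]} (map \<omega> [0..<n] @ [y])
            \<partial>measure_pmf (if n = 0 then return_pmf s else next_state G \<sigma> \<pi> (map \<omega> [0..<n]))) =
         emeasure ?p {x} * indicator {\<omega>. map \<omega> [0..<n] = h} \<omega>"
    proof (cases "map \<omega> [0..<n] = h")
      case True
      have "(\<lambda>y. indicator {h @ [x]} (h @ [y]) :: ennreal) = indicator {x}"
        by (auto split: split_indicator)
      then show ?thesis using True \<open>n > 0\<close> by simp
    qed simp
  qed
  also have "\<dots> = emeasure ?p {x} * emeasure ?M {\<omega>. map \<omega> [0..<n] = h}"
    by (rule nn_integral_cmult_indicator) simp
  finally show ?thesis
    using assms by (simp add: emeasure_pmf_single ennreal_zero_less_mult_iff pmf_positive)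
qed

text \<open>At a visit the step avoids \<open>w\<close> with probability at most
  \<open>1 - \<delta>\<close>, and the factor \<open>r = 1 / (1 - \<delta>)\<close> compensates
  exactly, so the expectation never increases. Histories in \<open>V\<close> are nonempty because
  the very first state is not drawn from \<open>next_state\<close>.\<close>

lemma nn_integral_fairness_martingale_le:
  assumes V: "\<And>h. V h \<Longrightarrow> h \<noteq> [] \<and> \<delta> \<le> pmf (next_state G \<sigma> \<pi> h) w"
    and \<delta>: "0 < \<delta>" "\<delta> < 1" and r: "r = 1 / (1 - \<delta>)"
  shows "(\<integral>\<^sup>+\<omega>. ennreal (fairness_martingale V w r N (rev (map \<omega> [0..<n]))) \<partial>play_measure G \<sigma> \<pi> s) \<le> 1"
proof (induction n)
  case 0
  then show ?case
    using prob_space.emeasure_space_1[OF prob_space_play_measure] by simp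
next
  case (Suc n)
  let ?g = "\<lambda>h. fairness_martingale V w r N (rev h)"
  have r0: "0 \<le> r" using \<delta> r by simp
  have step: "(\<integral>\<^sup>+x. ennreal (?g (h @ [x])) \<partial>measure_pmf (if n = 0 then return_pmf s else next_state G \<sigma> \<pi> h))
      \<le> ennreal (?g h)" if "length h = n" for h
  proof (cases "N \<le> length h \<and> V h")
    case True
    then have "n \<noteq> 0" using V that by auto
    let ?p = "next_state G \<sigma> \<pi> h"
    have "(\<integral>\<^sup>+x. ennreal (?g (h @ [x])) \<partial>?p) = (\<integral>\<^sup>+x. ennreal (r * ?g h) * indicator (- {w}) x \<partial>?p)"
      using True by (intro nn_integral_cong) (auto split: split_indicator)
    also have "\<dots> = ennreal (r * ?g h) * emeasure ?p (- {w})"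
      by (rule nn_integral_cmult_indicator) simp
    also have "emeasure ?p (- {w}) = ennreal (1 - pmf ?p w)"
      by (simp add: measure_pmf.emeasure_eq_measure measure_pmf.prob_compl[of "{w}", simplified]
            Compl_eq_Diff_UNIV measure_pmf_single)
    also have "\<dots> \<le> ennreal (1 - \<delta>)"
      using V[of h] True by (intro ennreal_leI) auto
    also have "ennreal (r * ?g h) * ennreal (1 - \<delta>) = ennreal (?g h)"
    proof -
      have "r * ?g h * (1 - \<delta>) = ?g h" using \<delta> by (simp add: r)
      then show ?thesis
        using \<delta> r0 fairness_martingale_nonneg[OF r0] by (metis diff_ge_0_iff_ge ennreal_mult less_imp_le mult_nonneg_nonneg)
    qed
    finally show ?thesis using \<open>n \<noteq> 0\<close> by (simp add: mult_left_mono)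
  qed (auto simp: measure_pmf.emeasure_space_1[simplified])
  have "(\<integral>\<^sup>+\<omega>. ennreal (?g (map \<omega> [0..<Suc n])) \<partial>play_measure G \<sigma> \<pi> s) \<le>
      (\<integral>\<^sup>+\<omega>. ennreal (?g (map \<omega> [0..<n])) \<partial>play_measure G \<sigma> \<pi> s)"
    unfolding nn_integral_play_measure_Suc[where f = "\<lambda>h. ennreal (?g h)"]
    by (rule nn_integral_mono) (rule step, simp)
  then show ?case using Suc by simp
qed

text \<open>A conditional Borel-Cantelli statement. By Fatou's lemma the uniform bound 1 on the
  expectations makes the liminf of the martingale almost surely finite, whereas infinitely many
  visits without a step to \<open>w\<close> after time \<open>N\<close> would push it above every
  power of \<open>r\<close>. A countable union over \<open>N\<close> finishes the argument.\<close>

lemma AE_play_fair: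
  assumes V: "\<And>h. V h \<Longrightarrow> h \<noteq> [] \<and> \<epsilon> \<le> pmf (next_state G \<sigma> \<pi> h) w" and \<epsilon>: "0 < \<epsilon>"
  shows "AE \<omega> in play_measure G \<sigma> \<pi> s.
    infinite {n. V (map \<omega> [0..<n])} \<longrightarrow> infinite {n. V (map \<omega> [0..<n]) \<and> \<omega> n = w}"
proof -
  \<comment> \<open>The bound \<open>\<epsilon>\<close> may equal 1, where
    \<open>1 / (1 - \<epsilon>)\<close> degenerates; the cap at one half makes \<open>r\<close> a
    genuine factor above 1.\<close>
  define \<delta> where "\<delta> = min \<epsilon> (1/2)"
  define r where "r = 1 / (1 - \<delta>)"
  have \<delta>: "0 < \<delta>" "\<delta> < 1" and r: "1 < r" using \<epsilon> by (auto simp: \<delta>_def r_def divide_simps)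
  have V': "V h \<Longrightarrow> h \<noteq> [] \<and> \<delta> \<le> pmf (next_state G \<sigma> \<pi> h) w" for h
    using V[of h] by (auto simp: \<delta>_def)
  let ?M = "play_measure G \<sigma> \<pi> s"
  let ?g = "\<lambda>N n \<omega>. ennreal (fairness_martingale V w r N (rev (map \<omega> [0..<n])))"
  have "AE \<omega> in ?M. (\<forall>n\<ge>N. V (map \<omega> [0..<n]) \<longrightarrow> \<omega> n \<noteq> w) \<longrightarrow> finite {n. V (map \<omega> [0..<n])}" for N
  proof -
    have [measurable]: "?g N n \<in> borel_measurable ?M" for n
      by (rule measurable_compose[OF measurable_play_history]) simp
    have "(\<integral>\<^sup>+\<omega>. liminf (\<lambda>n. ?g N n \<omega>) \<partial>?M) \<le> liminf (\<lambda>n. \<integral>\<^sup>+\<omega>. ?g N n \<omega> \<partial>?M)"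
      by (rule nn_integral_liminf) simp
    also have "\<dots> \<le> liminf (\<lambda>n. 1)"
      using nn_integral_fairness_martingale_le[OF V' \<delta> r_def]
      by (intro Liminf_mono always_eventually) simp
    finally have "(\<integral>\<^sup>+\<omega>. liminf (\<lambda>n. ?g N n \<omega>) \<partial>?M) \<noteq> \<infinity>"
      by (auto simp: Liminf_const top_unique)
    then have "AE \<omega> in ?M. liminf (\<lambda>n. ?g N n \<omega>) \<noteq> \<infinity>"
      by (intro nn_integral_PInf_AE) simp_all
    then show ?thesis
    proof eventually_elim
      case (elim \<omega>)
      show ?case
      proof (intro impI, rule ccontr)
        assume no: "\<forall>n\<ge>N. V (map \<omega> [0..<n]) \<longrightarrow> \<omega> n \<noteq> w" and inf: "infinite {n. V (map \<omega> [0..<n])}"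
        let ?K = "\<lambda>n. card {j\<in>{N..<n}. V (map \<omega> [0..<j])}"
        have g: "fairness_martingale V w r N (rev (map \<omega> [0..<n])) = r ^ ?K n" for n
        proof (induction n)
          case (Suc n)
          have "{j\<in>{N..<Suc n}. V (map \<omega> [0..<j])} =
             (if N \<le> n \<and> V (map \<omega> [0..<n]) then insert n {j\<in>{N..<n}. V (map \<omega> [0..<j])}
              else {j\<in>{N..<n}. V (map \<omega> [0..<j])})"
            by (auto simp: less_Suc_eq)
          then show ?case using Suc no by simp
        qed simp
        have bound: "ennreal (r ^ k) \<le> liminf (\<lambda>n. ?g N n \<omega>)" for k
        proof -
          have "infinite ({n. V (map \<omega> [0..<n])} - {..<N})" using inf by (simp add: Diff_infinite_finite)
          then obtain F where F: "F \<subseteq> {n. V (map \<omega> [0..<n])} - {..<N}" "finite F" "card F = k"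
            using infinite_arbitrarily_large by metis
          have "\<forall>n\<ge>Suc (Max (insert 0 F)). k \<le> ?K n"
          proof (intro allI impI)
            fix n assume n: "Suc (Max (insert 0 F)) \<le> n"
            have "j < n" if "j \<in> F" for j
            proof -
              have "j \<le> Max (insert 0 F)" by (rule Max_ge) (use that F in auto)
              then show ?thesis using n by linarith
            qed
            then have "F \<subseteq> {j\<in>{N..<n}. V (map \<omega> [0..<j])}" using F by auto
            then show "k \<le> ?K n" using F by (metis (no_types, lifting) card_mono finite_Collect_conjI finite_atLeastLessThan mem_Collect_eq finite_subset subsetI)
          qed
          then have "eventually (\<lambda>n. ennreal (r ^ k) \<le> ?g N n \<omega>) sequentially"
            unfolding g eventually_sequentially using r
            by (intro exI[of _ "Suc (Max (insert 0 F))"]) (auto intro!: ennreal_leI power_increasing)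
          then show ?thesis by (rule Liminf_bounded)
        qed
        obtain c where c: "liminf (\<lambda>n. ?g N n \<omega>) = ennreal c" "0 \<le> c"
          using elim by (cases "liminf (\<lambda>n. ?g N n \<omega>)") auto
        obtain k where "c < r ^ k" using real_arch_pow[OF r] by blast
        then show False using bound[of k] c r by (simp add: ennreal_le_iff)
      qed
    qed
  qed
  then have "AE \<omega> in ?M. \<forall>N. (\<forall>n\<ge>N. V (map \<omega> [0..<n]) \<longrightarrow> \<omega> n \<noteq> w) \<longrightarrow> finite {n. V (map \<omega> [0..<n])}"
    unfolding AE_all_countable by blast
  then show ?thesis
  proof eventually_elim
    case (elim \<omega>)
    show ?case
    proof (intro impI notI)
      assume inf: "infinite {n. V (map \<omega> [0..<n])}" and "finite {n. V (map \<omega> [0..<n]) \<and> \<omega> n = w}"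
      then obtain N where "{n. V (map \<omega> [0..<n]) \<and> \<omega> n = w} \<subseteq> {..<N}"
        using finite_nat_bounded by blast
      then have "\<forall>n\<ge>N. V (map \<omega> [0..<n]) \<longrightarrow> \<omega> n \<noteq> w" by force
      then show False using elim inf by blast
    qed
  qed
qed

end

lemma sets_parity:
  "parity p \<in> sets (play_measure G \<sigma> \<pi> (s::'s::countable))"
proof -
  let ?M = "play_measure G \<sigma> \<pi> s"
  have [measurable]: "Measurable.pred ?M (\<lambda>\<omega>. p (\<omega> i) = k)" for i k
    by (rule measurable_compose[OF measurable_play_component]) simp
  have "Measurable.pred ?M (\<lambda>\<omega>. infinite {i. p (\<omega> i) = k})" for k
    unfolding infinite_nat_iff_unbounded_le mem_Collect_eq by measurable
  then have "Measurable.pred ?M (\<lambda>\<omega>. even (LEAST k. infinite {i. p (\<omega> i) = k}))"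
    by (intro measurable_compose[OF measurable_Least]) simp_all
  then show ?thesis
    by (simp add: parity_def pred_def)
qed

section \<open>End components and the gadget\<close>

text \<open>The closure is \<open>\<^sup>+\<close> and not \<open>\<^sup>*\<close>, which excludes a
  single vertex without a loop: every vertex of \<open>U\<close> has a successor in
  \<open>U\<close>, so a play can remain there forever.\<close>

definition odd_end_component ::
    "('v \<times> 'v) set \<Rightarrow> 'v set \<Rightarrow> ('v \<Rightarrow> nat) \<Rightarrow> 'v set \<Rightarrow> bool" where
  "odd_end_component R VX p U \<longleftrightarrow> U \<noteq> {} \<and> (\<forall>u\<in>U \<inter> VX. R `` {u} \<subseteq> U) \<and>
     (\<forall>u\<in>U. \<forall>v\<in>U. (u, v) \<in> (R \<inter> U \<times> U)\<^sup>+) \<and> odd (Min (p ` U))"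

text \<open>
  Layer 0 holds the original vertices.  A random vertex \<open>v\<close> moves to layer \<open>3 + 2 * i\<close> for a
  threshold \<open>i\<close> chosen by player 3; there player 2 moves either to layer \<open>2 + 2 * i\<close> (priority
  \<open>2 * i\<close>), where he resolves the random choice, or to layer 1, where player 3 does.
\<close>

definition gadget_priority :: "('v \<Rightarrow> nat) \<Rightarrow> nat \<Rightarrow> nat \<Rightarrow> 'v \<Rightarrow> nat" where
  "gadget_priority p D l v = (if l = 0 then p v else if l = 1 then D else min (l - 2) D)"

text \<open>What remains of the three-player game once player 1 is fixed and player 3 has committed
  to a threshold \<open>ii v\<close> and an answer \<open>ww v\<close> at every random vertex: only
  player 2 still chooses. Keeping the layers apart from the vertices makes the definition
  independent of the numbering of states.\<close>

definition gadget_play ::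
    "('v \<times> 'v) set \<Rightarrow> 'v set \<Rightarrow> ('v \<Rightarrow> nat) \<Rightarrow> ('v \<Rightarrow> 'v) \<Rightarrow> (nat \<Rightarrow> nat) \<Rightarrow> (nat \<Rightarrow> 'v) \<Rightarrow> bool" where
  "gadget_play R VX ii ww lay v \<longleftrightarrow> lay 0 = 0 \<and> (\<forall>n.
     (lay n = 0 \<and> v n \<notin> VX \<and> lay (Suc n) = 0 \<and> (v n, v (Suc n)) \<in> R) \<or>
     (v n \<in> VX \<and>
       ((lay n = 0 \<and> lay (Suc n) = 3 + 2 * ii (v n) \<and> v (Suc n) = v n) \<or>
        (lay n = 3 + 2 * ii (v n) \<and> lay (Suc n) \<in> {1, 2 + 2 * ii (v n)} \<and> v (Suc n) = v n) \<or>
        (lay n = 2 + 2 * ii (v n) \<and> lay (Suc n) = 0 \<and> (v n, v (Suc n)) \<in> R) \<or>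
        (lay n = 1 \<and> lay (Suc n) = 0 \<and> v (Suc n) = ww (v n)))))"

definition even_limit :: "(nat \<Rightarrow> nat) \<Rightarrow> bool" where
  "even_limit f \<longleftrightarrow> even (LEAST k. infinite {n. f n = k})"

section \<open>Tails and macro steps of gadget plays\<close>

lemma infinite_shift_iff:
  fixes f :: "nat \<Rightarrow> 'b"
  shows "infinite {n. P (f (n + N))} \<longleftrightarrow> infinite {n. P (f n)}"
proof -
  have eq: "(\<lambda>n. n + N) ` {n. P (f (n + N))} = {n. P (f n)} - {..<N}"
  proof (intro equalityI subsetI)
    fix m assume "m \<in> {n. P (f n)} - {..<N}"
    then have "m = (m - N) + N" "P (f ((m - N) + N))" by auto
    then show "m \<in> (\<lambda>n. n + N) ` {n. P (f (n + N))}" by blast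
  qed auto
  have "infinite {n. P (f (n + N))} \<longleftrightarrow> infinite ((\<lambda>n. n + N) ` {n. P (f (n + N))})"
    by (subst finite_image_iff) (auto simp: inj_on_def)
  also have "\<dots> \<longleftrightarrow> infinite {n. P (f n)}"
    unfolding eq by simp
  finally show ?thesis .
qed

lemma even_limit_shift: "even_limit (\<lambda>n. f (n + N)) \<longleftrightarrow> even_limit f"
  unfolding even_limit_def by (simp only: infinite_shift_iff[where f = f and P = "\<lambda>y. y = _"])

lemma gadget_play_shift:
  "gadget_play R VX ii ww lay v \<Longrightarrow> lay N = 0 \<Longrightarrow>
     gadget_play R VX ii ww (\<lambda>n. lay (n + N)) (\<lambda>n. v (n + N))"
  unfolding gadget_play_def by simp

lemma gadget_play_cong:
  assumes "gadget_play R VX ii ww lay v" "\<And>n. v n \<in> V"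
    and "\<And>u. u \<in> V \<Longrightarrow> ii u = ii' u" "\<And>u. u \<in> V \<Longrightarrow> ww u = ww' u"
  shows "gadget_play R VX ii' ww' lay v"
  using assms unfolding gadget_play_def by simp

text \<open>Moves inside a gadget keep the vertex, so a claim about the vertices seen in layer 0
  extends to all positions.\<close>

lemma gadget_play_origin:
  assumes "gadget_play R VX ii ww lay v"
  shows "\<exists>m\<le>n. lay m = 0 \<and> v m = v n"
proof (induction n)
  case 0
  then show ?case using assms by (auto simp: gadget_play_def)
next
  case (Suc n)
  have "lay (Suc n) = 0 \<or> v (Suc n) = v n"
    using assms unfolding gadget_play_def by blast
  then show ?case using Suc le_SucI by (metis order_refl)
qed

text \<open>Macro steps from layer 0 to layer 0: one move at an ordinary vertex, three at a random
  one, the latter split by whether player 2 pays.\<close>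

lemma gadget_play_next:
  assumes g: "gadget_play R VX ii ww lay v" and n: "lay n = 0"
  obtains "v n \<notin> VX" "lay (n + 1) = 0" "(v n, v (n + 1)) \<in> R"
  | "v n \<in> VX" "lay (n + 2) = 2 + 2 * ii (v n)" "v (n + 2) = v n" "lay (n + 3) = 0" "(v n, v (n + 3)) \<in> R"
  | "v n \<in> VX" "lay (n + 2) = 1" "lay (n + 3) = 0" "v (n + 3) = ww (v n)"
proof (cases "v n \<in> VX")
  case False
  then have "lay (Suc n) = 0" "(v n, v (Suc n)) \<in> R" using g unfolding gadget_play_def by blast+
  then show ?thesis using False that(1) by simp
next
  case True
  have step: "\<And>k. (lay k = 0 \<and> v k \<notin> VX \<and> lay (Suc k) = 0 \<and> (v k, v (Suc k)) \<in> R) \<or>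
     (v k \<in> VX \<and>
       ((lay k = 0 \<and> lay (Suc k) = 3 + 2 * ii (v k) \<and> v (Suc k) = v k) \<or>
        (lay k = 3 + 2 * ii (v k) \<and> lay (Suc k) \<in> {1, 2 + 2 * ii (v k)} \<and> v (Suc k) = v k) \<or>
        (lay k = 2 + 2 * ii (v k) \<and> lay (Suc k) = 0 \<and> (v k, v (Suc k)) \<in> R) \<or>
        (lay k = 1 \<and> lay (Suc k) = 0 \<and> v (Suc k) = ww (v k))))"
    using g unfolding gadget_play_def by blast
  have 1: "lay (Suc n) = 3 + 2 * ii (v n)" "v (Suc n) = v n"
    using step[of n] True n by auto
  then have 2: "lay (Suc (Suc n)) \<in> {1, 2 + 2 * ii (v n)}" "v (Suc (Suc n)) = v n"
    using step[of "Suc n"] True by auto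
  from 2(1) consider "lay (Suc (Suc n)) = 1" | "lay (Suc (Suc n)) = 2 + 2 * ii (v n)" by auto
  then show ?thesis
  proof cases
    case 1
    then have "lay (Suc (Suc (Suc n))) = 0" "v (Suc (Suc (Suc n))) = ww (v n)"
      using step[of "Suc (Suc n)"] True 2(2) by auto
    with 1 show ?thesis using True that(3) by (simp add: numeral_3_eq_3)
  next
    case a: 2
    then have "lay (Suc (Suc (Suc n))) = 0" "(v n, v (Suc (Suc (Suc n)))) \<in> R"
      using step[of "Suc (Suc n)"] True 2(2) by auto
    with a 2(2) show ?thesis using True that(2) by (simp add: numeral_3_eq_3)
  qed
qed

text \<open>An attractor in which the vertices of \<open>VX\<close> cooperate and all others are
  adversarial: a gadget lets player 3 steer a random vertex unless player 2 pays. The last two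
  clauses say that the complement is closed under random moves and leaves every other vertex a move,
  so that it is again a process to which the recursion applies.\<close>

lemma attractor_exists:
  fixes R :: "('v \<times> 'v) set"
  assumes "finite V" "Tg \<subseteq> V"
  shows "\<exists>A (rank :: 'v \<Rightarrow> nat). Tg \<subseteq> A \<and> A \<subseteq> V \<and>
    (\<forall>v\<in>A - Tg. v \<in> VX \<longrightarrow> (\<exists>w\<in>A. (v, w) \<in> R \<and> rank w < rank v)) \<and>
    (\<forall>v\<in>A - Tg. v \<notin> VX \<longrightarrow> (\<forall>w\<in>V. (v, w) \<in> R \<longrightarrow> w \<in> A \<and> rank w < rank v)) \<and>
    (\<forall>v\<in>V - A. v \<in> VX \<longrightarrow> (\<forall>w\<in>A. (v, w) \<notin> R)) \<and>
    (\<forall>v\<in>V - A. v \<notin> VX \<longrightarrow> (\<exists>w\<in>V - A. (v, w) \<in> R))"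
proof -
  define F where "F B = B \<union> {v\<in>V. (v \<in> VX \<and> (\<exists>w\<in>B. (v, w) \<in> R)) \<or>
      (v \<notin> VX \<and> (\<forall>w\<in>V. (v, w) \<in> R \<longrightarrow> w \<in> B))}" for B
  define S where "S k = (F ^^ k) Tg" for k
  have S0: "S 0 = Tg" and SS: "S (Suc k) = F (S k)" for k by (simp_all add: S_def)
  have mono: "S j \<subseteq> S k" if "j \<le> k" for j k
    using that by (rule lift_Suc_mono_le[rotated]) (auto simp: SS F_def)
  have SV: "S k \<subseteq> V" for k by (induction k) (use assms in \<open>auto simp: S0 SS F_def\<close>)
  define A where "A = (\<Union>k. S k)"
  define rank where "rank v = (LEAST k. v \<in> S k)" for v
  have rankS: "v \<in> S (rank v)" if "v \<in> A" for v
    using that unfolding A_def rank_def by (auto intro: LeastI)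
  have rank_le: "v \<in> S k \<Longrightarrow> rank v \<le> k" for v k
    unfolding rank_def by (rule Least_le)
  have pred: "\<exists>k. rank v = Suc k \<and> v \<in> F (S k) \<and> v \<notin> S k" if "v \<in> A - Tg" for v
  proof (cases "rank v")
    case 0
    then show ?thesis using rankS[of v] that S0 by auto
  next
    case (Suc k)
    then show ?thesis using rankS[of v] that rank_le[of v k] by (auto simp: SS)
  qed
  have 1: "Tg \<subseteq> A" "A \<subseteq> V" unfolding A_def using S0 SV by blast+
  have 2: "\<exists>w\<in>A. (v, w) \<in> R \<and> rank w < rank v" if v: "v \<in> A - Tg" "v \<in> VX" for v
  proof -
    obtain k where k: "rank v = Suc k" "v \<in> F (S k)" "v \<notin> S k" using pred[OF v(1)] by blast
    then obtain w where "w \<in> S k" "(v, w) \<in> R" using v(2) by (auto simp: F_def)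
    then show ?thesis using k rank_le[of w k] unfolding A_def by force
  qed
  have 3: "w \<in> A \<and> rank w < rank v"
    if v: "v \<in> A - Tg" "v \<notin> VX" "w \<in> V" "(v, w) \<in> R" for v w
  proof -
    obtain k where k: "rank v = Suc k" "v \<in> F (S k)" "v \<notin> S k" using pred[OF v(1)] by blast
    then have "w \<in> S k" using v by (auto simp: F_def)
    then show ?thesis using k rank_le[of w k] unfolding A_def by force
  qed
  have 4: "(v, w) \<notin> R" if v: "v \<in> V - A" "v \<in> VX" "w \<in> A" for v w
  proof
    assume "(v, w) \<in> R"
    moreover obtain k where "w \<in> S k" using v unfolding A_def by blast
    ultimately have "v \<in> S (Suc k)" using v by (auto simp: SS F_def)
    then show False using v unfolding A_def by blast
  qed
  have 5: "\<exists>w\<in>V - A. (v, w) \<in> R" if v: "v \<in> V - A" "v \<notin> VX" for v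
  proof (rule ccontr)
    assume no: "\<not> (\<exists>w\<in>V - A. (v, w) \<in> R)"
    \<comment> \<open>Since \<open>K\<close> bounds all ranks, a vertex whose successors in
      \<open>V\<close> all lie in \<open>A\<close> has them all in stage \<open>K\<close> and would
      have joined by stage \<open>K + 1\<close>.\<close>
    define K where "K = Max (rank ` V)"
    have "w \<in> S K" if "w \<in> V" "(v, w) \<in> R" for w
    proof -
      have "w \<in> A" using no that by blast
      moreover have "rank w \<le> K" unfolding K_def using assms that by simp
      ultimately show ?thesis using rankS mono by blast
    qed
    then have "v \<in> S (Suc K)" using v by (auto simp: SS F_def)
    then show False using v unfolding A_def by blast
  qed
  show ?thesis
    using 1 2 3 4 5 by (intro exI[of _ A] exI[of _ rank]) blast
qed

text \<open>Take a vertex whose reachable set is as small as possible. Each vertex of that set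
  reaches the entire set, for otherwise its own reachable set would be smaller.\<close>

lemma bottom_component_exists:
  fixes R :: "('v \<times> 'v) set"
  assumes "finite V" "V \<noteq> {}" and succ: "\<And>v. v \<in> V \<Longrightarrow> \<exists>w\<in>V. (v, w) \<in> R"
  obtains v B where "v \<in> V" "B = (R \<inter> V \<times> V)\<^sup>* `` {v}" "B \<subseteq> V"
    "\<And>u w. u \<in> B \<Longrightarrow> w \<in> B \<Longrightarrow> (u, w) \<in> (R \<inter> B \<times> B)\<^sup>+"
proof -
  let ?Q = "R \<inter> V \<times> V"
  let ?r = "\<lambda>v. ?Q\<^sup>* `` {v}"
  have rV: "?r v \<subseteq> V" if "v \<in> V" for v
  proof
    fix u assume "u \<in> ?r v"
    then have "(v, u) \<in> ?Q\<^sup>*" by simp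
    then show "u \<in> V" by (induction) (use that in auto)
  qed
  obtain v where v: "v \<in> V" and min: "\<And>u. u \<in> V \<Longrightarrow> card (?r v) \<le> card (?r u)"
    using ex_has_least_nat[of "\<lambda>v. v \<in> V" _ "\<lambda>v. card (?r v)"] assms(2) by blast
  let ?B = "?r v"
  have BV: "?B \<subseteq> V" by (rule rV[OF v])
  have fin: "finite ?B" using BV assms(1) finite_subset by blast
  have eq: "?r u = ?B" if "u \<in> ?B" for u
  proof (rule card_subset_eq[OF fin])
    show "?r u \<subseteq> ?B" using that by (auto intro: rtrancl_trans)
    then show "card (?r u) = card ?B"
      using min[of u] that BV card_mono[OF fin] by (meson le_antisym subsetD)
  qed
  have star: "(u, w) \<in> (R \<inter> ?B \<times> ?B)\<^sup>*" if "u \<in> ?B" "(u, w) \<in> ?Q\<^sup>*" for u w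
    using that(2)
  proof induction
    case (step y z)
    then have "y \<in> ?B" "z \<in> ?B" using that(1) by (auto intro: rtrancl_trans rtrancl_into_rtrancl)
    then have "(y, z) \<in> R \<inter> ?B \<times> ?B" using step by blast
    then show ?case using step by (meson rtrancl_into_rtrancl)
  qed simp
  have "(u, w) \<in> (R \<inter> ?B \<times> ?B)\<^sup>+" if u: "u \<in> ?B" and w: "w \<in> ?B" for u w
  proof -
    obtain u1 where u1: "u1 \<in> V" "(u, u1) \<in> R" using succ u BV by blast
    then have q: "(u, u1) \<in> ?Q" using u BV by blast
    then have u1B: "u1 \<in> ?B" using u by (auto intro: rtrancl_into_rtrancl)
    then have "(u1, w) \<in> ?Q\<^sup>*" using eq[OF u1B] w by auto
    then have "(u1, w) \<in> (R \<inter> ?B \<times> ?B)\<^sup>*" by (rule star[OF u1B])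
    moreover have "(u, u1) \<in> R \<inter> ?B \<times> ?B" using q u u1B by blast
    ultimately show ?thesis by (meson rtrancl_into_trancl2)
  qed
  then show ?thesis using that[OF v refl BV] by blast
qed

text \<open>The first bound on \<open>ii\<close> keeps the even priority \<open>2 * ii v\<close>
  below the cap \<open>D\<close>. The second clause strengthens the induction: choices made for a
  sub-process must not introduce low priorities into the process around it. It ranges over all lower
  bounds \<open>c\<close>, because the enclosing process may have a smaller minimum than the
  sub-process.\<close>

definition gadget_winning ::
    "('v \<times> 'v) set \<Rightarrow> 'v set \<Rightarrow> ('v \<Rightarrow> nat) \<Rightarrow> nat \<Rightarrow> 'v set \<Rightarrow> ('v \<Rightarrow> nat) \<Rightarrow> ('v \<Rightarrow> 'v) \<Rightarrow> bool" where
  "gadget_winning R VX p D V ii ww \<longleftrightarrow>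
     (\<forall>v\<in>V. (v, ww v) \<in> R \<and> 2 * ii v \<le> D) \<and>
     (\<forall>c. (\<forall>v\<in>V. c \<le> p v) \<longrightarrow> (\<forall>v\<in>V. c \<le> 2 * ii v + 1)) \<and>
     (\<forall>lay v. gadget_play R VX ii ww lay v \<longrightarrow> (\<forall>n. v n \<in> V) \<longrightarrow>
        even_limit (\<lambda>n. gadget_priority p D (lay n) (v n)))"

lemma even_limit_least:
  assumes "\<And>n. x \<le> f n" "infinite {n. f n = x}" "even x"
  shows "even_limit f"
proof -
  have "(LEAST k. infinite {n. f n = k}) = x"
  proof (rule Least_equality)
    fix y assume "infinite {n. f n = y}"
    then obtain n where "f n = y" using not_finite_existsD by blast
    then show "x \<le> y" using assms(1) by blast
  qed (rule assms(2))
  then show ?thesis using assms(3) by (simp add: even_limit_def)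
qed

lemma gadget_winning_exists:
  fixes R :: "('v \<times> 'v) set"
  assumes "finite V" and "\<And>v. v \<in> V \<Longrightarrow> v \<in> VX \<Longrightarrow> R `` {v} \<subseteq> V"
    and "\<And>v. v \<in> V \<Longrightarrow> \<exists>w\<in>V. (v, w) \<in> R"
    and "\<And>U. U \<subseteq> V \<Longrightarrow> \<not> odd_end_component R VX p U"
    and "\<And>v. v \<in> V \<Longrightarrow> p v \<le> D"
  shows "\<exists>ii ww. gadget_winning R VX p D V ii ww"
  using assms
proof (induction "card V" arbitrary: V rule: less_induct)
  case less
  note fin = less.prems(1) and closed = less.prems(2) and succ = less.prems(3)
    and noodd = less.prems(4) and pD = less.prems(5)
  show ?case
  proof (cases "V = {}")
    case True
    then show ?thesis by (intro exI) (simp add: gadget_winning_def)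
  next
    case nonempty: False
    define c where "c = Min (p ` V)"
    have cle: "c \<le> p v" if "v \<in> V" for v
      unfolding c_def using that fin by simp
    have "c \<in> p ` V" unfolding c_def using fin nonempty by (intro Min_in) auto
    then obtain vc where vc: "vc \<in> V" "p vc = c" by blast
    have cD: "c \<le> D" using pD vc by blast
    let ?Q = "R \<inter> V \<times> V"
    define Tg where "Tg = (if even c then {v\<in>V. p v = c} else {v\<in>V. \<forall>u. (v, u) \<in> ?Q\<^sup>* \<longrightarrow> p u \<noteq> c})"
    have TgV: "Tg \<subseteq> V" by (auto simp: Tg_def)
    have TgNE: "Tg \<noteq> {}"
    proof (cases "even c")
      case False
      show ?thesis
      proof
        assume "Tg = {}"
        then have reach: "\<exists>u. (v, u) \<in> ?Q\<^sup>* \<and> p u = c" if "v \<in> V" for v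
          using that False unfolding Tg_def by auto
        obtain v B where B: "v \<in> V" "B = ?Q\<^sup>* `` {v}" "B \<subseteq> V"
          "\<And>u w. u \<in> B \<Longrightarrow> w \<in> B \<Longrightarrow> (u, w) \<in> (R \<inter> B \<times> B)\<^sup>+"
          using bottom_component_exists[OF fin nonempty succ] by metis
        obtain u where u: "u \<in> B" "p u = c" using reach[OF B(1)] B(2) by auto
        have "Min (p ` B) = c"
          using u B(3) cle fin by (intro Min_eqI) (auto intro: finite_subset)
        moreover have "R `` {w} \<subseteq> B" if "w \<in> B \<inter> VX" for w
        proof
          fix y assume "y \<in> R `` {w}"
          then have "(w, y) \<in> ?Q" using closed[of w] that B(3) by auto
          then show "y \<in> B" using that unfolding B(2) by (auto intro: rtrancl_into_rtrancl)
        qed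
        ultimately have "odd_end_component R VX p B"
          using False u B(4) by (auto simp: odd_end_component_def)
        then show False using noodd B(3) by blast
      qed
    qed (use vc in \<open>auto simp: Tg_def\<close>)
    obtain A and rank :: "'v \<Rightarrow> nat" where A: "Tg \<subseteq> A" "A \<subseteq> V"
      and A1: "\<And>v. v \<in> A - Tg \<Longrightarrow> v \<in> VX \<Longrightarrow> \<exists>w\<in>A. (v, w) \<in> R \<and> rank w < rank v"
      and A2: "\<And>v w. v \<in> A - Tg \<Longrightarrow> v \<notin> VX \<Longrightarrow> w \<in> V \<Longrightarrow> (v, w) \<in> R \<Longrightarrow> w \<in> A \<and> rank w < rank v"
      and A3: "\<And>v w. v \<in> V - A \<Longrightarrow> v \<in> VX \<Longrightarrow> w \<in> A \<Longrightarrow> (v, w) \<notin> R"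
      and A4: "\<And>v. v \<in> V - A \<Longrightarrow> v \<notin> VX \<Longrightarrow> \<exists>w\<in>V - A. (v, w) \<in> R"
    proof -
      obtain A and rank :: "'v \<Rightarrow> nat" where *: "Tg \<subseteq> A \<and> A \<subseteq> V \<and>
        (\<forall>v\<in>A - Tg. v \<in> VX \<longrightarrow> (\<exists>w\<in>A. (v, w) \<in> R \<and> rank w < rank v)) \<and>
        (\<forall>v\<in>A - Tg. v \<notin> VX \<longrightarrow> (\<forall>w\<in>V. (v, w) \<in> R \<longrightarrow> w \<in> A \<and> rank w < rank v)) \<and>
        (\<forall>v\<in>V - A. v \<in> VX \<longrightarrow> (\<forall>w\<in>A. (v, w) \<notin> R)) \<and>
        (\<forall>v\<in>V - A. v \<notin> VX \<longrightarrow> (\<exists>w\<in>V - A. (v, w) \<in> R))"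
        using attractor_exists[OF fin TgV, of VX R] by blast
      show thesis by (rule that[of A rank]) (use * in blast)+
    qed
    have c1: "card (V - A) < card V"
      using A TgNE fin by (intro psubset_card_mono) auto
    have "\<exists>ii ww. gadget_winning R VX p D (V - A) ii ww"
    proof (rule less.hyps[OF c1])
      show "R `` {v} \<subseteq> V - A" if "v \<in> V - A" "v \<in> VX" for v
        using closed[of v] A3[of v] that by blast
      show "\<exists>w\<in>V - A. (v, w) \<in> R" if "v \<in> V - A" for v
        using A4[of v] A3[of v] succ[of v] that by blast
    qed (use fin noodd pD in auto)
    then obtain ii1 ww1 where g1: "gadget_winning R VX p D (V - A) ii1 ww1" by blast
    \<comment> \<open>For odd \<open>c\<close> the target is closed under all edges inside
      \<open>V\<close> and contains no vertex of priority \<open>c\<close>; it is therefore a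
      smaller process, and its recursive strategy takes over on arrival. For even \<open>c\<close> a
      visit to the target already shows the priority \<open>c\<close>, so nothing more is required
      there.\<close>
    define Y where "Y = (if even c then {} else Tg)"
    have YV: "Y \<subseteq> V" "Y \<subseteq> A" using TgV A by (auto simp: Y_def)
    have Yc: "w \<in> Y" if "v \<in> Y" "(v, w) \<in> R" "w \<in> V" for v w
      using that by (auto simp: Y_def Tg_def split: if_splits intro: converse_rtrancl_into_rtrancl)
    have c2: "card Y < card V"
    proof (intro psubset_card_mono fin psubsetI YV)
      show "Y \<noteq> V" using vc by (auto simp: Y_def Tg_def)
    qed
    have "\<exists>ii ww. gadget_winning R VX p D Y ii ww"
    proof (rule less.hyps[OF c2])
      show "finite Y" using YV fin finite_subset by blast
      show "R `` {v} \<subseteq> Y" if "v \<in> Y" "v \<in> VX" for v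
        using closed[of v] Yc[of v] that YV by blast
      show "\<exists>w\<in>Y. (v, w) \<in> R" if "v \<in> Y" for v
        using succ[of v] Yc[of v] that YV by blast
    qed (use noodd pD YV in auto)
    then obtain ii2 ww2 where g2: "gadget_winning R VX p D Y ii2 ww2" by blast
    define ii where "ii v = (if v \<in> V - A then ii1 v else if v \<in> Y then ii2 v else c div 2)" for v
    \<comment> \<open>The last branch takes any edge: at a target of even \<open>c\<close> every
      continuation is acceptable, and at vertices that are not random player 2 or the action
      decides.\<close>
    define ww where "ww v = (if v \<in> V - A then ww1 v else if v \<in> Y then ww2 v
      else if v \<in> A - Tg \<and> v \<in> VX then SOME w. w \<in> A \<and> (v, w) \<in> R \<and> rank w < rank v
      else SOME w. (v, w) \<in> R)" for v
    have wwA: "ww v \<in> A \<and> (v, ww v) \<in> R \<and> rank (ww v) < rank v" if "v \<in> A - Tg" "v \<in> VX" for v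
    proof -
      have "ww v = (SOME w. w \<in> A \<and> (v, w) \<in> R \<and> rank w < rank v)"
        using that by (auto simp: ww_def Y_def)
      then show ?thesis using someI_ex[of "\<lambda>w. w \<in> A \<and> (v, w) \<in> R \<and> rank w < rank v"] A1[OF that] by auto
    qed
    have wwR: "(v, ww v) \<in> R" if "v \<in> V" for v
    proof -
      consider "v \<in> V - A" | "v \<in> Y" | "v \<in> A - Tg" "v \<in> VX" | "v \<notin> V - A" "v \<notin> Y" "\<not> (v \<in> A - Tg \<and> v \<in> VX)"
        by blast
      then show ?thesis
      proof cases
        case 1 then show ?thesis using g1 by (auto simp: ww_def gadget_winning_def)
      next
        case 2
        then have "v \<notin> V - A" using YV by blast
        with 2 have "ww v = ww2 v" by (auto simp: ww_def)
        then show ?thesis using g2 2 by (auto simp: gadget_winning_def)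
      next
        case 3 then show ?thesis using wwA by blast
      next
        case 4
        then have "ww v = (SOME w. (v, w) \<in> R)" by (auto simp: ww_def)
        then show ?thesis using succ[OF that] by (metis someI_ex)
      qed
    qed
    have ii2D: "2 * ii v \<le> D" if "v \<in> V" for v
      using that g1 g2 cD by (auto simp: ii_def gadget_winning_def)
    have iic: "m \<le> 2 * ii v + 1" if m: "\<forall>v\<in>V. m \<le> p v" and v: "v \<in> V" for m v
    proof -
      have "m \<le> c" using m vc by auto
      consider "v \<in> V - A" | "v \<notin> V - A" "v \<in> Y" | "v \<notin> V - A" "v \<notin> Y" by blast
      then show ?thesis
      proof cases
        case 1
        then have "m \<le> 2 * ii1 v + 1" using g1 m unfolding gadget_winning_def by blast
        moreover have "ii v = ii1 v" using 1 by (auto simp: ii_def)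
        ultimately show ?thesis by simp
      next
        case 2
        then have "m \<le> 2 * ii2 v + 1" using g2 m YV unfolding gadget_winning_def by blast
        moreover have "ii v = ii2 v" using 2 by (auto simp: ii_def)
        ultimately show ?thesis by simp
      next
        case 3
        then have "ii v = c div 2" by (auto simp: ii_def)
        then show ?thesis using \<open>m \<le> c\<close> by presburger
      qed
    qed
    \<comment> \<open>\<open>c\<close> rounded down to an even number, which is also the priority
      paid at threshold \<open>c div 2\<close>. No play shows anything smaller, so seeing
      \<open>x\<close> infinitely often wins; what remains are plays that eventually avoid
      it.\<close>
    define x where "x = 2 * (c div 2)"
    have x: "even x" "x \<le> c" by (auto simp: x_def)
    have xle: "x \<le> 2 * ii v" if "v \<in> V" for v
    proof -
      have "c \<le> 2 * ii v + 1" by (rule iic) (use cle that in auto)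
      then show ?thesis unfolding x_def by presburger
    qed
    have win: "even_limit (\<lambda>n. gadget_priority p D (lay n) (v n))"
      if gp: "gadget_play R VX ii ww lay v" and inV: "\<And>n. v n \<in> V" for lay v
    proof -
      let ?L = "\<lambda>n. gadget_priority p D (lay n) (v n)"
      have xL: "x \<le> ?L n" for n
      proof -
        have "lay n = 0 \<or> lay n = 1 \<or> lay n = 3 + 2 * ii (v n) \<or> lay n = 2 + 2 * ii (v n)"
          using gp unfolding gadget_play_def by blast
        then show ?thesis
          using xle[OF inV[of n]] cle[OF inV[of n]] x cD by (auto simp: gadget_priority_def)
      qed
      show ?thesis
      proof (cases "infinite {n. ?L n = x}")
        case True
        then show ?thesis using even_limit_least[of x ?L] xL x by blast
      next
        case False
        then obtain N0 where "{n. ?L n = x} \<subseteq> {..<N0}" using finite_nat_bounded by blast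
        then have N0: "?L n \<noteq> x" if "n \<ge> N0" for n using that by force
        have "\<exists>N\<ge>n. lay N = 0" for n
        proof (induction n)
          case 0
          then show ?case using gp by (auto simp: gadget_play_def)
        next
          case (Suc n)
          then obtain N where N: "N \<ge> n" "lay N = 0" by blast
          have "lay (N + 1) = 0 \<or> lay (N + 3) = 0"
            by (rule gadget_play_next[OF gp N(2)]) simp_all
          moreover have "N + 1 \<ge> Suc n" "N + 3 \<ge> Suc n" using N(1) by simp_all
          ultimately show ?case by blast
        qed
        then obtain N where N: "N \<ge> N0" "lay N = 0" by blast
        define lay' where "lay' n = lay (n + N)" for n
        define v' where "v' n = v (n + N)" for n
        have gp': "gadget_play R VX ii ww lay' v'"
          unfolding lay'_def[abs_def] v'_def[abs_def] by (rule gadget_play_shift[OF gp N(2)])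
        have inV': "v' n \<in> V" for n using inV by (simp add: v'_def)
        let ?L' = "\<lambda>n. gadget_priority p D (lay' n) (v' n)"
        have L': "?L' n \<noteq> x" for n using N0[of "n + N"] N by (simp add: lay'_def v'_def)
        \<comment> \<open>Paying at an attractor vertex outside the target would show
          \<open>x\<close>. As this no longer happens, every gadget there ends with the answer of
          player 3, and the rank falls until the target is reached.\<close>
        have toTg: "\<exists>m\<ge>n. lay' m = 0 \<and> v' m \<in> Tg" if "lay' n = 0" "v' n \<in> A" for n
          using that
        proof (induction "rank (v' n)" arbitrary: n rule: less_induct)
          case less
          show ?case
          proof (cases "v' n \<in> Tg")
            case False
            from gp' less.prems(1) show ?thesis
            proof (cases rule: gadget_play_next)
              case 1
              then have "v' (n + 1) \<in> A \<and> rank (v' (n + 1)) < rank (v' n)"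
                using A2 less.prems False inV' by blast
              then obtain m where "m \<ge> n + 1" "lay' m = 0 \<and> v' m \<in> Tg" using less.hyps 1(2) by blast
              then show ?thesis by (meson le_trans le_add1)
            next
              case 2
              have "ii (v' n) = c div 2" using less.prems False by (auto simp: ii_def Y_def)
              then have "?L' (n + 2) = x" using 2 x cD by (simp add: gadget_priority_def x_def)
              then show ?thesis using L' by blast
            next
              case 3
              then have "v' (n + 3) \<in> A \<and> rank (v' (n + 3)) < rank (v' n)"
                using wwA less.prems False by auto
              then obtain m where "m \<ge> n + 3" "lay' m = 0 \<and> v' m \<in> Tg" using less.hyps 3(3) by blast
              then show ?thesis by (meson le_trans le_add1)
            qed
          qed (use less.prems in blast)
        qed
        have "even_limit ?L'"
        proof (cases "\<exists>m. lay' m = 0 \<and> v' m \<in> Tg")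
          case True
          then obtain m where m: "lay' m = 0" "v' m \<in> Tg" by blast
          have "odd c"
          proof
            assume "even c"
            then have "?L' m = x" using m by (simp add: gadget_priority_def Tg_def x_def)
            then show False using L' by blast
          qed
          then have YT: "Y = Tg" by (simp add: Y_def)
          have inY: "v' (n + m) \<in> Y" for n
          proof (induction n)
            case (Suc n)
            have "v' (Suc (n + m)) = v' (n + m) \<or> (v' (n + m), v' (Suc (n + m))) \<in> R \<or>
                v' (Suc (n + m)) = ww (v' (n + m))"
              using gp' unfolding gadget_play_def by blast
            then have "v' (Suc (n + m)) = v' (n + m) \<or> (v' (n + m), v' (Suc (n + m))) \<in> R"
              using wwR[OF inV', of "n + m"] by auto
            then show ?case using Suc Yc[OF Suc] inV' by auto
          qed (use m YT in simp)
          have "gadget_play R VX ii2 ww2 (\<lambda>n. lay' (n + m)) (\<lambda>n. v' (n + m))"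
          proof (rule gadget_play_cong[OF gadget_play_shift[OF gp' m(1)]])
            show "v' (n + m) \<in> Y" for n by (rule inY)
            show "ii u = ii2 u" "ww u = ww2 u" if "u \<in> Y" for u
              using that YV by (auto simp: ii_def ww_def)
          qed
          then have "even_limit (\<lambda>n. ?L' (n + m))"
            using g2 inY unfolding gadget_winning_def by blast
          then show ?thesis by (simp add: even_limit_shift[where f = ?L'])
        next
          case False
          have in1: "v' n \<in> V - A" for n
          proof -
            obtain k where k: "lay' k = 0" "v' k = v' n"
              using gadget_play_origin[OF gp'] by blast
            then have "v' k \<notin> A" using toTg[of k] False by blast
            then show ?thesis using inV'[of n] k(2) by simp
          qed
          have "gadget_play R VX ii1 ww1 lay' v'"
            by (rule gadget_play_cong[OF gp' in1]) (simp_all add: ii_def ww_def)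
          then show ?thesis using g1 in1 unfolding gadget_winning_def by blast
        qed
        then show ?thesis
          using even_limit_shift[where f = ?L and N = N] by (simp add: lay'_def v'_def)
      qed
    qed
    show ?thesis
      unfolding gadget_winning_def using wwR ii2D iic win by blast
  qed
qed

section \<open>Almost-sure winning and end components\<close>

lemma infinite_nat_ge:
  fixes N :: nat
  assumes "infinite {n. P n}"
  obtains n where "n \<ge> N" "P n"
  using assms unfolding infinite_nat_iff_unbounded_le by blast

text \<open>Vertices outside \<open>U\<close> occur only finitely often altogether, since
  \<open>V\<close> is finite. After their last occurrence, the stretch between a visit to
  \<open>u\<close> and a later visit to \<open>v\<close> is a path inside \<open>U\<close>.\<close>

lemma infinitely_visited:
  assumes fin: "finite V" and xV: "\<And>n. x n \<in> V" and xR: "\<And>n. (x n, x (Suc n)) \<in> R"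
  defines "U \<equiv> {v. infinite {n::nat. x n = v}}"
  shows "U \<noteq> {}" "U \<subseteq> V" "\<exists>N. \<forall>n\<ge>N. x n \<in> U"
    "\<And>u v. u \<in> U \<Longrightarrow> v \<in> U \<Longrightarrow> (u, v) \<in> (R \<inter> U \<times> U)\<^sup>+"
    "(LEAST k. infinite {n. p (x n) = k}) = Min (p ` U)"
proof -
  show UV: "U \<subseteq> V"
  proof
    fix v assume "v \<in> U"
    then obtain n where "x n = v" unfolding U_def using not_finite_existsD by blast
    then show "v \<in> V" using xV by blast
  qed
  have "finite {n. x n \<in> V - U}"
  proof -
    have "{n. x n \<in> V - U} = (\<Union>v\<in>V - U. {n. x n = v})" by auto
    then show ?thesis using fin by (auto simp: U_def)
  qed
  then obtain N where "{n. x n \<in> V - U} \<subseteq> {..<N}" using finite_nat_bounded by blast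
  then have N: "x n \<in> U" if "n \<ge> N" for n using xV[of n] that by force
  then show "\<exists>N. \<forall>n\<ge>N. x n \<in> U" by blast
  show "U \<noteq> {}" using N by blast
  show "(u, v) \<in> (R \<inter> U \<times> U)\<^sup>+" if "u \<in> U" "v \<in> U" for u v
  proof -
    have uv: "infinite {n. x n = u}" "infinite {n. x n = v}" using that by (simp_all add: U_def)
    obtain i where i: "i \<ge> N" "x i = u" using infinite_nat_ge[OF uv(1)] .
    obtain j where j: "j \<ge> Suc i" "x j = v" using infinite_nat_ge[OF uv(2)] .
    have "(x i, x (Suc (i + k))) \<in> (R \<inter> U \<times> U)\<^sup>+" for k
    proof (induction k)
      case 0
      then show ?case using xR[of i] N i(1) by auto
    next
      case (Suc k)
      moreover have "(x (Suc (i + k)), x (Suc (i + Suc k))) \<in> R \<inter> U \<times> U"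
        using xR[of "Suc (i + k)"] N i(1) by auto
      ultimately show ?case by (meson trancl_into_trancl)
    qed
    from this[of "j - Suc i"] show ?thesis using i j by simp
  qed
  have finU: "finite U" using UV fin finite_subset by blast
  show "(LEAST k. infinite {n. p (x n) = k}) = Min (p ` U)"
  proof (rule Least_equality)
    have "Min (p ` U) \<in> p ` U" using finU \<open>U \<noteq> {}\<close> by (intro Min_in) auto
    then obtain u where u: "u \<in> U" "p u = Min (p ` U)" by auto
    have "{n. x n = u} \<subseteq> {n. p (x n) = Min (p ` U)}" using u by auto
    then show "infinite {n. p (x n) = Min (p ` U)}"
      using u(1) finite_subset unfolding U_def by blast
  next
    fix k assume "infinite {n. p (x n) = k}"
    then obtain n where "n \<ge> N" "p (x n) = k" by (rule infinite_nat_ge)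
    then show "Min (p ` U) \<le> k" using N finU by (auto intro!: Min_le)
  qed
qed

text \<open>The parameter \<open>f\<close> is the effect on the memory of the observations made inside a gadget.\<close>

definition product_edges ::
    "('s, 'a, 'o, 'z) game_scheme \<Rightarrow> ('a, 'o) transducer \<Rightarrow> (nat \<Rightarrow> nat) \<Rightarrow> (('s \<times> nat) \<times> ('s \<times> nat)) set" where
  "product_edges G T f =
     {((s, m), (t, upd T (if s \<in> SX G then f m else m) (obs G t))) | s m t.
        m \<in> mem T \<and> (if s \<in> S1 G then t = act G s (nxt T m) else (s, t) \<in> E G)}"

section \<open>Products of a game with a transducer\<close>

lemma product_edges_iff:
  "((x, m), w) \<in> product_edges G T f \<longleftrightarrow> m \<in> mem T \<and>
     w = (fst w, upd T (if x \<in> SX G then f m else m) (obs G (fst w))) \<and>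
     (if x \<in> S1 G then fst w = act G x (nxt T m) else (x, fst w) \<in> E G)"
  by (cases w) (auto simp: product_edges_def)

definition random_vertices :: "('s, 'a, 'o, 'z) game_scheme \<Rightarrow> ('s \<times> nat) set" where
  "random_vertices G = SX G \<times> UNIV"

definition memory_state ::
    "('s, 'a, 'o, 'z) game_scheme \<Rightarrow> ('a, 'o) transducer \<Rightarrow> 's list \<Rightarrow> nat" where
  "memory_state G T h = foldl (upd T) (init T) (map (obs G) h)"

definition history_vertex ::
    "('s, 'a, 'o, 'z) game_scheme \<Rightarrow> ('a, 'o) transducer \<Rightarrow> 's list \<Rightarrow> 's \<times> nat" where
  "history_vertex G T h = (last h, memory_state G T h)"

lemma history_vertex_append:
  "history_vertex G T (h @ [t]) = (t, upd T (snd (history_vertex G T h)) (obs G t))"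
  by (simp add: history_vertex_def memory_state_def)

section \<open>The stochastic game under a fixed transducer: almost-sure winning versus end
  components\<close>

context
  fixes G :: "('s::countable, 'a, 'o) stochastic_game" and T :: "('a, 'o) transducer" and s :: 's
    and p :: "'s \<Rightarrow> nat"
  assumes G: "stochastic_game G" and T: "transducer G T" and s: "s \<in> states G"
begin

abbreviation (input) "vx \<equiv> history_vertex G T"
abbreviation (input) "R \<equiv> product_edges G T id"
abbreviation (input) "v0 \<equiv> (s, upd T (init T) (obs G s))"

lemma stochastic_game_graph: "game_graph G"
  using G by (simp add: stochastic_game_def)

lemma finite_vertices: "finite (states G \<times> mem T)"
  using stochastic_game_graph T by (auto simp: game_graph_def transducer_def)

lemma start_vertex: "vx [s] = v0" "v0 \<in> states G \<times> mem T"
  using stochastic_game_graph T s by (auto simp: history_vertex_def memory_state_def transducer_def game_graph_def)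

lemma product_edges_id_iff:
  "((x, m), w) \<in> R \<longleftrightarrow> m \<in> mem T \<and> w = (fst w, upd T m (obs G (fst w))) \<and>
     (if x \<in> S1 G then fst w = act G x (nxt T m) else (x, fst w) \<in> E G)"
  unfolding product_edges_iff id_apply if_cancel ..

lemma product_edges_range:
  assumes "(v, w) \<in> R"
  shows "w \<in> states G \<times> mem T"
proof -
  obtain x m where v: "v = (x, m)" by (cases v)
  have e: "m \<in> mem T" "w = (fst w, upd T m (obs G (fst w)))"
    "if x \<in> S1 G then fst w = act G x (nxt T m) else (x, fst w) \<in> E G"
    using assms unfolding v product_edges_id_iff by blast+
  have "fst w \<in> states G"
    using e(1,3) stochastic_game_graph T by (cases "x \<in> S1 G") (auto simp: game_graph_def transducer_def states_def)
  moreover have "upd T m (obs G (fst w)) \<in> mem T"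
    using e(1) stochastic_game_graph T calculation by (auto simp: game_graph_def transducer_def)
  ultimately show ?thesis by (subst e(2)) simp
qed

lemma random_support: "x \<in> SX G \<Longrightarrow> t \<in> set_pmf (trans_prob G x) \<longleftrightarrow> (x, t) \<in> E G"
proof -
  assume "x \<in> SX G"
  moreover obtain E' where "E' \<subseteq> S2 G \<times> SX G"
    "E G = {(s, t). s \<in> SX G \<and> pmf (trans_prob G s) t > 0} \<union> E'"
    using G unfolding stochastic_game_def by blast
  moreover have "S2 G \<inter> SX G = {}" using stochastic_game_graph by (simp add: game_graph_def)
  ultimately show ?thesis by (auto simp: set_pmf_iff order.strict_iff_order)
qed

lemma next_state_edge:
  assumes \<pi>: "player2_strategy G \<pi>" and h: "h \<noteq> []" "vx h \<in> states G \<times> mem T"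
    and t: "t \<in> set_pmf (next_state G (transducer_strategy G T) \<pi> h)"
  shows "(vx h, vx (h @ [t])) \<in> R"
proof -
  have m: "memory_state G T h \<in> mem T" "last h \<in> states G" using h by (auto simp: history_vertex_def)
  consider "last h \<in> S1 G" | "last h \<in> S2 G" "last h \<notin> S1 G" | "last h \<in> SX G" "last h \<notin> S1 G" "last h \<notin> S2 G"
    using m stochastic_game_graph by (auto simp: states_def game_graph_def)
  then have "if last h \<in> S1 G then t = act G (last h) (nxt T (memory_state G T h)) else (last h, t) \<in> E G"
  proof cases
    case 1
    then show ?thesis using t by (simp add: next_state_def transducer_strategy_def memory_state_def)
  next
    case 2
    then show ?thesis using t \<pi> h(1) by (auto simp: next_state_def player2_strategy_def)
  next
    case 3
    then show ?thesis using t random_support by (simp add: next_state_def)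
  qed
  then show ?thesis
    using m unfolding history_vertex_append by (simp add: history_vertex_def product_edges_id_iff)
qed

lemma play_vertices:
  assumes \<pi>: "player2_strategy G \<pi>"
    and start: "\<omega> 0 = s"
    and step: "\<forall>n>0. \<omega> n \<in> set_pmf (next_state G (transducer_strategy G T) \<pi> (map \<omega> [0..<n]))"
  shows "vx (map \<omega> [0..<Suc n]) \<in> states G \<times> mem T"
    and "(vx (map \<omega> [0..<Suc n]), vx (map \<omega> [0..<Suc (Suc n)])) \<in> R"
    and "(v0, vx (map \<omega> [0..<Suc n])) \<in> R\<^sup>*"
proof -
  have edge: "(vx (map \<omega> [0..<Suc n]), vx (map \<omega> [0..<Suc (Suc n)])) \<in> R"
    if "vx (map \<omega> [0..<Suc n]) \<in> states G \<times> mem T" for n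
  proof -
    have "\<omega> (Suc n) \<in> set_pmf (next_state G (transducer_strategy G T) \<pi> (map \<omega> [0..<Suc n]))"
      using step by blast
    from next_state_edge[OF \<pi> _ that this] show ?thesis by simp
  qed
  have *: "vx (map \<omega> [0..<Suc n]) \<in> states G \<times> mem T \<and> (v0, vx (map \<omega> [0..<Suc n])) \<in> R\<^sup>*" for n
  proof (induction n)
    case 0
    then show ?case using start start_vertex by simp
  next
    case (Suc n)
    have e: "(vx (map \<omega> [0..<Suc n]), vx (map \<omega> [0..<Suc (Suc n)])) \<in> R"
      by (rule edge) (use Suc in blast)
    then show ?case using Suc product_edges_range[OF e] by (meson rtrancl_into_rtrancl)
  qed
  show "vx (map \<omega> [0..<Suc n]) \<in> states G \<times> mem T" "(v0, vx (map \<omega> [0..<Suc n])) \<in> R\<^sup>*"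
    using * by blast+
  show "(vx (map \<omega> [0..<Suc n]), vx (map \<omega> [0..<Suc (Suc n)])) \<in> R"
    by (rule edge) (use * in blast)
qed

text \<open>Index shift between the fairness lemma, which speaks of nonempty histories, and the
  vertex sequence, whose entry \<open>n\<close> belongs to the history of length
  \<open>n + 1\<close>.\<close>

lemma infinite_vertex_history:
  "infinite {n. map \<omega> [0..<n] \<noteq> [] \<and> vx (map \<omega> [0..<n]) = v \<and> Q n} \<longleftrightarrow>
     infinite {n. vx (map \<omega> [0..<Suc n]) = v \<and> Q (Suc n)}"
proof -
  have eq: "{n. map \<omega> [0..<n] \<noteq> [] \<and> vx (map \<omega> [0..<n]) = v \<and> Q n} =
      Suc ` {n. vx (map \<omega> [0..<Suc n]) = v \<and> Q (Suc n)}" (is "?A = ?B")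
  proof (intro equalityI subsetI)
    fix n assume n: "n \<in> ?A"
    then obtain k where "n = Suc k" by (cases n) auto
    then show "n \<in> ?B" using n by blast
  qed auto
  show ?thesis unfolding eq by (subst finite_image_iff) auto
qed

text \<open>Fairness is proved for the next state; since the memory is updated deterministically, it
  carries over to the next vertex.\<close>

lemma fair_successor:
  assumes "v = vx (map \<omega> [0..<Suc n])"
    and "infinite {n. map \<omega> [0..<n] \<noteq> [] \<and> vx (map \<omega> [0..<n]) = v} \<longrightarrow>
         infinite {n. (map \<omega> [0..<n] \<noteq> [] \<and> vx (map \<omega> [0..<n]) = v) \<and> \<omega> n = t}"
    and "infinite {n. vx (map \<omega> [0..<Suc n]) = v}"
  shows "infinite {n. vx (map \<omega> [0..<Suc n]) = (t, upd T (snd v) (obs G t))}"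
proof -
  have "infinite {n. map \<omega> [0..<n] \<noteq> [] \<and> vx (map \<omega> [0..<n]) = v \<and> \<omega> n = t}"
    using assms(2,3) infinite_vertex_history[where Q = "\<lambda>_. True"] by (simp del: upt_Suc)
  then have "infinite {n. vx (map \<omega> [0..<Suc n]) = v \<and> \<omega> (Suc n) = t}"
    unfolding infinite_vertex_history .
  moreover have "vx (map \<omega> [0..<Suc (Suc n)]) = (t, upd T (snd v) (obs G t))"
    if "vx (map \<omega> [0..<Suc n]) = v \<and> \<omega> (Suc n) = t" for n
    using that history_vertex_append[of G T "map \<omega> [0..<Suc n]" t] by simp
  then have "{n. vx (map \<omega> [0..<Suc n]) = v \<and> \<omega> (Suc n) = t} \<subseteq>
      {n. vx (map \<omega> [0..<Suc (n + 1)]) = (t, upd T (snd v) (obs G t))}" by auto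
  ultimately have "infinite {n. vx (map \<omega> [0..<Suc (n + 1)]) = (t, upd T (snd v) (obs G t))}"
    using finite_subset by blast
  then show ?thesis
    by (rule iffD1[OF infinite_shift_iff[where f = "\<lambda>n. vx (map \<omega> [0..<Suc n])" and N = 1
          and P = "\<lambda>y. y = (t, upd T (snd v) (obs G t))"]])
qed

text \<open>The only probabilistic ingredient is that the set of vertices visited infinitely often
  is closed under random moves, which is fairness with the transition probability as lower bound.
  There are countably many pairs of a vertex and a successor, so one null set serves them
  all.\<close>

lemma almost_sure_winning_if:
  assumes no: "\<And>U. U \<subseteq> R\<^sup>* `` {v0} \<Longrightarrow> \<not> odd_end_component R (random_vertices G) (p \<circ> fst) U"
  shows "almost_sure_winning G p (transducer_strategy G T) s"
  unfolding almost_sure_winning_def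
proof (intro allI impI)
  fix \<pi> assume \<pi>: "player2_strategy G \<pi>"
  let ?M = "play_measure G (transducer_strategy G T) \<pi> s"
  let ?N = "next_state G (transducer_strategy G T) \<pi>"
  interpret M: prob_space ?M by (rule prob_space_play_measure)
  have fair: "AE \<omega> in ?M. fst v \<in> SX G \<and> (fst v, t) \<in> E G \<longrightarrow>
      infinite {n. map \<omega> [0..<n] \<noteq> [] \<and> vx (map \<omega> [0..<n]) = v} \<longrightarrow>
      infinite {n. (map \<omega> [0..<n] \<noteq> [] \<and> vx (map \<omega> [0..<n]) = v) \<and> \<omega> n = t}" for v t
  proof (cases "fst v \<in> SX G \<and> (fst v, t) \<in> E G")
    case True
    have "AE \<omega> in ?M. infinite {n. map \<omega> [0..<n] \<noteq> [] \<and> vx (map \<omega> [0..<n]) = v} \<longrightarrow>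
      infinite {n. (map \<omega> [0..<n] \<noteq> [] \<and> vx (map \<omega> [0..<n]) = v) \<and> \<omega> n = t}"
    proof (rule AE_play_fair[where \<epsilon> = "pmf (trans_prob G (fst v)) t"])
      show "0 < pmf (trans_prob G (fst v)) t"
        using True random_support by (simp add: pmf_positive)
      fix h assume h: "h \<noteq> [] \<and> vx h = v"
      then have "last h = fst v" by (auto simp: history_vertex_def)
      moreover have "fst v \<notin> S1 G" "fst v \<notin> S2 G" using True stochastic_game_graph by (auto simp: game_graph_def)
      ultimately show "h \<noteq> [] \<and> pmf (trans_prob G (fst v)) t \<le> pmf (?N h) t"
        using h by (simp add: next_state_def)
    qed
    then show ?thesis by simp
  next
    case False
    show ?thesis by (rule AE_I2) (use False in blast)
  qed
  have "AE \<omega> in ?M. \<forall>v t. fst v \<in> SX G \<and> (fst v, t) \<in> E G \<longrightarrow>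
      infinite {n. map \<omega> [0..<n] \<noteq> [] \<and> vx (map \<omega> [0..<n]) = v} \<longrightarrow>
      infinite {n. (map \<omega> [0..<n] \<noteq> [] \<and> vx (map \<omega> [0..<n]) = v) \<and> \<omega> n = t}"
    unfolding AE_all_countable using fair by blast
  then have "AE \<omega> in ?M. \<omega> \<in> parity p"
    using AE_play_start AE_play_step
  proof eventually_elim
    case (elim \<omega>)
    define x where "x n = vx (map \<omega> [0..<Suc n])" for n
    note pv = play_vertices[OF \<pi> elim(2,3), folded x_def]
    have xR: "(x n, x (Suc n)) \<in> R" for n using pv(2) by (simp only: x_def)
    define U where "U = {v. infinite {n. x n = v}}"
    note inf = infinitely_visited[where x = x, OF finite_vertices pv(1) xR, folded U_def]
    have "R `` {u} \<subseteq> U" if u: "u \<in> U \<inter> random_vertices G" for u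
    proof
      fix w assume "w \<in> R `` {u}"
      then have e: "(u, w) \<in> R" by simp
      have SX: "fst u \<in> SX G" using u by (auto simp: random_vertices_def)
      then have "fst u \<notin> S1 G" using stochastic_game_graph by (auto simp: game_graph_def)
      then have uw: "(fst u, fst w) \<in> E G" "w = (fst w, upd T (snd u) (obs G (fst w)))" "fst u \<in> SX G"
        using e SX product_edges_id_iff[of "fst u" "snd u" w] by simp_all
      have "infinite {n. x n = u}" using u by (simp add: U_def)
      then obtain n where "u = x n" using not_finite_existsD by blast
      then have "infinite {n. x n = (fst w, upd T (snd u) (obs G (fst w)))}"
        using fair_successor[of u \<omega> n "fst w"] elim(1) uw \<open>infinite {n. x n = u}\<close>
        unfolding x_def by blast
      then show "w \<in> U" using uw(2) unfolding U_def by simp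
    qed
    moreover have "U \<subseteq> R\<^sup>* `` {v0}"
    proof
      fix u assume "u \<in> U"
      then obtain n where "x n = u" unfolding U_def using not_finite_existsD by blast
      then show "u \<in> R\<^sup>* `` {v0}" using pv(3)[of n] by blast
    qed
    ultimately have "even (Min ((p \<circ> fst) ` U))"
      using no[of U] inf(1,4) by (auto simp: odd_end_component_def)
    then have "even (LEAST k. infinite {n. (p \<circ> fst) (x n) = k})"
      by (simp only: inf(5))
    moreover have "(p \<circ> fst) (x n) = p (\<omega> n)" for n
      by (simp add: x_def history_vertex_def)
    ultimately show ?case by (simp add: parity_def)
  qed
  then show "M.prob (parity p) = 1"
    using M.prob_eq_1[OF sets_parity] by blast
qed

text \<open>Uniform choices give every permitted edge positive probability. Hence some history
  enters \<open>U\<close> with positive probability, the play never leaves \<open>U\<close>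
  afterwards, and fairness makes it visit all of \<open>U\<close> infinitely often.\<close>

lemma not_almost_sure_winning_if:
  assumes U: "U \<subseteq> R\<^sup>* `` {v0}" "odd_end_component R (random_vertices G) (p \<circ> fst) U"
  shows "\<not> almost_sure_winning G p (transducer_strategy G T) s"
proof
  assume win: "almost_sure_winning G p (transducer_strategy G T) s"
  have conn: "(u, v) \<in> (R \<inter> U \<times> U)\<^sup>+" if "u \<in> U" "v \<in> U" for u v
    using U(2) that by (auto simp: odd_end_component_def)
  have succU: "\<exists>w\<in>U. (u, w) \<in> R" if "u \<in> U" for u
    using tranclD[OF conn[OF that that]] by blast
  \<comment> \<open>Outside \<open>U\<close> all edges are permitted, so that every path towards
    \<open>U\<close> remains possible; inside \<open>U\<close> only those that stay there.\<close>
  define Q where "Q v = {t. (fst v, t) \<in> E G \<and> (v \<in> U \<longrightarrow> (t, upd T (snd v) (obs G t)) \<in> U)}" for v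
  define nx where "nx v = (if fst v \<in> S1 G then return_pmf (act G (fst v) (nxt T (snd v)))
      else if fst v \<in> S2 G then pmf_of_set (Q v) else trans_prob G (fst v))" for v
  define \<pi> where "\<pi> h = pmf_of_set (Q (vx h))" for h
  have finQ: "finite (Q v)" for v
  proof (rule finite_subset)
    show "Q v \<subseteq> states G" using stochastic_game_graph by (auto simp: Q_def game_graph_def)
  qed (use stochastic_game_graph in \<open>simp add: game_graph_def\<close>)
  have Qne: "Q v \<noteq> {}" if "fst v \<in> S2 G" for v
  proof (cases "v \<in> U")
    case True
    then obtain w where "w \<in> U" "(v, w) \<in> R" using succU by blast
    then show ?thesis using that stochastic_game_graph product_edges_id_iff[of "fst v" "snd v" w]
      by (auto simp: Q_def game_graph_def split: if_splits)
  next
    case False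
    then show ?thesis using that stochastic_game_graph by (auto simp: Q_def game_graph_def)
  qed
  have \<pi>: "player2_strategy G \<pi>"
    unfolding player2_strategy_def
  proof (intro allI impI)
    fix h assume h: "h \<noteq> [] \<and> last h \<in> S2 G"
    then have "Q (vx h) \<noteq> {}" by (intro Qne) (simp add: history_vertex_def)
    then show "set_pmf (\<pi> h) \<subseteq> {t. (last h, t) \<in> E G}"
      using finQ by (auto simp: \<pi>_def set_pmf_of_set) (auto simp: Q_def history_vertex_def)
  qed
  let ?M = "play_measure G (transducer_strategy G T) \<pi> s"
  let ?N = "next_state G (transducer_strategy G T) \<pi>"
  interpret M: prob_space ?M by (rule prob_space_play_measure)
  have sets_history: "{\<omega>. map \<omega> [0..<n] = h} \<in> sets ?M" for n h
    using measurable_sets[OF measurable_play_history, of "{h}"] by (simp add: vimage_def)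
  have next_eq: "?N h = nx (vx h)" for h
    by (simp add: next_state_def nx_def history_vertex_def \<pi>_def transducer_strategy_def memory_state_def)
  have supp: "fst w \<in> set_pmf (nx v)" if "(v, w) \<in> R" "v \<in> U \<longrightarrow> w \<in> U" "v \<in> states G \<times> mem T" for v w
  proof -
    have w: "w = (fst w, upd T (snd v) (obs G (fst w)))"
      "if fst v \<in> S1 G then fst w = act G (fst v) (nxt T (snd v)) else (fst v, fst w) \<in> E G"
      using that(1) product_edges_id_iff[of "fst v" "snd v" w] by auto
    consider "fst v \<in> S1 G" | "fst v \<in> S2 G" "fst v \<notin> S1 G" | "fst v \<in> SX G" "fst v \<notin> S1 G" "fst v \<notin> S2 G"
      using \<open>v \<in> states G \<times> mem T\<close> by (auto simp: states_def mem_Times_iff)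
    then show ?thesis
    proof cases
      case 1
      then show ?thesis using w by (simp add: nx_def)
    next
      case 2
      then have "fst w \<in> Q v" using w that(2) by (auto simp: Q_def)
      then show ?thesis using 2 finQ Qne by (simp add: nx_def set_pmf_of_set)
    next
      case 3
      then show ?thesis using w random_support by (simp add: nx_def)
    qed
  qed
  have stay: "w \<in> U" if v: "v \<in> U" and e: "(v, w) \<in> R" and t: "fst w \<in> set_pmf (nx v)" for v w
  proof -
    have w: "w = (fst w, upd T (snd v) (obs G (fst w)))"
      "if fst v \<in> S1 G then fst w = act G (fst v) (nxt T (snd v)) else (fst v, fst w) \<in> E G"
      using e product_edges_id_iff[of "fst v" "snd v" w] by auto
    have "v \<in> states G \<times> mem T"
    proof -
      have "(v0, v) \<in> R\<^sup>*" using U(1) v by blast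
      then show ?thesis by cases (use start_vertex product_edges_range in auto)
    qed
    then consider "fst v \<in> S1 G" | "fst v \<in> S2 G" "fst v \<notin> S1 G" | "fst v \<in> SX G" "fst v \<notin> S1 G" "fst v \<notin> S2 G"
      by (auto simp: states_def mem_Times_iff)
    then show ?thesis
    proof cases
      case 1
      obtain w' where w': "w' \<in> U" "(v, w') \<in> R" using succU v by blast
      then have "w' = w" using w 1 product_edges_id_iff[of "fst v" "snd v" w'] by (auto simp: prod_eq_iff)
      then show ?thesis using w' by simp
    next
      case 2
      then have "fst w \<in> Q v" using t finQ Qne by (simp add: nx_def set_pmf_of_set)
      then show ?thesis using v w(1) by (auto simp: Q_def)
    next
      case 3
      then have "v \<in> U \<inter> random_vertices G" using v by (cases v) (auto simp: random_vertices_def)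
      then show ?thesis using e U(2) unfolding odd_end_component_def by blast
    qed
  qed
  \<comment> \<open>A path to \<open>v\<close> may enter \<open>U\<close> before its end, and from
    then on its edges need not be followed with positive probability. The disjunction allows the
    history to stop there.\<close>
  have reach: "\<exists>h. h \<noteq> [] \<and> emeasure ?M {\<omega>. map \<omega> [0..<length h] = h} > 0 \<and>
      vx h \<in> states G \<times> mem T \<and> (vx h = v \<or> vx h \<in> U)" if "(v0, v) \<in> R\<^sup>*" for v
    using that
  proof induction
    case base
    have "emeasure ?M {\<omega>. map \<omega> [0..<length [s]] = [s]} = 1"
    proof (rule M.emeasure_eq_1_AE[OF sets_history])
      show "AE \<omega> in ?M. \<omega> \<in> {\<omega>. map \<omega> [0..<length [s]] = [s]}"
        using AE_play_start by eventually_elim simp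
    qed
    then show ?case using start_vertex by (intro exI[of _ "[s]"]) simp
  next
    case (step y z)
    obtain h where h: "h \<noteq> []" "emeasure ?M {\<omega>. map \<omega> [0..<length h] = h} > 0"
      "vx h \<in> states G \<times> mem T" "vx h = y \<or> vx h \<in> U" using step.IH by (elim exE conjE)
    show ?case
    proof (cases "vx h \<in> U")
      case False
      then have y: "vx h = y" "y \<notin> U" using h by auto
      then have "fst z \<in> set_pmf (?N h)" using supp[of y z] step.hyps(2) h(3) by (simp add: next_eq)
      then have "emeasure ?M {\<omega>. map \<omega> [0..<Suc (length h)] = h @ [fst z]} > 0"
        using h by (intro emeasure_play_history_pos) auto
      moreover have "vx (h @ [fst z]) = z"
        using y step.hyps(2) product_edges_id_iff[of "fst y" "snd y" z] by (simp add: history_vertex_append)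
      ultimately show ?thesis
        using product_edges_range[OF step.hyps(2)] by (intro exI[of _ "h @ [fst z]"]) simp
    next
      case True
      then show ?thesis using h by (intro exI[of _ h]) simp
    qed
  qed
  obtain u0 where "u0 \<in> U" using U(2) by (auto simp: odd_end_component_def)
  then obtain h where h: "h \<noteq> []" "emeasure ?M {\<omega>. map \<omega> [0..<length h] = h} > 0" "vx h \<in> U"
    using reach[of u0] U(1) by blast
  have fair: "AE \<omega> in ?M. t \<in> set_pmf (nx v) \<longrightarrow>
      infinite {n. map \<omega> [0..<n] \<noteq> [] \<and> vx (map \<omega> [0..<n]) = v} \<longrightarrow>
      infinite {n. (map \<omega> [0..<n] \<noteq> [] \<and> vx (map \<omega> [0..<n]) = v) \<and> \<omega> n = t}" for v t
  proof (cases "t \<in> set_pmf (nx v)")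
    case True
    then have "AE \<omega> in ?M. infinite {n. map \<omega> [0..<n] \<noteq> [] \<and> vx (map \<omega> [0..<n]) = v} \<longrightarrow>
      infinite {n. (map \<omega> [0..<n] \<noteq> [] \<and> vx (map \<omega> [0..<n]) = v) \<and> \<omega> n = t}"
      by (intro AE_play_fair[where \<epsilon> = "pmf (nx v) t"]) (auto simp: next_eq pmf_positive)
    then show ?thesis by simp
  qed simp
  have "AE \<omega> in ?M. \<forall>v t. t \<in> set_pmf (nx v) \<longrightarrow>
      infinite {n. map \<omega> [0..<n] \<noteq> [] \<and> vx (map \<omega> [0..<n]) = v} \<longrightarrow>
      infinite {n. (map \<omega> [0..<n] \<noteq> [] \<and> vx (map \<omega> [0..<n]) = v) \<and> \<omega> n = t}"
    unfolding AE_all_countable using fair by blast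
  moreover have "AE \<omega> in ?M. \<omega> \<in> parity p"
    using win \<pi> M.prob_eq_1[OF sets_parity] unfolding almost_sure_winning_def by blast
  \<comment> \<open>A play extending \<open>h\<close> visits exactly \<open>U\<close> infinitely
    often and so violates the parity condition, which holds almost surely by assumption. Thus
    \<open>h\<close> would have probability zero, against its choice.\<close>
  ultimately have "AE \<omega> in ?M. map \<omega> [0..<length h] \<noteq> h"
    using AE_play_start AE_play_step
  proof eventually_elim
    case (elim \<omega>)
    show ?case
    proof
      assume wh: "map \<omega> [0..<length h] = h"
      define x where "x n = vx (map \<omega> [0..<Suc n])" for n
      note pv = play_vertices[OF \<pi> elim(3,4), folded x_def]
      have xR: "(x n, x (Suc n)) \<in> R" for n using pv(2) by (simp only: x_def)
      define W where "W = {v. infinite {n. x n = v}}"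
      note inf = infinitely_visited[where x = x, OF finite_vertices pv(1) xR, folded W_def]
      define n0 where "n0 = length h - 1"
      have n0: "x n0 = vx h" using wh h(1) by (simp add: x_def n0_def del: upt_Suc)
      have xU: "x (n0 + n) \<in> U" for n
      proof (induction n)
        case (Suc n)
        have "fst (x (Suc (n0 + n))) \<in> set_pmf (nx (x (n0 + n)))"
        proof -
          have "\<omega> (Suc (n0 + n)) \<in> set_pmf (?N (map \<omega> [0..<Suc (n0 + n)]))" using elim(4) by blast
          moreover have "fst (x (Suc (n0 + n))) = \<omega> (Suc (n0 + n))"
            by (simp add: x_def history_vertex_def)
          ultimately show ?thesis by (simp only: next_eq x_def)
        qed
        then show ?case using stay[OF Suc xR[of "n0 + n"]] by simp
      qed (use n0 h in simp)
      have WU: "W \<subseteq> U"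
      proof
        fix v assume "v \<in> W"
        then have "infinite {n. x n = v}" by (simp add: W_def)
        then obtain n where "n \<ge> n0" "x n = v" by (rule infinite_nat_ge)
        then show "v \<in> U" using xU[of "n - n0"] by simp
      qed
      have Wstep: "w \<in> W" if "v \<in> W" "(v, w) \<in> R \<inter> U \<times> U" for v w
      proof -
        have "v \<in> states G \<times> mem T" using inf(2) that(1) by blast
        then have t: "fst w \<in> set_pmf (nx v)" using supp that by blast
        have i: "infinite {n. x n = v}" using that by (simp add: W_def)
        then obtain n where "v = x n" using not_finite_existsD by blast
        then have "infinite {n. x n = (fst w, upd T (snd v) (obs G (fst w)))}"
          using fair_successor[of v \<omega> n "fst w"] elim(1) t i unfolding x_def by blast
        moreover have "w = (fst w, upd T (snd v) (obs G (fst w)))"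
          using that product_edges_id_iff[of "fst v" "snd v" w] by auto
        ultimately show ?thesis unfolding W_def by simp
      qed
      have "U \<subseteq> W"
      proof
        fix w assume w: "w \<in> U"
        obtain v where v: "v \<in> W" using inf(1) by blast
        then have "(v, w) \<in> (R \<inter> U \<times> U)\<^sup>+" using conn WU w by blast
        then show "w \<in> W" by induction (use v Wstep in blast)+
      qed
      then have "W = U" using WU by blast
      then have "odd (LEAST k. infinite {n. (p \<circ> fst) (x n) = k})"
        unfolding inf(5) using U(2) by (simp add: odd_end_component_def)
      moreover have "(p \<circ> fst) (x n) = p (\<omega> n)" for n
        by (simp add: x_def history_vertex_def)
      ultimately show False using elim(2) by (simp add: parity_def)
    qed
  qed
  then have "emeasure ?M {\<omega>. map \<omega> [0..<length h] = h} = 0"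
    by (subst (asm) AE_iff_measurable[OF sets_history]) auto
  then show False using h(2) by simp
qed

end

section \<open>The three-player game\<close>

text \<open>With \<open>n\<close> original states, state \<open>j * n + s\<close> is the copy of \<open>s\<close> in layer \<open>j\<close>.  The copies of
  states that are not probabilistic in the layers 1, 2, 4, \<dots> are unreachable and get a self-loop.\<close>

definition layer_successors ::
    "(nat, nat, nat, 'z) game_scheme \<Rightarrow> nat \<Rightarrow> nat \<Rightarrow> (nat \<Rightarrow> nat list) \<Rightarrow> nat \<Rightarrow> nat list" where
  "layer_successors G n D succs x =
     (if x < n then if x \<in> SX G then map (\<lambda>i. (3 + 2 * i) * n + x) [0..<Suc D] else succs x
      else if odd (x div n) \<and> x div n \<noteq> 1 then [x - n, n + x mod n]
      else if x mod n \<in> SX G then succs (x mod n) else [x])"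

text \<open>The number \<open>2 * D + 4\<close> counts layers 0 and 1 and, for each threshold
  \<open>i\<close> up to \<open>D\<close>, the layers \<open>2 + 2 * i\<close> and
  \<open>3 + 2 * i\<close>. Subtracting \<open>n\<close> descends one layer. The fresh observation
  \<open>l\<close> is shared by all copies, so player 1 learns nothing about the choices made inside
  a gadget.\<close>

definition layered_game ::
    "(nat, nat, nat) stochastic_game \<Rightarrow> nat \<Rightarrow> nat \<Rightarrow> nat \<Rightarrow> (nat \<Rightarrow> nat list) \<Rightarrow> (nat, nat, nat) game" where
  "layered_game G n l D succs =
     \<lparr>S1 = S1 G,
      S2 = S2 G \<union> {x. n \<le> x \<and> x < (2 * D + 4) * n \<and> x div n \<noteq> 1},
      SX = SX G \<union> {x. n \<le> x \<and> x < (2 * D + 4) * n \<and> x div n = 1},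
      A1 = A1 G,
      act = act G,
      E = {(x, y). x < (2 * D + 4) * n \<and> x \<notin> S1 G \<and> y \<in> set (layer_successors G n D succs x)},
      Obs = {..<Suc l},
      obs = (\<lambda>x. if x < n then obs G x else l)\<rparr>"

definition layered_priority :: "(nat \<Rightarrow> nat) \<Rightarrow> nat \<Rightarrow> nat \<Rightarrow> nat \<Rightarrow> nat" where
  "layered_priority p n D x = gadget_priority p D (x div n) (x mod n)"

text \<open>The rank is the distance to \<open>Tg\<close>. The chosen successor can still reach
  \<open>Tg\<close>, so the descent may be repeated.\<close>

lemma reach_rank_exists:
  fixes R :: "('v \<times> 'v) set"
  shows "\<exists>rank :: 'v \<Rightarrow> nat. \<forall>v u. v \<notin> Tg \<longrightarrow> u \<in> Tg \<longrightarrow> (v, u) \<in> R\<^sup>* \<longrightarrow>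
    (\<exists>w. (v, w) \<in> R \<and> rank w < rank v \<and> (\<exists>u\<in>Tg. (w, u) \<in> R\<^sup>*))"
proof -
  define rank where "rank v = (LEAST n. \<exists>u\<in>Tg. (v, u) \<in> R ^^ n)" for v
  have "\<exists>w. (v, w) \<in> R \<and> rank w < rank v \<and> (\<exists>u\<in>Tg. (w, u) \<in> R\<^sup>*)"
    if v: "v \<notin> Tg" and u: "u \<in> Tg" and vu: "(v, u) \<in> R\<^sup>*" for v u
  proof -
    obtain m where "(v, u) \<in> R ^^ m" using rtrancl_imp_relpow[OF vu] by blast
    then have "\<exists>u\<in>Tg. (v, u) \<in> R ^^ rank v"
      unfolding rank_def by (intro LeastI[of "\<lambda>n. \<exists>u\<in>Tg. (v, u) \<in> R ^^ n" m]) (use u in blast)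
    then obtain u' where u': "u' \<in> Tg" "(v, u') \<in> R ^^ rank v" by blast
    then obtain k where k: "rank v = Suc k" using v by (cases "rank v") auto
    obtain w where w: "(v, w) \<in> R" "(w, u') \<in> R ^^ k"
      using relpow_Suc_E2[of v u' k R] u'(2) k by auto
    have "rank w \<le> k" unfolding rank_def by (rule Least_le) (use w u' in blast)
    moreover have "(w, u') \<in> R\<^sup>*" by (rule relpow_imp_rtrancl[OF w(2)])
    ultimately show ?thesis
      using w(1) k u'(1) by (intro exI[of _ w]) auto
  qed
  then show ?thesis by blast
qed

text \<open>Produces a play against a strategy that depends on the whole history; for this reason
  the recursion is on histories and not on states.\<close>

lemma history_recursion:
  "\<exists>\<rho> :: nat \<Rightarrow> 'v. \<rho> 0 = v \<and> (\<forall>i. \<rho> (Suc i) = F (map \<rho> [0..<Suc i]))"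
proof -
  define hs where "hs = rec_nat [v] (\<lambda>_ h. h @ [F h])"
  have hs: "hs 0 = [v]" "hs (Suc i) = hs i @ [F (hs i)]" for i by (simp_all add: hs_def)
  have map_hs: "map (\<lambda>i. last (hs i)) [0..<Suc i] = hs i" for i
  proof (induction i)
    case (Suc i)
    have "map (\<lambda>i. last (hs i)) [0..<Suc (Suc i)] = map (\<lambda>i. last (hs i)) [0..<Suc i] @ [last (hs (Suc i))]"
      by simp
    then show ?case unfolding Suc by (simp add: hs)
  qed (simp add: hs)
  have "last (hs 0) = v \<and> (\<forall>i. last (hs (Suc i)) = F (map (\<lambda>i. last (hs i)) [0..<Suc i]))"
    unfolding map_hs by (simp add: hs)
  then show ?thesis by (rule exI[of _ "\<lambda>i. last (hs i)"])
qed

text \<open>There are finitely many odd values up to \<open>c\<close>, so one of them recurs and the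
  least recurring value is at most \<open>c\<close>. From \<open>j\<close> on every even value is at
  least \<open>c\<close>, and \<open>c\<close> is odd, so an even value cannot be that least
  one.\<close>

lemma odd_limit:
  fixes f :: "nat \<Rightarrow> nat"
  assumes A: "\<And>k. j \<le> k \<Longrightarrow> c \<le> f k \<or> odd (f k)"
    and B: "infinite {k. odd (f k) \<and> f k \<le> c}" and c: "odd c"
  shows "\<not> even_limit f"
proof -
  have "{k. odd (f k) \<and> f k \<le> c} = (\<Union>x\<in>{x. odd x \<and> x \<le> c}. {k. f k = x})" by auto
  then obtain x where x: "x \<le> c" "infinite {k. f k = x}"
    using B by (auto simp: finite_UN)
  define K where "K = (LEAST x. infinite {k. f k = x})"
  have K: "infinite {k. f k = K}" unfolding K_def by (rule LeastI) (rule x(2))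
  have Kx: "K \<le> x" unfolding K_def by (rule Least_le) (rule x(2))
  obtain k where "k \<ge> j" "f k = K" by (rule infinite_nat_ge[OF K])
  then have "c \<le> K \<or> odd K" using A[of k] by simp
  then have "odd K" using Kx x(1) c by (cases "K = c") simp_all
  then show ?thesis by (simp add: even_limit_def K_def)
qed

section \<open>Shape of the three-player game and of its product with a transducer\<close>

locale layered =
  fixes G :: "(nat, nat, nat) stochastic_game" and p :: "nat \<Rightarrow> nat" and n l D :: nat
    and succs :: "nat \<Rightarrow> nat list"
  assumes G: "stochastic_game G" and states_G: "states G = {..<n}" and Obs_G: "Obs G = {..<l}"
    and set_succs: "\<And>s. s \<in> S2 G \<union> SX G \<Longrightarrow> set (succs s) = {t. (s, t) \<in> E G}"
    and p_le: "\<And>s. s < n \<Longrightarrow> p s \<le> D"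
begin

abbreviation (input) "H \<equiv> layered_game G n l D succs"
abbreviation (input) "q \<equiv> layered_priority p n D"

lemma graph_G: "game_graph G"
  using G by (simp add: stochastic_game_def)

lemma n_pos: "0 < n"
  using graph_G states_G by (auto simp: game_graph_def)

lemma in_states: "s < n \<longleftrightarrow> s \<in> S1 G \<or> s \<in> S2 G \<or> s \<in> SX G"
  using states_G by (auto simp: states_def)

lemma disjoint: "S1 G \<inter> S2 G = {}" "S1 G \<inter> SX G = {}" "S2 G \<inter> SX G = {}"
  using graph_G by (auto simp: game_graph_def)

lemma edge_less: "(s, t) \<in> E G \<Longrightarrow> t < n"
  using graph_G states_G by (auto simp: game_graph_def)

lemma obs_less: "s < n \<Longrightarrow> obs G s < l"
  using graph_G states_G Obs_G by (auto simp: game_graph_def)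

lemma layer_div [simp]: "s < n \<Longrightarrow> (j * n + s) div n = j" "s < n \<Longrightarrow> (j * n + s) mod n = s"
  by simp_all

lemma layer_less: "s < n \<Longrightarrow> j < 2 * D + 4 \<Longrightarrow> j * n + s < (2 * D + 4) * n"
proof -
  assume "s < n" "j < 2 * D + 4"
  then have "j * n + s < Suc j * n" by simp
  also have "\<dots> \<le> (2 * D + 4) * n" using \<open>j < 2 * D + 4\<close> by (intro mult_le_mono1) simp
  finally show ?thesis .
qed

lemma states_H: "states H = {..<(2 * D + 4) * n}"
proof -
  have "n \<le> (2 * D + 4) * n" by simp
  moreover have "states H = states G \<union> {x. n \<le> x \<and> x < (2 * D + 4) * n}"
    unfolding states_def layered_game_def by auto
  moreover have "{..<n} \<union> {x. n \<le> x \<and> x < N} = {..<N}" if "n \<le> N" for N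
    using that by auto
  ultimately show ?thesis unfolding states_G by blast
qed

lemma successors_gadget:
  assumes "s < n" "1 \<le> j"
  shows "layer_successors G n D succs (j * n + s) =
    (if odd j \<and> j \<noteq> 1 then [(j - 1) * n + s, n + s]
     else if s \<in> SX G then succs s else [j * n + s])"
proof -
  obtain j' where "j = Suc j'" using assms(2) by (cases j) auto
  then have "\<not> j * n + s < n" "j * n + s - n = (j - 1) * n + s" by simp_all
  then show ?thesis using assms(1) by (simp add: layer_successors_def)
qed

lemma game_graph_H: "game_graph H"
proof -
  have Eprop: "x < (2 * D + 4) * n \<Longrightarrow> x \<notin> S1 G \<Longrightarrow>
      set (layer_successors G n D succs x) \<subseteq> {..<(2 * D + 4) * n} \<and> layer_successors G n D succs x \<noteq> []" for x
  proof -
    assume x: "x < (2 * D + 4) * n" "x \<notin> S1 G"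
    define j where "j = x div n"
    define s where "s = x mod n"
    have s: "s < n" using n_pos by (simp add: s_def)
    have xjs: "x = j * n + s" by (simp add: j_def s_def)
    have j: "j < 2 * D + 4" using x(1) unfolding j_def by (simp add: less_mult_imp_div_less)
    have nn: "n + s' < (2 * D + 4) * n" "s' < (2 * D + 4) * n" if "s' < n" for s'
      using layer_less[OF that, of 1] layer_less[OF that, of 0] by simp_all
    have succ: "set (succs s') \<subseteq> {..<(2 * D + 4) * n} \<and> succs s' \<noteq> []" if "s' \<in> S2 G \<union> SX G" for s'
    proof -
      have "{t. (s', t) \<in> E G} \<noteq> {}" using that graph_G by (auto simp: game_graph_def)
      moreover have "{t. (s', t) \<in> E G} \<subseteq> {..<(2 * D + 4) * n}"
        using edge_less nn(2) by auto
      ultimately show ?thesis using set_succs[OF that] by auto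
    qed
    show ?thesis
    proof (cases "x < n")
      case True
      show ?thesis
      proof (cases "x \<in> SX G")
        case SX: True
        have "(3 + 2 * i) * n + x < (2 * D + 4) * n" if "i < Suc D" for i
          by (rule layer_less[OF True]) (use that in simp)
        then show ?thesis using True SX by (auto simp: layer_successors_def)
      next
        case False
        then have "x \<in> S2 G \<union> SX G" using x True in_states by auto
        then show ?thesis using succ True False by (auto simp: layer_successors_def)
      qed
    next
      case False
      then have j1: "1 \<le> j" using xjs s by (cases j) auto
      have "(j - 1) * n + s < (2 * D + 4) * n" by (rule layer_less[OF s]) (use j in simp)
      then show ?thesis
        unfolding xjs successors_gadget[OF s j1] using succ[of s] nn[OF s] x(1) xjs by auto
    qed
  qed
  have S1n: "x \<in> S1 G \<Longrightarrow> x < n" "x \<in> S2 G \<Longrightarrow> x < n" "x \<in> SX G \<Longrightarrow> x < n" for x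
    using in_states by auto
  have nle: "n \<le> (2 * D + 4) * n" by simp
  show ?thesis
    unfolding game_graph_def states_H
  proof (intro conjI)
    have "0 \<in> {..<(2 * D + 4) * n}" using n_pos by simp
    then show "{..<(2 * D + 4) * n} \<noteq> {}" by blast
    have ge: "x \<in> S1 G \<Longrightarrow> \<not> n \<le> x" "x \<in> S2 G \<Longrightarrow> \<not> n \<le> x" "x \<in> SX G \<Longrightarrow> \<not> n \<le> x" for x
      using S1n by (simp_all add: not_le)
    show "S1 H \<inter> S2 H = {}" "S1 H \<inter> SX H = {}" "S2 H \<inter> SX H = {}"
      using disjoint by (auto simp: layered_game_def ge dest: ge)
    show "finite (A1 H)" "A1 H \<noteq> {}" using graph_G by (simp_all add: layered_game_def game_graph_def)
    show "\<forall>s\<in>S1 H. \<forall>a\<in>A1 H. act H s a \<in> S2 H"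
      using graph_G by (simp add: layered_game_def game_graph_def)
    show "E H \<subseteq> (S2 H \<union> SX H) \<times> {..<(2 * D + 4) * n}"
    proof
      fix e assume "e \<in> E H"
      then obtain x y where e: "e = (x, y)" "x < (2 * D + 4) * n" "x \<notin> S1 G"
        "y \<in> set (layer_successors G n D succs x)" by (auto simp: layered_game_def)
      then have "x \<in> S2 H \<union> SX H" using in_states[of x] by (cases "x < n") (auto simp: layered_game_def)
      then show "e \<in> (S2 H \<union> SX H) \<times> {..<(2 * D + 4) * n}" using Eprop[of x] e by auto
    qed
    show "\<forall>s\<in>S2 H \<union> SX H. \<exists>t. (s, t) \<in> E H"
    proof
      fix s assume s: "s \<in> S2 H \<union> SX H"
      then have "s < n \<or> s < (2 * D + 4) * n" "s \<notin> S1 G"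
        using S1n[of s] disjoint by (auto simp: layered_game_def)
      then have "s < (2 * D + 4) * n" "s \<notin> S1 G" using nle by linarith+
      then have "hd (layer_successors G n D succs s) \<in> set (layer_successors G n D succs s)"
        using Eprop by auto
      then show "\<exists>t. (s, t) \<in> E H"
        using \<open>s < (2 * D + 4) * n\<close> \<open>s \<notin> S1 G\<close> by (auto simp: layered_game_def)
    qed
    show "\<forall>s\<in>{..<(2 * D + 4) * n}. obs H s \<in> Obs H"
      using obs_less by (auto simp: layered_game_def less_Suc_eq)
  qed (simp_all add: layered_game_def)
qed

lemma edges_H: "edges (fix_player1 H T) =
   {((s, m), (t, upd T m (obs H t))) | s m t. m \<in> mem T \<and> (s \<in> S1 H \<and> t = act H s (nxt T m) \<or> (s, t) \<in> E H)}"
  by (simp add: fix_player1_def)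

lemma edges_H_iff:
  "((s, m), w) \<in> edges (fix_player1 H T) \<longleftrightarrow> m \<in> mem T \<and> w = (fst w, upd T m (obs H (fst w))) \<and>
     (s \<in> S1 G \<and> fst w = act G s (nxt T m) \<or> (s, fst w) \<in> E H)"
proof -
  have "S1 H = S1 G" "act H = act G" by (simp_all add: layered_game_def)
  then show ?thesis unfolding edges_H by (cases w) (auto simp only: prod.inject fst_conv mem_Collect_eq)
qed

lemma S1_H: "S1 H = S1 G" and act_H: "act H = act G" by (simp_all add: layered_game_def)

lemma obs_H: "x < n \<Longrightarrow> obs H x = obs G x" "\<not> x < n \<Longrightarrow> obs H x = l"
  by (simp_all add: layered_game_def)

definition gadget_memory :: "(nat, nat) transducer \<Rightarrow> nat \<Rightarrow> nat" where
  "gadget_memory T m = upd T (upd T m l) l"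

abbreviation (input) "RX T \<equiv> product_edges G T (gadget_memory T)"

context
  fixes T :: "(nat, nat) transducer"
  assumes T: "transducer H T"
begin

lemma upd_mem: "m \<in> mem T \<Longrightarrow> o' \<le> l \<Longrightarrow> upd T m o' \<in> mem T"
  using T by (simp add: transducer_def layered_game_def less_Suc_eq_le)

lemma nxt_A1: "m \<in> mem T \<Longrightarrow> nxt T m \<in> A1 G"
  using T by (simp add: transducer_def layered_game_def)

lemma gadget_memory_mem: "m \<in> mem T \<Longrightarrow> gadget_memory T m \<in> mem T"
  by (simp add: gadget_memory_def upd_mem)

lemma act_less: "m \<in> mem T \<Longrightarrow> s \<in> S1 G \<Longrightarrow> act G s (nxt T m) < n"
  using nxt_A1 graph_G in_states by (auto simp: game_graph_def)

lemma RX_range: "((s, m), w) \<in> RX T \<Longrightarrow> fst w < n \<and> snd w \<in> mem T"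
proof -
  assume "((s, m), w) \<in> RX T"
  then obtain t where w: "w = (t, upd T (if s \<in> SX G then gadget_memory T m else m) (obs G t))"
    and m: "m \<in> mem T" and t: "if s \<in> S1 G then t = act G s (nxt T m) else (s, t) \<in> E G"
    unfolding product_edges_def by blast
  have "t < n" using t m act_less edge_less by (cases "s \<in> S1 G") auto
  then show ?thesis
    using w m obs_less[of t] gadget_memory_mem[of m] by (simp add: upd_mem)
qed

lemma edges_original:
  assumes "s < n" "s \<notin> SX G"
  shows "((s, m), w) \<in> edges (fix_player1 H T) \<longleftrightarrow> ((s, m), w) \<in> RX T"
proof (cases "s \<in> S1 G")
  case True
  have "(s, t) \<notin> E H" for t using True by (simp add: layered_game_def)
  then have "((s, m), w) \<in> edges (fix_player1 H T) \<longleftrightarrow>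
      m \<in> mem T \<and> w = (act G s (nxt T m), upd T m (obs H (act G s (nxt T m))))"
    using True edges_H_iff[where w = w] by (auto simp: prod_eq_iff)
  moreover have "((s, m), w) \<in> RX T \<longleftrightarrow>
      m \<in> mem T \<and> w = (act G s (nxt T m), upd T m (obs G (act G s (nxt T m))))"
    unfolding product_edges_def using True assms by auto
  ultimately show ?thesis using act_less[OF _ True] obs_H(1) by auto
next
  case False
  then have "s \<in> S2 G" using assms in_states by auto
  moreover have "s < (2 * D + 4) * n" using layer_less[OF assms(1), of 0] by simp
  ultimately have E: "(s, t) \<in> E H \<longleftrightarrow> (s, t) \<in> E G" for t
    using assms False set_succs[of s] by (simp add: layered_game_def layer_successors_def)
  have "((s, m), w) \<in> edges (fix_player1 H T) \<longleftrightarrow>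
      m \<in> mem T \<and> (\<exists>t. (s, t) \<in> E G \<and> w = (t, upd T m (obs H t)))"
    using False E edges_H_iff[where w = w] by (auto simp: prod_eq_iff)
  moreover have "((s, m), w) \<in> RX T \<longleftrightarrow>
      m \<in> mem T \<and> (\<exists>t. (s, t) \<in> E G \<and> w = (t, upd T m (obs G t)))"
    unfolding product_edges_def using False assms by auto
  ultimately show ?thesis using edge_less obs_H(1) by metis
qed

lemma gadget_edge_iff:
  assumes "s < n" "j < 2 * D + 4" "1 \<le> j"
  shows "((j * n + s, m), w) \<in> edges (fix_player1 H T) \<longleftrightarrow> m \<in> mem T \<and>
    (\<exists>t\<in>set (layer_successors G n D succs (j * n + s)). w = (t, upd T m (obs H t)))"
proof -
  have "n \<le> j * n + s" using assms by (simp add: trans_le_add1)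
  then have "j * n + s \<notin> S1 G" using in_states by (meson leD)
  then have "(j * n + s, t) \<in> E H \<longleftrightarrow> t \<in> set (layer_successors G n D succs (j * n + s))" for t
    using layer_less[OF assms(1,2)] by (simp add: layered_game_def)
  then show ?thesis
    using \<open>j * n + s \<notin> S1 G\<close> edges_H_iff[where w = w] by (auto simp: prod_eq_iff)
qed

lemma edges_random:
  assumes "s \<in> SX G"
  shows "((s, m), w) \<in> edges (fix_player1 H T) \<longleftrightarrow>
    m \<in> mem T \<and> (\<exists>i\<le>D. w = ((3 + 2 * i) * n + s, upd T m l))"
proof -
  have s: "s < n" "s \<notin> S1 G" using assms in_states disjoint by auto
  moreover have "s < (2 * D + 4) * n" using layer_less[OF s(1), of 0] by simp
  ultimately have E: "(s, t) \<in> E H \<longleftrightarrow> (\<exists>i\<le>D. t = (3 + 2 * i) * n + s)" for t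
    using assms by (auto simp: layered_game_def layer_successors_def less_Suc_eq_le simp del: upt_Suc)
  have o: "obs H ((3 + 2 * i) * n + s) = l" for i
  proof (rule obs_H(2))
    have "1 * n \<le> (3 + 2 * i) * n" by (intro mult_le_mono1) simp
    then show "\<not> (3 + 2 * i) * n + s < n" by linarith
  qed
  have "((s, m), w) \<in> edges (fix_player1 H T) \<longleftrightarrow>
      m \<in> mem T \<and> (\<exists>t. (s, t) \<in> E H \<and> w = (t, upd T m (obs H t)))"
    using s(2) edges_H_iff[where w = w] by (auto simp: prod_eq_iff)
  also have "\<dots> \<longleftrightarrow> m \<in> mem T \<and> (\<exists>i\<le>D. w = ((3 + 2 * i) * n + s, upd T m l))"
    unfolding E using o by auto
  finally show ?thesis .
qed

lemma edges_threshold: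
  assumes "s < n" "i \<le> D"
  shows "(((3 + 2 * i) * n + s, m), w) \<in> edges (fix_player1 H T) \<longleftrightarrow>
    m \<in> mem T \<and> (w = ((2 + 2 * i) * n + s, upd T m l) \<or> w = (n + s, upd T m l))"
proof -
  let ?a = "(2 + 2 * i) * n + s" and ?b = "n + s"
  have "1 * n \<le> (2 + 2 * i) * n" by (intro mult_le_mono1) simp
  then have o: "obs H ?a = l" "obs H ?b = l" by (auto intro!: obs_H(2))
  have L: "set (layer_successors G n D succs ((3 + 2 * i) * n + s)) = {?a, ?b}"
    using successors_gadget[OF assms(1), of "3 + 2 * i"] by simp
  have j: "3 + 2 * i < 2 * D + 4" "1 \<le> 3 + 2 * i" using assms(2) by auto
  have "(\<exists>t\<in>{?a, ?b}. w = (t, upd T m (obs H t))) \<longleftrightarrow>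
      w = (?a, upd T m (obs H ?a)) \<or> w = (?b, upd T m (obs H ?b))"
    by blast
  then show ?thesis
    unfolding gadget_edge_iff[OF assms(1) j] L by (simp only: o)
qed

lemma edges_choice:
  assumes "s \<in> SX G" "j = 1 \<or> j = 2 + 2 * i" "i \<le> D"
  shows "((j * n + s, m), w) \<in> edges (fix_player1 H T) \<longleftrightarrow>
    m \<in> mem T \<and> (\<exists>t. (s, t) \<in> E G \<and> w = (t, upd T m (obs G t)))"
proof -
  have s: "s < n" using assms in_states by auto
  have "layer_successors G n D succs (j * n + s) = succs s"
    using successors_gadget[OF s, of j] assms by auto
  moreover have "set (succs s) = {t. (s, t) \<in> E G}" using set_succs assms by simp
  moreover have o: "obs H t = obs G t" if "(s, t) \<in> E G" for t using obs_H edge_less[OF that] by simp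
  moreover have "j < 2 * D + 4" "1 \<le> j" using assms by auto
  ultimately have "((j * n + s, m), w) \<in> edges (fix_player1 H T) \<longleftrightarrow> m \<in> mem T \<and>
      (\<exists>t\<in>{t. (s, t) \<in> E G}. w = (t, upd T m (obs H t)))"
    using gadget_edge_iff[OF s, of j] by simp
  then show ?thesis using o by auto
qed

lemma RX_random:
  assumes "s \<in> SX G"
  shows "((s, m), w) \<in> RX T \<longleftrightarrow>
    m \<in> mem T \<and> (\<exists>t. (s, t) \<in> E G \<and> w = (t, upd T (gadget_memory T m) (obs G t)))"
  using assms disjoint by (auto simp: product_edges_def)

end

section \<open>Priorities, owners and successors in the fixed game\<close>

lemma priority_layers:
  assumes "s < n"
  shows "q s = p s" "q ((3 + 2 * i) * n + s) = min (2 * i + 1) D"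
    "q ((2 + 2 * i) * n + s) = min (2 * i) D" "q (n + s) = D"
proof -
  have "q (0 * n + s) = p s" "q (1 * n + s) = D"
    unfolding layered_priority_def layer_div[OF assms] by (simp_all add: gadget_priority_def)
  then show "q s = p s" "q (n + s) = D" by simp_all
  show "q ((3 + 2 * i) * n + s) = min (2 * i + 1) D" "q ((2 + 2 * i) * n + s) = min (2 * i) D"
    unfolding layered_priority_def layer_div[OF assms] by (simp_all add: gadget_priority_def)
qed

lemma vertex_owner:
  fixes T :: "(nat, nat) transducer"
  assumes "s < n" "m \<in> mem T"
  shows "s \<notin> SX G \<Longrightarrow> (s, m) \<in> V2 (fix_player1 H T) \<and> (s, m) \<notin> V3 (fix_player1 H T)"
    and "s \<in> SX G \<Longrightarrow> (s, m) \<in> V3 (fix_player1 H T)"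
    and "2 \<le> j \<Longrightarrow> j < 2 * D + 4 \<Longrightarrow>
      (j * n + s, m) \<in> V2 (fix_player1 H T) \<and> (j * n + s, m) \<notin> V3 (fix_player1 H T)"
    and "(n + s, m) \<in> V3 (fix_player1 H T)"
proof -
  show "s \<notin> SX G \<Longrightarrow> (s, m) \<in> V2 (fix_player1 H T) \<and> (s, m) \<notin> V3 (fix_player1 H T)"
    using assms in_states[of s] by (auto simp: fix_player1_def layered_game_def)
  show "s \<in> SX G \<Longrightarrow> (s, m) \<in> V3 (fix_player1 H T)"
    using assms by (simp add: fix_player1_def layered_game_def)
  show "(j * n + s, m) \<in> V2 (fix_player1 H T) \<and> (j * n + s, m) \<notin> V3 (fix_player1 H T)"
    if j: "2 \<le> j" "j < 2 * D + 4"
  proof -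
    have "1 * n \<le> j * n" using j by (intro mult_le_mono1) simp
    then have ge: "n \<le> j * n + s" by linarith
    moreover have "j * n + s \<notin> SX G" using ge in_states[of "j * n + s"] by (simp add: not_less[symmetric])
    moreover have "j * n + s < (2 * D + 4) * n" by (rule layer_less[OF assms(1) j(2)])
    moreover have "(j * n + s) div n = j" by (rule layer_div[OF assms(1)])
    ultimately show ?thesis using assms(2) j(1)
      unfolding fix_player1_def layered_game_def by simp
  qed
  have "1 * n + s < (2 * D + 4) * n" by (rule layer_less[OF assms(1)]) simp
  moreover have "(1 * n + s) div n = 1" by (rule layer_div[OF assms(1)])
  ultimately show "(n + s, m) \<in> V3 (fix_player1 H T)"
    using assms(2) unfolding fix_player1_def layered_game_def by simp
qed

lemma vertex_successor:
  fixes T :: "(nat, nat) transducer"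
  assumes T: "transducer H T" and v: "v \<in> V2 (fix_player1 H T) \<union> V3 (fix_player1 H T)"
  shows "\<exists>w. (v, w) \<in> edges (fix_player1 H T)"
proof -
  obtain x m where xm: "v = (x, m)" "m \<in> mem T" "x \<in> S1 H \<union> S2 H \<union> SX H"
    using v by (auto simp: fix_player1_def)
  show ?thesis
  proof (cases "x \<in> S1 H")
    case True
    then show ?thesis using xm unfolding edges_H by blast
  next
    case False
    then obtain t where "(x, t) \<in> E H" using xm game_graph_H unfolding game_graph_def by blast
    then show ?thesis using xm unfolding edges_H by blast
  qed
qed

text \<open>Player 2 refutes any strategy of player 3 with a choice \<open>ch\<close> that looks
  only at the current vertex. It approaches \<open>U\<close>, then circulates in \<open>U\<close>
  towards its vertices of priority \<open>c\<close>, and cedes a random choice only where no answer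
  can leave \<open>U\<close> and the threshold shows an odd priority of at most
  \<open>c\<close>.\<close>

lemma no_odd_end_component_if:
  assumes T: "transducer H T" and s0: "s0 < n"
    and win: "player3_sure_winning (fix_player1 H T) (q \<circ> fst) (initial_vertex H T s0)"
    and U: "U \<subseteq> (RX T)\<^sup>* `` {(s0, upd T (init T) (obs G s0))}"
  shows "\<not> odd_end_component (RX T) (random_vertices G) (p \<circ> fst) U"
proof
  assume ec: "odd_end_component (RX T) (random_vertices G) (p \<circ> fst) U"
  let ?HE = "edges (fix_player1 H T)" and ?V2 = "V2 (fix_player1 H T)" and ?V3 = "V3 (fix_player1 H T)"
  let ?R = "RX T"
  define v0 where "v0 = (s0, upd T (init T) (obs G s0))"
  have init_mem: "init T \<in> mem T" and fin_mem: "finite (mem T)" using T by (simp_all add: transducer_def)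
  have v0: "fst v0 < n" "snd v0 \<in> mem T" "initial_vertex H T s0 = v0"
    using s0 upd_mem[OF T init_mem] obs_less[OF s0] by (simp_all add: v0_def initial_vertex_def obs_H(1))
  have reach: "fst v < n \<and> snd v \<in> mem T" if "(v0, v) \<in> ?R\<^sup>*" for v
    using that
  proof induction
    case (step y z)
    then show ?case using RX_range[OF T, of "fst y" "snd y" z] by simp
  qed (use v0 in simp)
  have Ureach: "(v0, u) \<in> ?R\<^sup>*" if "u \<in> U" for u using U that by (auto simp: v0_def)
  have Uv: "fst u < n" "snd u \<in> mem T" if "u \<in> U" for u using reach[OF Ureach[OF that]] by auto
  have "U \<subseteq> {..<n} \<times> mem T" using Uv by (auto simp: subset_iff mem_Times_iff)
  then have finU: "finite U" using fin_mem finite_subset by blast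
  have neU: "U \<noteq> {}" and closedU: "\<And>u. u \<in> U \<Longrightarrow> fst u \<in> SX G \<Longrightarrow> ?R `` {u} \<subseteq> U"
    and connU: "\<And>u v. u \<in> U \<Longrightarrow> v \<in> U \<Longrightarrow> (u, v) \<in> (?R \<inter> U \<times> U)\<^sup>+"
    and oddU: "odd (Min ((p \<circ> fst) ` U))"
    using ec by (auto simp: odd_end_component_def random_vertices_def)
  define c where "c = Min ((p \<circ> fst) ` U)"
  \<comment> \<open>With \<open>c = 2 * kk + 1\<close>, the threshold priority
    \<open>2 * i + 1\<close> is at most \<open>c\<close> exactly for \<open>i \<le> kk\<close>, and
    the price \<open>2 * i\<close> exceeds \<open>c\<close> exactly for
    \<open>i > kk\<close>.\<close>
  define kk where "kk = c div 2"
  have c_odd: "odd c" using oddU by (simp add: c_def)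
  then have c_eq: "c = 2 * kk + 1" unfolding kk_def by presburger
  have cU: "c \<le> p (fst u)" if "u \<in> U" for u
    unfolding c_def using finU that by (auto intro!: Min_le)
  have "c \<in> (p \<circ> fst) ` U" unfolding c_def using finU neU by (intro Min_in) auto
  then obtain vc where vc: "vc \<in> U" "p (fst vc) = c" by auto
  have cD: "c \<le> D" using p_le[of "fst vc"] vc Uv by simp
  define C where "C = {v. \<exists>u\<in>U. (v, u) \<in> ?R\<^sup>*}"
  obtain r1 :: "nat \<times> nat \<Rightarrow> nat" where r1: "\<And>v. v \<notin> U \<Longrightarrow> v \<in> C \<Longrightarrow> \<exists>w. (v, w) \<in> ?R \<and> r1 w < r1 v \<and> w \<in> C"
    using reach_rank_exists[of U ?R] unfolding C_def by blast
  obtain r2 :: "nat \<times> nat \<Rightarrow> nat" where r2': "\<And>v u. v \<notin> {u\<in>U. p (fst u) = c} \<Longrightarrow> u \<in> {u\<in>U. p (fst u) = c} \<Longrightarrow>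
      (v, u) \<in> (?R \<inter> U \<times> U)\<^sup>* \<Longrightarrow> \<exists>w. (v, w) \<in> ?R \<inter> U \<times> U \<and> r2 w < r2 v"
    using reach_rank_exists[of "{u\<in>U. p (fst u) = c}" "?R \<inter> U \<times> U"] by blast
  have r2: "\<exists>w\<in>U. (v, w) \<in> ?R \<and> r2 w < r2 v" if "v \<in> U" "p (fst v) \<noteq> c" for v
    using r2'[of v vc] connU[OF that(1) vc(1)] that vc by (auto dest: trancl_into_rtrancl)
  \<comment> \<open>One selection rule for both phases: a successor in \<open>U\<close> nearest to
    priority \<open>c\<close> if there is one, otherwise a successor nearest to \<open>U\<close>.
    The phase can then be read off the available successors.\<close>
  define sel where "sel Q w \<longleftrightarrow> w \<in> Q \<and>
      (Q \<inter> U \<noteq> {} \<longrightarrow> w \<in> U \<and> (\<forall>w'\<in>Q \<inter> U. r2 w \<le> r2 w')) \<and>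
      (Q \<inter> U = {} \<longrightarrow> Q \<inter> C \<noteq> {} \<longrightarrow> w \<in> C \<and> (\<forall>w'\<in>Q \<inter> C. r1 w \<le> r1 w'))" for Q w
  have sel_ex: "\<exists>w. sel Q w" if Q: "Q \<noteq> {}" for Q
  proof (cases "Q \<inter> U \<noteq> {}")
    case True
    then obtain w where "w \<in> Q \<inter> U" "\<forall>w'. w' \<in> Q \<inter> U \<longrightarrow> r2 w \<le> r2 w'"
      using ex_has_least_nat[of "\<lambda>w. w \<in> Q \<inter> U" _ r2] by blast
    then show ?thesis using True unfolding sel_def by blast
  next
    case F1: False
    show ?thesis
    proof (cases "Q \<inter> C \<noteq> {}")
      case True
      then obtain w where "w \<in> Q \<inter> C" "\<forall>w'. w' \<in> Q \<inter> C \<longrightarrow> r1 w \<le> r1 w'"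
        using ex_has_least_nat[of "\<lambda>w. w \<in> Q \<inter> C" _ r1] by blast
      then show ?thesis using F1 unfolding sel_def by blast
    next
      case False
      then show ?thesis using F1 Q unfolding sel_def by blast
    qed
  qed
  define pick where "pick Q = (SOME w. sel Q w)" for Q
  have pick: "sel Q (pick Q)" if "Q \<noteq> {}" for Q
    unfolding pick_def using sel_ex[OF that] by (rule someI_ex)
  define N where "N s m = {(t, upd T m (obs G t)) | t. (s, t) \<in> E G}" for s m
  have RN: "?R `` {(s, m)} = N s (gadget_memory T m)" if "s \<in> SX G" "m \<in> mem T" for s m
    using RX_random[OF T that(1)] that(2) unfolding N_def by blast
  \<comment> \<open>At a threshold state the memory has absorbed one of the two gadget observations;
    the local \<open>m\<close> includes the second one, so \<open>N s m\<close> is the set of all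
    answers that player 3 could give.\<close>
  define ch where "ch v = (let j = fst v div n; s = fst v mod n; m = upd T (snd v) l in
      if odd j \<and> 3 \<le> j then if (j - 3) div 2 \<le> kk \<and> N s m \<subseteq> U then (n + s, m) else ((j - 1) * n + s, m)
      else pick (?HE `` {v}))" for v
  have ch_threshold: "ch ((3 + 2 * i) * n + s, m) = (if i \<le> kk \<and> N s (upd T m l) \<subseteq> U then (n + s, upd T m l)
      else ((2 + 2 * i) * n + s, upd T m l))" if "s < n" for i s m
  proof -
    have "3 + 2 * i - 1 = 2 + 2 * i" "odd (3 + 2 * i)" "(3 + 2 * i - 3) div 2 = i" "3 \<le> 3 + 2 * i" by simp_all
    then show ?thesis unfolding ch_def Let_def fst_conv snd_conv layer_div[OF that] by presburger
  qed
  have ch_pick: "ch (j * n + s, m) = pick (?HE `` {(j * n + s, m)})" if "s < n" "even j" for j s m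
    unfolding ch_def Let_def fst_conv snd_conv layer_div[OF that(1)] using that(2) by presburger
  have ch_edge: "(v, ch v) \<in> ?HE" if v: "v \<in> ?V2" for v
  proof -
    obtain x m where xm: "v = (x, m)" "m \<in> mem T" "x \<in> S1 H \<union> S2 H"
      using v by (auto simp: fix_player1_def)
    have xs: "x \<in> states H" using xm(3) by (auto simp: states_def)
    define j where "j = x div n"
    define s where "s = x mod n"
    have s: "s < n" and x: "x = j * n + s" using n_pos by (simp_all add: s_def j_def)
    have j: "j < 2 * D + 4" using xs unfolding states_H j_def by (simp add: less_mult_imp_div_less)
    show ?thesis
    proof (cases "odd j \<and> 3 \<le> j")
      case True
      define i where "i = (j - 3) div 2"
      have i: "j = 3 + 2 * i" using True unfolding i_def by presburger
      then have "i \<le> D" using j by simp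
      from edges_threshold[OF T s this, of m "ch v"] show ?thesis
        unfolding xm(1) x i ch_threshold[OF s] using xm(2) by presburger
    next
      case False
      have "?HE `` {v} \<noteq> {}" using vertex_successor[OF T, of v] v by blast
      moreover have "ch v = pick (?HE `` {v})"
        using False unfolding ch_def Let_def xm(1) fst_conv snd_conv j_def by presburger
      ultimately show ?thesis using pick[of "?HE `` {v}"] by (auto simp: sel_def)
    qed
  qed
  obtain \<tau> where \<tau>: "strategy (fix_player1 H T) ?V3 \<tau>"
    and \<tau>win: "\<And>\<pi> \<rho>. strategy (fix_player1 H T) ?V2 \<pi> \<Longrightarrow>
       outcome (fix_player1 H T) \<tau> \<pi> v0 \<rho> \<Longrightarrow> \<rho> \<in> parity (q \<circ> fst)"
    using win v0(3) unfolding player3_sure_winning_def by auto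
  obtain \<rho> where \<rho>0: "\<rho> 0 = v0"
    and \<rho>Suc: "\<And>i. \<rho> (Suc i) = (if \<rho> i \<in> ?V3 then \<tau> (map \<rho> [0..<Suc i]) else ch (\<rho> i))"
  proof -
    obtain \<rho> where "\<rho> 0 = v0"
      "\<forall>i. \<rho> (Suc i) = (\<lambda>h. if last h \<in> ?V3 then \<tau> h else ch (last h)) (map \<rho> [0..<Suc i])"
      using history_recursion[of v0 "\<lambda>h. if last h \<in> ?V3 then \<tau> h else ch (last h)"] by blast
    then show thesis by (intro that[of \<rho>]) simp_all
  qed
  have V23: "?V2 \<inter> ?V3 = {}"
    using game_graph_H by (auto simp: fix_player1_def game_graph_def)
  have "strategy (fix_player1 H T) ?V2 (\<lambda>h. ch (last h))"
    using ch_edge by (simp add: strategy_def)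
  moreover have "outcome (fix_player1 H T) \<tau> (\<lambda>h. ch (last h)) v0 \<rho>"
    unfolding outcome_def using \<rho>0 \<rho>Suc V23 by auto
  ultimately have par: "\<rho> \<in> parity (q \<circ> fst)" by (rule \<tau>win)
  have step3: "(\<rho> k, \<rho> (Suc k)) \<in> ?HE" if "\<rho> k \<in> ?V3" for k
  proof -
    have "(last (map \<rho> [0..<Suc k]), \<tau> (map \<rho> [0..<Suc k])) \<in> ?HE"
      using \<tau>[unfolded strategy_def, rule_format, of "map \<rho> [0..<Suc k]"] that by simp
    then show ?thesis using that \<rho>Suc[of k] by simp
  qed
  have o1: "\<rho> (Suc k) = pick (?R `` {(s, m)})" if k: "\<rho> k = (s, m)" "s < n" "m \<in> mem T" "s \<notin> SX G" for k s m
  proof -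
    have "\<rho> (Suc k) = ch (s, m)" using \<rho>Suc[of k] vertex_owner(1)[OF k(2,3)] k by simp
    also have "\<dots> = pick (?HE `` {(s, m)})" using ch_pick[OF k(2), of 0 m] by simp
    also have "?HE `` {(s, m)} = ?R `` {(s, m)}" using edges_original[OF T k(2,4)] by blast
    finally show ?thesis .
  qed
  have o2: "\<exists>i\<le>D. \<rho> (Suc k) = ((3 + 2 * i) * n + s, upd T m l)"
    if k: "\<rho> k = (s, m)" "m \<in> mem T" "s \<in> SX G" for k s m
  proof -
    have "s < n" using k(3) in_states by blast
    then have "((s, m), \<rho> (Suc k)) \<in> ?HE" using step3[of k] vertex_owner(2)[of s m T] k by simp
    then show ?thesis using edges_random[OF T k(3)] by blast
  qed
  have o3: "\<rho> (Suc k) = (if i \<le> kk \<and> N s (upd T m l) \<subseteq> U then (n + s, upd T m l)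
      else ((2 + 2 * i) * n + s, upd T m l))"
    if k: "\<rho> k = ((3 + 2 * i) * n + s, m)" "s < n" "m \<in> mem T" "i \<le> D" for k s m i
  proof -
    have "\<rho> k \<notin> ?V3" unfolding k(1) using vertex_owner(3)[OF k(2,3), of "3 + 2 * i"] k(4) by force
    then have "\<rho> (Suc k) = ch (\<rho> k)" using \<rho>Suc[of k] by simp
    then show ?thesis unfolding k(1) ch_threshold[OF k(2)] .
  qed
  have o4: "\<rho> (Suc k) = pick (N s m)"
    if k: "\<rho> k = ((2 + 2 * i) * n + s, m)" "s \<in> SX G" "m \<in> mem T" "i \<le> D" for k s m i
  proof -
    have s: "s < n" using k(2) in_states by blast
    have "\<rho> k \<notin> ?V3" unfolding k(1) using vertex_owner(3)[OF s k(3), of "2 + 2 * i"] k(4) by force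
    then have "\<rho> (Suc k) = ch (\<rho> k)" using \<rho>Suc[of k] by simp
    also have "\<dots> = pick (?HE `` {\<rho> k})" unfolding k(1) by (rule ch_pick[OF s]) simp
    also have "?HE `` {\<rho> k} = N s m"
      unfolding k(1) N_def using edges_choice[OF T k(2) disjI2[OF refl] k(4)] k(3) by blast
    finally show ?thesis .
  qed
  have o5: "\<rho> (Suc k) \<in> N s m" if k: "\<rho> k = (n + s, m)" "s \<in> SX G" "m \<in> mem T" for k s m
  proof -
    have s: "s < n" using k(2) in_states by blast
    have "((1 * n + s, m), \<rho> (Suc k)) \<in> ?HE"
      using step3[of k] vertex_owner(4)[OF s k(3)] k by simp
    then show ?thesis
      unfolding N_def using edges_choice[OF T k(2) disjI1[OF refl], of D] by blast
  qed
  have Npick: "pick Q \<in> Q \<and> (Q \<inter> U \<noteq> {} \<longrightarrow> pick Q \<in> U \<and> (\<forall>w'\<in>Q \<inter> U. r2 (pick Q) \<le> r2 w')) \<and>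
      (Q \<inter> U = {} \<longrightarrow> Q \<inter> C \<noteq> {} \<longrightarrow> pick Q \<in> C \<and> (\<forall>w'\<in>Q \<inter> C. r1 (pick Q) \<le> r1 w'))"
    if "Q \<noteq> {}" for Q
    using pick[OF that] unfolding sel_def by blast
  \<comment> \<open>One visit to an original vertex ends with the selection of player 2, made in one
    or three moves, or with an answer of player 3 that lies in \<open>U\<close> and was preceded by
    a threshold \<open>i \<le> kk\<close>.\<close>
  have big: "\<rho> (k + 1) = pick (?R `` {(s, m)}) \<or> \<rho> (k + 3) = pick (?R `` {(s, m)}) \<or>
      (?R `` {(s, m)} \<subseteq> U \<and> \<rho> (k + 3) \<in> U \<and> (\<exists>i\<le>kk. fst (\<rho> (k + 1)) = (3 + 2 * i) * n + s))"
    if k: "\<rho> k = (s, m)" "s < n" "m \<in> mem T" for k s m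
  proof (cases "s \<in> SX G")
    case False
    then show ?thesis using o1[OF k] by simp
  next
    case SX: True
    obtain i where i: "i \<le> D" "\<rho> (Suc k) = ((3 + 2 * i) * n + s, upd T m l)"
      using o2[OF k(1,3) SX] by blast
    have m1: "upd T m l \<in> mem T" by (rule upd_mem[OF T k(3)]) simp
    have m2: "upd T (upd T m l) l \<in> mem T" by (rule upd_mem[OF T m1]) simp
    have NR: "N s (upd T (upd T m l) l) = ?R `` {(s, m)}"
      using RN[OF SX k(3)] by (simp add: gadget_memory_def)
    show ?thesis
    proof (cases "i \<le> kk \<and> N s (upd T (upd T m l) l) \<subseteq> U")
      case True
      have "\<rho> (Suc (Suc k)) = (n + s, upd T (upd T m l) l)"
        unfolding o3[OF i(2) k(2) m1 i(1)] by (rule if_P[OF True])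
      then have "\<rho> (Suc (Suc (Suc k))) \<in> N s (upd T (upd T m l) l)" by (rule o5[OF _ SX m2])
      then have "\<rho> (Suc (Suc (Suc k))) \<in> U" using True by blast
      then have "\<rho> (k + 3) \<in> U" by (simp add: numeral_3_eq_3)
      moreover have "fst (\<rho> (k + 1)) = (3 + 2 * i) * n + s" using i(2) by simp
      ultimately show ?thesis using True unfolding NR by blast
    next
      case False
      have "\<rho> (Suc (Suc k)) = ((2 + 2 * i) * n + s, upd T (upd T m l) l)"
        unfolding o3[OF i(2) k(2) m1 i(1)] by (rule if_not_P[OF False])
      then have "\<rho> (Suc (Suc (Suc k))) = pick (N s (upd T (upd T m l) l))" by (rule o4[OF _ SX m2 i(1)])
      then have "\<rho> (k + 3) = pick (?R `` {(s, m)})" unfolding NR by (simp add: numeral_3_eq_3)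
      then show ?thesis by blast
    qed
  qed
  have toU: "\<exists>k'. \<rho> k' \<in> U" if "\<rho> k = v" "(v0, v) \<in> ?R\<^sup>*" "v \<in> C" for k v
    using that
  proof (induction "r1 v" arbitrary: k v rule: less_induct)
    case less
    show ?case
    proof (cases "v \<in> U")
      case False
      obtain s m where sm: "v = (s, m)" by (cases v)
      have v: "s < n" "m \<in> mem T" using reach[OF less.prems(2)] sm by auto
      obtain w0 where w0: "(v, w0) \<in> ?R" "r1 w0 < r1 v" "w0 \<in> C" using r1[OF False less.prems(3)] by blast
      let ?Q = "?R `` {v}"
      have Q: "?Q \<noteq> {}" "?Q \<inter> C \<noteq> {}" using w0 by blast+
      have "\<rho> (k + 1) = pick ?Q \<or> \<rho> (k + 3) = pick ?Q \<or> \<rho> (k + 3) \<in> U"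
        using big[OF less.prems(1)[unfolded sm] v] unfolding sm by blast
      then consider k' where "\<rho> k' = pick ?Q" | "\<rho> (k + 3) \<in> U" by metis
      then show ?thesis
      proof cases
        case 1
        note pk = Npick[OF Q(1)]
        show ?thesis
        proof (cases "?Q \<inter> U = {}")
          case True
          then have "pick ?Q \<in> C" "r1 (pick ?Q) \<le> r1 w0" using pk Q w0 by blast+
          moreover have "(v0, pick ?Q) \<in> ?R\<^sup>*" using pk less.prems(2) by (auto intro: rtrancl_into_rtrancl)
          ultimately show ?thesis using less.hyps[of "pick ?Q" k'] 1 w0(2) by simp
        next
          case False
          then show ?thesis using pk 1 by metis
        qed
      qed blast
    qed (use less.prems in blast)
  qed
  have "v0 \<in> C" using neU Ureach by (auto simp: C_def)
  then obtain k0 where k0: "\<rho> k0 \<in> U" using toU[OF \<rho>0] by blast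
  \<comment> \<open>The invariant after entering \<open>U\<close>, including positions inside
    gadgets. A paying layer \<open>2 + 2 * i\<close> is visited only with \<open>kk < i\<close>, so
    its priority, even if capped, is not below \<open>c\<close>.\<close>
  define I where "I k \<longleftrightarrow> \<rho> k \<in> U \<or>
     (\<exists>s m i. (s, m) \<in> U \<and> s \<in> SX G \<and>
       (i \<le> D \<and> \<rho> k = ((3 + 2 * i) * n + s, upd T m l) \<or>
        kk < i \<and> i \<le> D \<and> \<rho> k = ((2 + 2 * i) * n + s, gadget_memory T m) \<or>
        \<rho> k = (n + s, gadget_memory T m)))" for k
  have pickU: "pick (?R `` {u}) \<in> U \<and> (\<forall>w\<in>U. (u, w) \<in> ?R \<longrightarrow> r2 (pick (?R `` {u})) \<le> r2 w)" if u: "u \<in> U" for u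
  proof -
    obtain w where "w \<in> U" "(u, w) \<in> ?R" using tranclD[OF connU[OF u u]] by blast
    then have "?R `` {u} \<inter> U \<noteq> {}" "?R `` {u} \<noteq> {}" by blast+
    then show ?thesis using Npick[of "?R `` {u}"] by blast
  qed
  have closedN: "N s (gadget_memory T m) \<subseteq> U" if "(s, m) \<in> U" "s \<in> SX G" for s m
    using closedU[OF that(1)] that(2) RN[of s m] Uv(2)[OF that(1)] by simp
  have I_step: "I (Suc k)" and I_return: "\<exists>k'\<ge>k. \<rho> k' \<in> U" if I: "I k" for k
  proof -
    have gm: "gadget_memory T m = upd T (upd T m l) l" for m by (simp add: gadget_memory_def)
    consider (1) "\<rho> k \<in> U"
      | (2) s m i where "(s, m) \<in> U" "s \<in> SX G" "i \<le> D" "\<rho> k = ((3 + 2 * i) * n + s, upd T m l)"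
      | (3) s m i where "(s, m) \<in> U" "s \<in> SX G" "i \<le> D" "\<rho> k = ((2 + 2 * i) * n + s, gadget_memory T m)"
      | (4) s m where "(s, m) \<in> U" "s \<in> SX G" "\<rho> k = (n + s, gadget_memory T m)"
      using I unfolding I_def by blast
    then have "I (Suc k) \<and> (\<exists>k'\<ge>k. \<rho> k' \<in> U)"
    proof cases
      case 1
      obtain s m where sm: "\<rho> k = (s, m)" by (cases "\<rho> k")
      have s: "s < n" "m \<in> mem T" "(s, m) \<in> U" using Uv[OF 1] 1 sm by auto
      have "I (Suc k)"
      proof (cases "s \<in> SX G")
        case True
        then show ?thesis using o2[OF sm s(2) True] s(3) unfolding I_def by blast
      next
        case False
        then show ?thesis using o1[OF sm s(1,2) False] pickU[OF s(3)] unfolding I_def by simp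
      qed
      then show ?thesis using 1 by blast
    next
      case 2
      have s: "s < n" "m \<in> mem T" using Uv[OF 2(1)] by auto
      have m1: "upd T m l \<in> mem T" by (rule upd_mem[OF T s(2)]) simp
      have m2: "gadget_memory T m \<in> mem T" by (rule gadget_memory_mem[OF T s(2)])
      note cl = closedN[OF 2(1,2)]
      have sc: "\<rho> (Suc k) = (if i \<le> kk then (n + s, gadget_memory T m) else ((2 + 2 * i) * n + s, gadget_memory T m))"
        using o3[OF 2(4) s(1) m1 2(3)] cl unfolding gm by simp
      have "I (Suc k)"
      proof (cases "i \<le> kk")
        case True
        then show ?thesis using sc 2(1,2) unfolding I_def by auto
      next
        case False
        then have "kk < i \<and> i \<le> D \<and> \<rho> (Suc k) = ((2 + 2 * i) * n + s, gadget_memory T m)"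
          using sc 2(3) by simp
        then show ?thesis using 2(1,2) unfolding I_def by blast
      qed
      moreover have "\<rho> (Suc (Suc k)) \<in> U"
      proof (cases "i \<le> kk")
        case True
        then show ?thesis using o5[of "Suc k" s "gadget_memory T m"] sc 2(2) m2 cl by auto
      next
        case False
        then have "\<rho> (Suc (Suc k)) = pick (?R `` {(s, m)})"
          using o4[of "Suc k" i s "gadget_memory T m"] sc 2(2,3) m2 RN[OF 2(2) s(2)] by simp
        then show ?thesis using pickU[OF 2(1)] by simp
      qed
      ultimately show ?thesis by (meson le_Suc_eq order_refl)
    next
      case 3
      have s: "s < n" "m \<in> mem T" using Uv[OF 3(1)] by auto
      have "\<rho> (Suc k) = pick (?R `` {(s, m)})"
        using o4[OF 3(4,2) gadget_memory_mem[OF T s(2)] 3(3)] RN[OF 3(2) s(2)] by simp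
      then have "\<rho> (Suc k) \<in> U" using pickU[OF 3(1)] by simp
      then show ?thesis unfolding I_def by (meson le_Suc_eq order_refl)
    next
      case 4
      have s: "m \<in> mem T" using Uv[OF 4(1)] by auto
      have "\<rho> (Suc k) \<in> U"
        using o5[OF 4(3,2) gadget_memory_mem[OF T s]] closedN[OF 4(1,2)] by blast
      then show ?thesis unfolding I_def by (meson le_Suc_eq order_refl)
    qed
    then show "I (Suc k)" "\<exists>k'\<ge>k. \<rho> k' \<in> U" by blast+
  qed
  have I: "I k" if "k0 \<le> k" for k
    using that by (induction rule: dec_induct) (use k0 I_step in \<open>auto simp: I_def[of k0]\<close>)
  let ?L = "\<lambda>k. q (fst (\<rho> k))"
  have low: "c \<le> ?L k \<or> odd (?L k)" if k: "k0 \<le> k" for k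
  proof -
    consider (1) "\<rho> k \<in> U"
      | (2) s m i where "(s, m) \<in> U" "i \<le> D" "fst (\<rho> k) = (3 + 2 * i) * n + s"
      | (3) s m i where "(s, m) \<in> U" "kk < i" "fst (\<rho> k) = (2 + 2 * i) * n + s"
      | (4) s m where "(s, m) \<in> U" "fst (\<rho> k) = n + s"
      using I[OF k] unfolding I_def by (metis fst_conv)
    then show ?thesis
    proof cases
      case 1
      then show ?thesis using cU[OF 1] priority_layers(1)[OF Uv(1)[OF 1]] by simp
    next
      case 2
      have "s < n" using Uv(1)[OF 2(1)] by simp
      from priority_layers(2)[OF this] show ?thesis unfolding 2(3) using cD
        by (cases "2 * i + 1 \<le> D") (auto simp: min_def)
    next
      case 3
      have "s < n" using Uv(1)[OF 3(1)] by simp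
      from priority_layers(3)[OF this, of i] show ?thesis unfolding 3(3) using cD 3(2) c_eq by simp
    next
      case 4
      have "s < n" using Uv(1)[OF 4(1)] by simp
      from priority_layers(4)[OF this] show ?thesis unfolding 4(2) using cD by simp
    qed
  qed
  \<comment> \<open>Either some gadget on the way shows \<open>2 * i + 1\<close> with
    \<open>i \<le> kk\<close>, or \<open>r2\<close> decreases at every visit until priority
    \<open>c\<close> itself appears.\<close>
  have progress: "\<exists>k'\<ge>k. odd (?L k') \<and> ?L k' \<le> c" if "\<rho> k \<in> U" for k
    using that
  proof (induction "r2 (\<rho> k)" arbitrary: k rule: less_induct)
    case less
    note u = Uv[OF less.prems]
    show ?case
    proof (cases "p (fst (\<rho> k)) = c")
      case True
      then show ?thesis using c_odd priority_layers(1)[OF u(1)] by (intro exI[of _ k]) simp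
    next
      case False
      obtain s m where sm: "\<rho> k = (s, m)" by (cases "\<rho> k")
      obtain w where w: "w \<in> U" "(\<rho> k, w) \<in> ?R" "r2 w < r2 (\<rho> k)" using r2[OF less.prems False] by blast
      have pk: "pick (?R `` {\<rho> k}) \<in> U" "r2 (pick (?R `` {\<rho> k})) < r2 (\<rho> k)"
        using pickU[OF less.prems] w by (auto intro: le_less_trans)
      have sm': "s < n" "m \<in> mem T" using u sm by simp_all
      consider "\<rho> (k + 1) = pick (?R `` {\<rho> k})" | "\<rho> (k + 3) = pick (?R `` {\<rho> k})"
        | i where "i \<le> kk" "fst (\<rho> (k + 1)) = (3 + 2 * i) * n + s"
        using big[OF sm sm'] unfolding sm[symmetric] by blast
      then show ?thesis
      proof cases
        case 1
        then have "\<exists>k'\<ge>k + 1. odd (?L k') \<and> ?L k' \<le> c" using less.hyps[of "k + 1"] pk by simp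
        then show ?thesis by (meson add_leD1)
      next
        case 2
        then have "\<exists>k'\<ge>k + 3. odd (?L k') \<and> ?L k' \<le> c" using less.hyps[of "k + 3"] pk by simp
        then show ?thesis by (meson add_leD1)
      next
        case 3
        have "?L (k + 1) = min (2 * i + 1) D"
          unfolding 3(2) by (rule priority_layers(2)) (use u sm in simp)
        also have "\<dots> = 2 * i + 1" using 3(1) c_eq cD by simp
        finally show ?thesis using 3(1) c_eq by (intro exI[of _ "k + 1"]) simp
      qed
    qed
  qed
  have "infinite {k. odd (?L k) \<and> ?L k \<le> c}"
    unfolding infinite_nat_iff_unbounded_le
  proof
    fix j
    obtain k' where "k' \<ge> max j k0" "\<rho> k' \<in> U" using I_return[OF I[of "max j k0"]] by auto
    moreover from progress[OF this(2)] obtain k'' where "k'' \<ge> k'" "odd (?L k'') \<and> ?L k'' \<le> c" by blast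
    ultimately show "\<exists>k\<ge>j. k \<in> {k. odd (?L k) \<and> ?L k \<le> c}"
      by (intro exI[of _ k'']) simp
  qed
  then have "\<not> even_limit ?L"
    using odd_limit[of k0 c ?L] low c_odd by blast
  then show False using par by (simp add: parity_def even_limit_def)
qed

text \<open>The new transducer ignores the gadget observation \<open>l\<close>. The gadgets then
  leave the memory alone, both product graphs coincide, and the positional choices from
  \<open>gadget_winning_exists\<close> become a strategy for player 3.\<close>

lemma player3_sure_winning_if:
  assumes TG: "transducer G T0" and s0: "s0 < n"
    and no: "\<And>U. U \<subseteq> (product_edges G T0 id)\<^sup>* `` {(s0, upd T0 (init T0) (obs G s0))} \<Longrightarrow>
       \<not> odd_end_component (product_edges G T0 id) (random_vertices G) (p \<circ> fst) U"
  shows "\<exists>T. transducer H T \<and> player3_sure_winning (fix_player1 H T) (q \<circ> fst) (initial_vertex H T s0)"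
proof -
  define T where "T = T0\<lparr>upd := (\<lambda>m b. if b < l then upd T0 m b else m)\<rparr>"
  have T: "transducer H T"
    using TG Obs_G by (auto simp: transducer_def T_def layered_game_def)
  have T_sel: "mem T = mem T0" "init T = init T0" "nxt T = nxt T0"
    "\<And>m b. b < l \<Longrightarrow> upd T m b = upd T0 m b" "\<And>m. upd T m l = m"
    by (simp_all add: T_def)
  have gm: "gadget_memory T = id" by (rule ext) (simp add: gadget_memory_def T_sel)
  have R_eq: "RX T = product_edges G T0 id"
  proof (rule set_eqI)
    fix e :: "(nat \<times> nat) \<times> (nat \<times> nat)"
    obtain s m w where e: "e = ((s, m), w)" by (metis surj_pair)
    define a where "a \<longleftrightarrow> (if s \<in> S1 G then fst w = act G s (nxt T0 m) else (s, fst w) \<in> E G)"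
    have upd: "upd T m (obs G (fst w)) = upd T0 m (obs G (fst w))" if "a" "m \<in> mem T0"
      using that act_less[OF T, of m s] edge_less[of s "fst w"] obs_less[of "fst w"] T_sel
      unfolding a_def by (cases "s \<in> S1 G") simp_all
    show "e \<in> RX T \<longleftrightarrow> e \<in> product_edges G T0 id"
      unfolding e product_edges_iff gm T_sel id_apply if_cancel a_def[symmetric]
      using upd by (cases "a \<and> m \<in> mem T0") auto
  qed
  let ?HE = "edges (fix_player1 H T)" and ?V2 = "V2 (fix_player1 H T)" and ?V3 = "V3 (fix_player1 H T)"
  let ?R = "RX T"
  define v0 where "v0 = (s0, upd T0 (init T0) (obs G s0))"
  define V where "V = ?R\<^sup>* `` {v0}"
  have v0: "v0 \<in> V" "initial_vertex H T s0 = v0" "fst v0 < n" "snd v0 \<in> mem T"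
    using s0 obs_less[OF s0] TG T upd_mem[OF T, of "init T" "obs G s0"]
    by (simp_all add: V_def v0_def initial_vertex_def obs_H(1) T_sel transducer_def)
  have Vm: "fst v < n \<and> snd v \<in> mem T" if "v \<in> V" for v
  proof -
    have "(v0, v) \<in> ?R\<^sup>*" using that by (simp add: V_def)
    then show ?thesis
    proof induction
      case (step y z)
      then show ?case using RX_range[OF T, of "fst y" "snd y" z] by simp
    qed (use v0 in simp)
  qed
  have Vsucc: "w \<in> V" if "v \<in> V" "(v, w) \<in> ?R" for v w
    using that unfolding V_def by (auto intro: rtrancl_into_rtrancl)
  have "V \<subseteq> {..<n} \<times> mem T" using Vm by (auto simp: subset_iff mem_Times_iff)
  then have finV: "finite V" using T finite_subset unfolding transducer_def by blast
  have Vex: "\<exists>w\<in>V. (v, w) \<in> ?R" if v: "v \<in> V" for v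
  proof -
    obtain s m where sm: "v = (s, m)" by (cases v)
    have s: "s < n" "m \<in> mem T" using Vm[OF v] sm by auto
    have "\<exists>w. (v, w) \<in> ?R"
    proof (cases "s \<in> S1 G")
      case True
      then show ?thesis using s(2) unfolding sm product_edges_def by auto
    next
      case False
      then have "s \<in> S2 G \<union> SX G" using s(1) in_states by blast
      then obtain t where "(s, t) \<in> E G" using graph_G unfolding game_graph_def by blast
      then show ?thesis using s(2) False unfolding sm product_edges_def by auto
    qed
    then show ?thesis using Vsucc[OF v] by blast
  qed
  have "\<exists>ii ww. gadget_winning ?R (random_vertices G) (p \<circ> fst) D V ii ww"
  proof (rule gadget_winning_exists[OF finV])
    show "?R `` {v} \<subseteq> V" if "v \<in> V" for v using Vsucc[OF that] by blast
    show "\<exists>w\<in>V. (v, w) \<in> ?R" if "v \<in> V" for v by (rule Vex[OF that])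
    show "\<not> odd_end_component ?R (random_vertices G) (p \<circ> fst) U" if "U \<subseteq> V" for U
      using no that unfolding R_eq V_def v0_def by blast
    show "(p \<circ> fst) v \<le> D" if "v \<in> V" for v using Vm[OF that] p_le by simp
  qed
  then obtain ii ww where gw: "gadget_winning ?R (random_vertices G) (p \<circ> fst) D V ii ww" by blast
  have ww: "(v, ww v) \<in> ?R" and iiD: "ii v \<le> D" if "v \<in> V" for v
    using gw that unfolding gadget_winning_def by fastforce+
  \<comment> \<open>A strategy must give legal moves at all vertices, also at those that the play
    cannot reach: there the threshold is 0 and the successor arbitrary. Memory values stay unchanged
    on entering a gadget because \<open>T\<close> ignores \<open>l\<close>.\<close>
  define \<tau>1 where "\<tau>1 x m = (let s = x mod n in
     if x < n then ((3 + 2 * (if (x, m) \<in> V then ii (x, m) else 0)) * n + x, m)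
     else if s \<in> SX G \<and> (s, m) \<in> V then ww (s, m) else SOME w. ((x, m), w) \<in> ?HE)" for x m
  define \<tau> where "\<tau> h = \<tau>1 (fst (last h)) (snd (last h))" for h :: "(nat \<times> nat) list"
  have strat: "strategy (fix_player1 H T) ?V3 \<tau>"
    unfolding strategy_def
  proof (intro allI impI)
    fix h :: "(nat \<times> nat) list" assume h: "h \<noteq> [] \<and> last h \<in> ?V3"
    obtain x m where xm: "last h = (x, m)" by (cases "last h")
    have xm': "m \<in> mem T" "x \<in> SX H" using h xm by (auto simp: fix_player1_def)
    have \<tau>h: "\<tau> h = \<tau>1 x m" by (simp add: \<tau>_def xm)
    show "(last h, \<tau> h) \<in> ?HE"
    proof (cases "x < n")
      case True
      then have "x \<in> SX G" using xm'(2) by (auto simp: layered_game_def)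
      moreover have "(if (x, m) \<in> V then ii (x, m) else 0) \<le> D" using iiD by simp
      ultimately show ?thesis
        unfolding xm \<tau>h using edges_random[OF T, of x m] xm'(1) True T_sel(5)[of m]
        by (auto simp: \<tau>1_def Let_def)
    next
      case False
      then have x1: "x div n = 1" using xm'(2) in_states[of x] by (simp add: layered_game_def)
      define s where "s = x mod n"
      have s: "s < n" "x = 1 * n + s" using n_pos x1 div_mult_mod_eq[of x n] by (simp_all add: s_def)
      show ?thesis
      proof (cases "s \<in> SX G \<and> (s, m) \<in> V")
        case True
        then have "((s, m), ww (s, m)) \<in> ?R" using ww by blast
        then have "((x, m), ww (s, m)) \<in> ?HE"
          using RX_random[OF T, of s m] edges_choice[OF T, of s 1 0 m] True s(2) gm by simp
        then show ?thesis unfolding xm \<tau>h using False True by (simp add: \<tau>1_def Let_def s_def)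
      next
        case F: False
        have "\<exists>w. ((x, m), w) \<in> ?HE"
        proof -
          obtain t where "(x, t) \<in> E H" using xm'(2) game_graph_H unfolding game_graph_def by blast
          then show ?thesis using xm'(1) unfolding edges_H by blast
        qed
        moreover have "\<tau>1 x m = (SOME w. ((x, m), w) \<in> ?HE)"
          unfolding \<tau>1_def Let_def s_def[symmetric] if_not_P[OF False] if_not_P[OF F] ..
        ultimately show ?thesis unfolding xm \<tau>h by (metis someI_ex)
      qed
    qed
  qed
  have "\<rho> \<in> parity (q \<circ> fst)"
    if \<pi>: "strategy (fix_player1 H T) ?V2 \<pi>" and out: "outcome (fix_player1 H T) \<tau> \<pi> v0 \<rho>" for \<pi> \<rho>
  proof -
    define lay where "lay k = fst (\<rho> k) div n" for k
    define v where "v k = (fst (\<rho> k) mod n, snd (\<rho> k))" for k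
    have \<rho>_eq: "\<rho> k = (lay k * n + fst (v k), snd (v k))" for k
      by (simp add: lay_def v_def prod_eq_iff)
    have lv: "lay k = j" "v k = (s, m)" if "\<rho> k = (j * n + s, m)" "s < n" for k j s m
      unfolding lay_def v_def that(1) fst_conv snd_conv layer_div[OF that(2)] by simp_all
    have lv0: "lay k = 0" "v k = w" if "\<rho> k = w" "fst w < n" for k w
      using lv[of k 0 "fst w" "snd w"] that by simp_all
    have st2: "(\<rho> k, \<rho> (Suc k)) \<in> ?HE" if "\<rho> k \<in> ?V2" for k
    proof -
      have "\<rho> (Suc k) = \<pi> (map \<rho> [0..<Suc k])" using out that unfolding outcome_def by blast
      moreover have "(last (map \<rho> [0..<Suc k]), \<pi> (map \<rho> [0..<Suc k])) \<in> ?HE"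
        using \<pi>[unfolded strategy_def, rule_format, of "map \<rho> [0..<Suc k]"] that by simp
      ultimately show ?thesis by simp
    qed
    have st3: "\<rho> (Suc k) = \<tau>1 (fst (\<rho> k)) (snd (\<rho> k))" if "\<rho> k \<in> ?V3" for k
      using out that unfolding outcome_def \<tau>_def by simp
    \<comment> \<open>\<open>J\<close> confines the play to the reachable part and to the layers
      belonging to the chosen thresholds; \<open>S\<close> is one step of
      \<open>gadget_play\<close>. Together they allow the induction along the play.\<close>
    define J where "J k \<longleftrightarrow> v k \<in> V \<and> (lay k = 0 \<or> v k \<in> random_vertices G \<and>
        (lay k = 1 \<or> lay k = 3 + 2 * ii (v k) \<or> lay k = 2 + 2 * ii (v k)))" for k
    define S where "S k \<longleftrightarrow>
     (lay k = 0 \<and> v k \<notin> random_vertices G \<and> lay (Suc k) = 0 \<and> (v k, v (Suc k)) \<in> ?R) \<or>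
     (v k \<in> random_vertices G \<and>
       ((lay k = 0 \<and> lay (Suc k) = 3 + 2 * ii (v k) \<and> v (Suc k) = v k) \<or>
        (lay k = 3 + 2 * ii (v k) \<and> lay (Suc k) \<in> {1, 2 + 2 * ii (v k)} \<and> v (Suc k) = v k) \<or>
        (lay k = 2 + 2 * ii (v k) \<and> lay (Suc k) = 0 \<and> (v k, v (Suc k)) \<in> ?R) \<or>
        (lay k = 1 \<and> lay (Suc k) = 0 \<and> v (Suc k) = ww (v k))))" for k
    have step: "S k \<and> J (Suc k)" if J: "J k" for k
    proof -
      obtain s m where sm: "v k = (s, m)" by (cases "v k")
      have V: "(s, m) \<in> V" and s: "s < n" "m \<in> mem T" using J Vm[of "v k"] sm unfolding J_def by auto
      have \<rho>k: "\<rho> k = (lay k * n + s, m)" using \<rho>_eq[of k] sm by simp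
      note D_ii = iiD[OF V]
      have rv: "(s, m) \<in> random_vertices G \<longleftrightarrow> s \<in> SX G" by (simp add: random_vertices_def)
      consider (1) "lay k = 0" "s \<notin> SX G" | (2) "lay k = 0" "s \<in> SX G"
        | (3) "lay k = 3 + 2 * ii (s, m)" "s \<in> SX G" | (4) "lay k = 2 + 2 * ii (s, m)" "s \<in> SX G"
        | (5) "lay k = 1" "s \<in> SX G"
        using J unfolding J_def sm rv by metis
      then show ?thesis
      proof cases
        case 1
        have "\<rho> k \<in> ?V2" using vertex_owner(1)[OF s 1(2)] \<rho>k 1(1) by simp
        then have e: "((s, m), \<rho> (Suc k)) \<in> ?R"
          using st2[of k] edges_original[OF T s(1) 1(2)] \<rho>k 1(1) by simp
        have w: "\<rho> (Suc k) \<in> V" by (rule Vsucc[OF V e])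
        then have "lay (Suc k) = 0" "v (Suc k) = \<rho> (Suc k)" using lv0[OF refl] Vm by blast+
        then show ?thesis using e w 1 unfolding S_def J_def by (simp add: sm rv)
      next
        case 2
        have "\<rho> k \<in> ?V3" using vertex_owner(2)[OF s 2(2)] \<rho>k 2(1) by simp
        then have "\<rho> (Suc k) = ((3 + 2 * ii (s, m)) * n + s, m)"
          using st3[of k] \<rho>k 2(1) V s(1) by (simp add: \<tau>1_def)
        then have "lay (Suc k) = 3 + 2 * ii (s, m)" "v (Suc k) = (s, m)" using lv s(1) by blast+
        then show ?thesis using V 2 unfolding S_def J_def by (simp add: sm random_vertices_def)
      next
        case 3
        have "\<rho> k \<in> ?V2" unfolding \<rho>k using vertex_owner(3)[OF s, of "lay k"] D_ii 3(1) by simp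
        then have "\<rho> (Suc k) = ((2 + 2 * ii (s, m)) * n + s, m) \<or> \<rho> (Suc k) = (1 * n + s, m)"
          using st2[of k] edges_threshold[OF T s(1) D_ii, of m "\<rho> (Suc k)"] T_sel(5)[of m]
          unfolding \<rho>k 3(1) by simp
        then have "lay (Suc k) = 2 + 2 * ii (s, m) \<or> lay (Suc k) = 1" "v (Suc k) = (s, m)"
          using lv s(1) by blast+
        then show ?thesis using V 3 unfolding S_def J_def by (auto simp: sm random_vertices_def)
      next
        case 4
        have "\<rho> k \<in> ?V2" unfolding \<rho>k using vertex_owner(3)[OF s, of "lay k"] D_ii 4(1) by simp
        then have "((s, m), \<rho> (Suc k)) \<in> ?R"
          using st2[of k] edges_choice[OF T 4(2) disjI2[OF refl] D_ii] RX_random[OF T 4(2)] gm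
          unfolding \<rho>k 4(1) by simp
        note e = this
        have w: "\<rho> (Suc k) \<in> V" by (rule Vsucc[OF V e])
        then have "lay (Suc k) = 0" "v (Suc k) = \<rho> (Suc k)" using lv0[OF refl] Vm by blast+
        then show ?thesis using e w 4 unfolding S_def J_def by (simp add: sm rv)
      next
        case 5
        have "\<rho> k \<in> ?V3" unfolding \<rho>k 5(1) using vertex_owner(4)[OF s] by simp
        then have e: "\<rho> (Suc k) = ww (s, m)"
          using st3[of k] 5 V s(1) unfolding \<rho>k by (simp add: \<tau>1_def)
        have w: "\<rho> (Suc k) \<in> V" unfolding e by (rule Vsucc[OF V ww[OF V]])
        then have "lay (Suc k) = 0" "v (Suc k) = \<rho> (Suc k)" using lv0[OF refl] Vm by blast+
        then show ?thesis using e w 5 unfolding S_def J_def by (simp add: sm rv)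
      qed
    qed
    have \<rho>0: "\<rho> 0 = v0" using out by (simp add: outcome_def)
    have J: "J k" for k
    proof (induction k)
      case 0
      then show ?case using lv0[OF \<rho>0 v0(3)] v0(1) by (simp add: J_def)
    qed (use step in blast)
    have "lay 0 = 0" using lv0[OF \<rho>0 v0(3)] by blast
    then have "gadget_play ?R (random_vertices G) ii ww lay v"
      unfolding gadget_play_def using step[OF J] unfolding S_def by blast
    moreover have "v k \<in> V" for k using J unfolding J_def by blast
    ultimately have "even_limit (\<lambda>k. gadget_priority (p \<circ> fst) D (lay k) (v k))"
      using gw unfolding gadget_winning_def by blast
    moreover have "gadget_priority (p \<circ> fst) D (lay k) (v k) = (q \<circ> fst) (\<rho> k)" for k
      by (simp add: gadget_priority_def layered_priority_def lay_def v_def)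
    ultimately show ?thesis by (simp add: parity_def even_limit_def)
  qed
  then have "player3_sure_winning (fix_player1 H T) (q \<circ> fst) (initial_vertex H T s0)"
    unfolding player3_sure_winning_def v0(2) using strat by blast
  then show ?thesis using T by blast
qed

text \<open>A strategy for the three-player game is used in \<open>G\<close> by feeding it the two gadget observations
  after every probabilistic state.  Since the classes of the states alternate, the memory can keep
  track of the class of the current state, with 3 as its value before a play from a player-1 state.\<close>

definition next_class :: "nat \<Rightarrow> nat" where
  "next_class i = (if i < 2 then Suc i else 0)"

text \<open>The first update reads the observation of the start state and has to arrive at its
  class, so the initial value is a predecessor under \<open>next_class\<close>. For class 0 the
  predecessor 2 would feed two gadget observations into the memory before the play begins; 3 avoids
  this.\<close>

definition initial_class :: "nat \<Rightarrow> nat" where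
  "initial_class s = (if s \<in> S1 G then 3 else if s \<in> S2 G then 0 else 1)"

definition simulating_transducer :: "(nat, nat) transducer \<Rightarrow> nat \<Rightarrow> (nat, nat) transducer" where
  "simulating_transducer T s =
     \<lparr>mem = prod_encode ` (mem T \<times> {..<4}),
      init = prod_encode (init T, initial_class s),
      upd = (\<lambda>e b. let (m, i) = prod_decode e in
        prod_encode (upd T (if i = 2 then gadget_memory T m else m) b, next_class i)),
      nxt = (\<lambda>e. nxt T (fst (prod_decode e)))\<rparr>"

lemma edge_classes:
  assumes "(x, t) \<in> E G"
  shows "x \<in> S2 G \<and> t \<in> SX G \<or> x \<in> SX G \<and> t \<in> S1 G"
proof -
  obtain E' where E': "E' \<subseteq> S2 G \<times> SX G"
    "E G = {(s, t). s \<in> SX G \<and> pmf (trans_prob G s) t > 0} \<union> E'"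
    using G unfolding stochastic_game_def by blast
  have "t \<in> S1 G" if "x \<in> SX G" "pmf (trans_prob G x) t > 0"
  proof -
    have "t \<in> set_pmf (trans_prob G x)" using that(2) by (simp add: set_pmf_iff)
    then show ?thesis using G that(1) by (auto simp: stochastic_game_def)
  qed
  then show ?thesis using assms E' by auto
qed

lemma state_class_iff:
  "state_class G s = 0 \<longleftrightarrow> s \<in> S1 G" "s < n \<Longrightarrow> state_class G s = 1 \<longleftrightarrow> s \<in> S2 G"
  "s < n \<Longrightarrow> state_class G s = 2 \<longleftrightarrow> s \<in> SX G"
  using disjoint in_states[of s] by (auto simp: state_class_def)

lemma transducer_simulating:
  assumes T: "transducer H T"
  shows "transducer G (simulating_transducer T s)"
proof -
  have u: "upd T m b \<in> mem T" if "m \<in> mem T" "b \<in> Obs G" for m b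
    using upd_mem[OF T that(1), of b] that(2) Obs_G by simp
  have "initial_class s < 4" "next_class i < 4" for i by (simp_all add: initial_class_def next_class_def)
  then show ?thesis
    using T nxt_A1[OF T] u gadget_memory_mem[OF T]
    by (auto simp: transducer_def simulating_transducer_def)
qed

text \<open>Forgetting the class component, by \<open>g\<close>, maps edges to edges of
  \<open>RX T\<close> and preserves states, hence priorities. At reachable vertices the recorded
  class is correct, so the gadget update happens exactly at random states and every random move of
  \<open>RX T\<close> lifts back. An odd end component therefore projects to one.\<close>

lemma simulating_no_odd_end_component:
  assumes T: "transducer H T" and s0: "s0 < n"
    and no: "\<And>U. U \<subseteq> (RX T)\<^sup>* `` {(s0, upd T (init T) (obs G s0))} \<Longrightarrow>
       \<not> odd_end_component (RX T) (random_vertices G) (p \<circ> fst) U"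
    and U: "U \<subseteq> (product_edges G (simulating_transducer T s0) id)\<^sup>* ``
       {(s0, upd (simulating_transducer T s0) (init (simulating_transducer T s0)) (obs G s0))}"
  shows "\<not> odd_end_component (product_edges G (simulating_transducer T s0) id) (random_vertices G) (p \<circ> fst) U"
proof
  let ?T = "simulating_transducer T s0"
  let ?R = "product_edges G ?T id"
  assume ec: "odd_end_component ?R (random_vertices G) (p \<circ> fst) U"
  define v0 where "v0 = (s0, upd ?T (init ?T) (obs G s0))"
  define w0 where "w0 = (s0, upd T (init T) (obs G s0))"
  define g where "g v = (fst v, fst (prod_decode (snd v)))" for v :: "nat \<times> nat"
  define ok where "ok v \<longleftrightarrow> fst v < n \<and> fst (prod_decode (snd v)) \<in> mem T \<and>
    snd (prod_decode (snd v)) = state_class G (fst v)" for v :: "nat \<times> nat"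
  have upd_S: "upd ?T (prod_encode (m, i)) b =
      prod_encode (upd T (if i = 2 then gadget_memory T m else m) b, next_class i)" for m i b
    by (simp add: simulating_transducer_def)
  have init_mem: "init T \<in> mem T" using T by (simp add: transducer_def)
  have "next_class (initial_class s0) = state_class G s0" "initial_class s0 \<noteq> 2"
    by (simp_all add: initial_class_def next_class_def state_class_def)
  moreover have "init ?T = prod_encode (init T, initial_class s0)" by (simp add: simulating_transducer_def)
  ultimately have v0_eq: "v0 = (s0, prod_encode (upd T (init T) (obs G s0), state_class G s0))"
    by (simp add: v0_def upd_S)
  have v0: "ok v0" "g v0 = w0"
    unfolding v0_eq ok_def g_def w0_def using s0 upd_mem[OF T init_mem] obs_less[OF s0] by simp_all
  have step: "(g v, g w) \<in> RX T \<and> ok w" if v: "ok v" and e: "(v, w) \<in> ?R" for v w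
  proof -
    obtain s m where sm: "v = (s, prod_encode (m, state_class G s))" "s < n" "m \<in> mem T"
      using v unfolding ok_def by (metis prod.collapse prod_decode_inverse)
    have SX2: "state_class G s = 2 \<longleftrightarrow> s \<in> SX G" by (rule state_class_iff(3)[OF sm(2)])
    define m' where "m' = upd T (if s \<in> SX G then gadget_memory T m else m) (obs G (fst w))"
    have c: "if s \<in> S1 G then fst w = act G s (nxt T m) else (s, fst w) \<in> E G"
      and w: "w = (fst w, prod_encode (m', next_class (state_class G s)))"
    proof -
      have e': "w = (fst w, upd ?T (prod_encode (m, state_class G s)) (obs G (fst w)))"
        "if s \<in> S1 G then fst w = act G s (nxt ?T (prod_encode (m, state_class G s))) else (s, fst w) \<in> E G"
        using e unfolding sm(1) product_edges_iff id_apply if_cancel by blast+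
      show "w = (fst w, prod_encode (m', next_class (state_class G s)))"
        using e'(1) unfolding upd_S SX2 m'_def .
      have "nxt ?T (prod_encode (m, state_class G s)) = nxt T m" by (simp add: simulating_transducer_def)
      then show "if s \<in> S1 G then fst w = act G s (nxt T m) else (s, fst w) \<in> E G"
        using e'(2) by simp
    qed
    have gw: "g w = (fst w, m')" by (subst w) (simp add: g_def)
    have R: "(g v, g w) \<in> RX T"
      unfolding gw unfolding sm(1) g_def using sm(3) c by (simp add: product_edges_iff m'_def)
    have "state_class G (fst w) = next_class (state_class G s)"
    proof (cases "s \<in> S1 G")
      case True
      then have "fst w \<in> S2 G" using c nxt_A1[OF T sm(3)] graph_G by (simp add: game_graph_def)
      then show ?thesis using True disjoint by (auto simp: state_class_def next_class_def)
    next
      case False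
      then have "s \<in> S2 G \<and> fst w \<in> SX G \<or> s \<in> SX G \<and> fst w \<in> S1 G" using c edge_classes by simp
      then show ?thesis using False disjoint by (auto simp: state_class_def next_class_def)
    qed
    moreover have "fst w < n" "m' \<in> mem T"
      using RX_range[OF T, of "fst (g v)" "snd (g v)" "g w"] R gw by simp_all
    ultimately have "ok w" by (subst w) (simp add: ok_def)
    then show ?thesis using R by blast
  qed
  have reach: "ok v \<and> (w0, g v) \<in> (RX T)\<^sup>*" if "(v0, v) \<in> ?R\<^sup>*" for v
    using that
  proof induction
    case (step y z)
    then show ?case using \<open>\<And>w v. ok v \<Longrightarrow> (v, w) \<in> ?R \<Longrightarrow> (g v, g w) \<in> RX T \<and> ok w\<close>[of y z]
      by (auto intro: rtrancl_into_rtrancl)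
  qed (use v0 in simp)
  have okU: "ok u" and reachU: "(w0, g u) \<in> (RX T)\<^sup>*" if "u \<in> U" for u
    using U reach that unfolding v0_def by blast+
  have conn: "(u, v) \<in> (?R \<inter> U \<times> U)\<^sup>+" if "u \<in> U" "v \<in> U" for u v
    using ec that by (auto simp: odd_end_component_def)
  have "odd_end_component (RX T) (random_vertices G) (p \<circ> fst) (g ` U)"
    unfolding odd_end_component_def
  proof (intro conjI ballI)
    show "g ` U \<noteq> {}" using ec by (simp add: odd_end_component_def)
    show "odd (Min ((p \<circ> fst) ` g ` U))"
    proof -
      have "(p \<circ> fst) ` g ` U = (p \<circ> fst) ` U" unfolding image_image by (simp add: g_def)
      then show ?thesis using ec by (simp add: odd_end_component_def)
    qed
    show "RX T `` {a} \<subseteq> g ` U" if a: "a \<in> g ` U \<inter> random_vertices G" for a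
    proof
      fix b assume "b \<in> RX T `` {a}"
      obtain u where u: "u \<in> U" "a = g u" using a by blast
      then have SX: "fst u \<in> SX G" using a by (auto simp: g_def random_vertices_def)
      obtain s m where sm: "u = (s, prod_encode (m, state_class G s))" "s < n" "m \<in> mem T"
        using okU[OF u(1)] unfolding ok_def by (metis prod.collapse prod_decode_inverse)
      have c2: "state_class G s = 2" "s \<in> SX G" "s \<notin> S1 G"
        using SX state_class_iff(3)[OF sm(2)] sm(1) disjoint by auto
      have ab: "((s, m), b) \<in> RX T" using \<open>b \<in> RX T `` {a}\<close> u(2) sm(1) by (simp add: g_def)
      \<comment> \<open>The lift of \<open>b\<close>: a random state is followed by a player-1
        state, whose class is 0.\<close>
      define w where "w = (fst b, prod_encode (snd b, 0))"
      have b: "b = (fst b, upd T (gadget_memory T m) (obs G (fst b)))" "(s, fst b) \<in> E G"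
        using ab c2 unfolding product_edges_iff by simp_all
      have w_eq: "w = (fst b, upd ?T (prod_encode (m, 2)) (obs G (fst b)))"
        unfolding w_def upd_S using b(1) by (simp add: next_class_def prod_eq_iff)
      have "prod_encode (m, 2) \<in> mem ?T" using sm(3) by (simp add: simulating_transducer_def)
      then have "(u, w) \<in> ?R"
        unfolding sm(1) product_edges_iff c2(1) using c2 b(2) w_eq by simp
      moreover have "?R `` {u} \<subseteq> U"
        using ec u(1) SX unfolding odd_end_component_def random_vertices_def by (cases u) auto
      ultimately have "w \<in> U" by blast
      moreover have "g w = b" by (simp add: g_def w_def)
      ultimately show "b \<in> g ` U" by blast
    qed
    show "(a, b) \<in> (RX T \<inter> g ` U \<times> g ` U)\<^sup>+" if a: "a \<in> g ` U" and b: "b \<in> g ` U" for a b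
    proof -
      obtain u v where uv: "u \<in> U" "v \<in> U" "a = g u" "b = g v" using a b by blast
      have map: "(g x, g y) \<in> RX T \<inter> g ` U \<times> g ` U" if "(x, y) \<in> ?R \<inter> U \<times> U" for x y
        using that step[of x y] okU by blast
      have "(g u, g v) \<in> (RX T \<inter> g ` U \<times> g ` U)\<^sup>+"
        using conn[OF uv(1,2)]
      proof induction
        case (base y)
        then show ?case using map by blast
      next
        case (step y z)
        then show ?case using map[of y z] by (meson trancl_into_trancl)
      qed
      then show ?thesis using uv by simp
    qed
  qed
  moreover have "g ` U \<subseteq> (RX T)\<^sup>* `` {w0}" using reachU by blast
  ultimately show False using no unfolding w0_def by blast
qed

end

section \<open>The construction on a random access machine\<close>

definition ends :: "ram_program \<Rightarrow> ram \<Rightarrow> nat \<Rightarrow> (ram \<Rightarrow> bool) \<Rightarrow> bool" where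
  "ends P s t B \<longleftrightarrow> (\<exists>t' s'. exec P s t' s' \<and> t' \<le> t \<and> B s')"

fun loop_free :: "ram_program \<Rightarrow> bool" where
  "loop_free (Seq P Q) = (loop_free P \<and> loop_free Q)"
| "loop_free (IfLess a b P Q) = (loop_free P \<and> loop_free Q)"
| "loop_free (WhileLess a b P) = False"
| "loop_free _ = True"

text \<open>Lets the simplifier execute straight-line code symbolically. The equation for loops is a
  placeholder, since the function is only related to \<open>exec\<close> under
  \<open>loop_free\<close>.\<close>

fun run :: "ram_program \<Rightarrow> ram \<Rightarrow> ram" where
  "run (Const r c) s = s\<lparr>reg := (reg s)(r := c)\<rparr>"
| "run (Add r a b) s = s\<lparr>reg := (reg s)(r := reg s a + reg s b)\<rparr>"
| "run (Sub r a b) s = s\<lparr>reg := (reg s)(r := reg s a - reg s b)\<rparr>"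
| "run (Load r a) s = s\<lparr>reg := (reg s)(r := memory s (reg s a))\<rparr>"
| "run (Store a r) s = s\<lparr>memory := (memory s)(reg s a := reg s r)\<rparr>"
| "run (Write r) s = s\<lparr>written := written s @ [reg s r]\<rparr>"
| "run (Seq P Q) s = run Q (run P s)"
| "run (IfLess a b P Q) s = (if reg s a < reg s b then run P s else run Q s)"
| "run (WhileLess a b P) s = s"

fun weight :: "ram_program \<Rightarrow> nat" where
  "weight (Seq P Q) = weight P + weight Q"
| "weight (IfLess a b P Q) = 1 + (weight P + weight Q)"
| "weight _ = 1"

lemma exec_run: "loop_free P \<Longrightarrow> \<exists>t\<le>weight P. exec P s t (run P s)"
proof (induction P arbitrary: s)
  case (Seq P Q)
  then obtain t t' where "t \<le> weight P" "exec P s t (run P s)" "t' \<le> weight Q"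
    "exec Q (run P s) t' (run Q (run P s))" by fastforce
  then show ?case by (intro exI[of _ "t + t'"]) (auto intro: exec.Seq)
next
  case (IfLess a b P Q)
  then obtain t t' where t: "t \<le> weight P" "exec P s t (run P s)" "t' \<le> weight Q" "exec Q s t' (run Q s)"
    by fastforce
  show ?case
  proof (cases "reg s a < reg s b")
    case True
    then show ?thesis using t by (intro exI[of _ "1 + t"]) (auto intro: exec.IfTrue simp del: One_nat_def)
  next
    case False
    then show ?thesis using t by (intro exI[of _ "1 + t'"]) (auto intro: exec.IfFalse simp del: One_nat_def)
  qed
qed (auto intro: exec.intros simp del: One_nat_def)

lemma ends_run: "loop_free P \<Longrightarrow> weight P \<le> t \<Longrightarrow> B (run P s) \<Longrightarrow> ends P s t B"
  using exec_run[of P s] unfolding ends_def by (meson le_trans)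

lemma ends_Seq:
  assumes "ends P s t B" "\<And>s'. B s' \<Longrightarrow> ends Q s' t' C" "t + t' \<le> u"
  shows "ends (Seq P Q) s u C"
proof -
  obtain t1 s1 where 1: "exec P s t1 s1" "t1 \<le> t" "B s1" using assms(1) by (auto simp: ends_def)
  have "ends Q s1 t' C" by (rule assms(2)) (rule 1)
  then obtain t2 s2 where 2: "exec Q s1 t2 s2" "t2 \<le> t'" "C s2" by (auto simp: ends_def)
  have "exec (Seq P Q) s (t1 + t2) s2" using 1(1) 2(1) by (rule exec.Seq)
  then show ?thesis using 1 2 assms(3) unfolding ends_def by (intro exI[of _ "t1 + t2"] exI[of _ s2]) simp
qed

lemma ends_run_Seq:
  assumes "loop_free P" "ends Q (run P s) t' C" "weight P + t' \<le> u"
  shows "ends (Seq P Q) s u C"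
proof (rule ends_Seq[where B = "\<lambda>s'. s' = run P s", OF _ _ assms(3)])
  show "ends P s (weight P) (\<lambda>s'. s' = run P s)" by (rule ends_run) (use assms(1) in simp_all)
qed (use assms(2) in simp)

lemma ends_IfLess:
  assumes "reg s a < reg s b \<Longrightarrow> ends P s t B" "\<not> reg s a < reg s b \<Longrightarrow> ends Q s t B" "1 + t \<le> u"
  shows "ends (IfLess a b P Q) s u B"
proof (cases "reg s a < reg s b")
  case True
  then obtain t1 s1 where 1: "exec P s t1 s1" "t1 \<le> t" "B s1" using assms(1) by (auto simp: ends_def)
  have "exec (IfLess a b P Q) s (1 + t1) s1" using True 1(1) by (rule exec.IfTrue)
  then show ?thesis using 1 assms(3) unfolding ends_def by (intro exI[of _ "1 + t1"] exI[of _ s1]) simp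
next
  case False
  then obtain t1 s1 where 1: "exec Q s t1 s1" "t1 \<le> t" "B s1" using assms(2) by (auto simp: ends_def)
  have "exec (IfLess a b P Q) s (1 + t1) s1" using False 1(1) by (rule exec.IfFalse)
  then show ?thesis using 1 assms(3) unfolding ends_def by (intro exI[of _ "1 + t1"] exI[of _ s1]) simp
qed

text \<open>The invariant and the cost are indexed by the iteration. Variable costs matter for the
  linear bound: copying a successor list costs time proportional to its own length, and only the sum
  over all states is bounded by the number of transitions.\<close>

lemma ends_WhileLess:
  assumes "I 0 s"
    and "\<And>i s. i < N \<Longrightarrow> I i s \<Longrightarrow> reg s a < reg s b \<and> ends P s (c i) (I (Suc i))"
    and "\<And>s. I N s \<Longrightarrow> \<not> reg s a < reg s b" and "1 + (\<Sum>i<N. 1 + c i) \<le> u"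
  shows "ends (WhileLess a b P) s u (I N)"
proof -
  have "ends (WhileLess a b P) s (1 + (\<Sum>i\<in>{j..<N}. 1 + c i)) (I N)" if "j \<le> N" "I j s" for j s
    using that
  proof (induction "N - j" arbitrary: j s)
    case 0
    then have j: "j = N" by simp
    then have "exec (WhileLess a b P) s 1 s" using 0 assms(3) by (intro exec.WhileFalse) simp
    then show ?case using 0 j unfolding ends_def by auto
  next
    case (Suc x)
    then have j: "j < N" by simp
    then obtain t1 s1 where 1: "exec P s t1 s1" "t1 \<le> c j" "I (Suc j) s1" and less: "reg s a < reg s b"
      using assms(2)[of j s] Suc.prems by (auto simp: ends_def)
    have "ends (WhileLess a b P) s1 (1 + (\<Sum>i\<in>{Suc j..<N}. 1 + c i)) (I N)"
      using Suc.hyps(1)[of "Suc j" s1] Suc.hyps(2) j 1(3) by simp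
    then obtain t2 s2 where 2: "exec (WhileLess a b P) s1 t2 s2"
      "t2 \<le> 1 + (\<Sum>i\<in>{Suc j..<N}. 1 + c i)" "I N s2" by (auto simp: ends_def)
    have "exec (WhileLess a b P) s (1 + t1 + t2) s2" using less 1(1) 2(1) by (rule exec.WhileTrue)
    moreover have "(\<Sum>i\<in>{j..<N}. 1 + c i) = 1 + c j + (\<Sum>i\<in>{Suc j..<N}. 1 + c i)"
      using j by (simp add: sum.atLeast_Suc_lessThan)
    then have "1 + t1 + t2 \<le> 1 + (\<Sum>i\<in>{j..<N}. 1 + c i)"
      using 1(2) 2(2) by linarith
    ultimately show ?case using 2(3) unfolding ends_def by blast
  qed
  from this[of 0 s] have "ends (WhileLess a b P) s (1 + (\<Sum>i<N. 1 + c i)) (I N)"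
    using assms(1) by (simp add: atLeast0LessThan)
  then show ?thesis using assms(4) unfolding ends_def by (meson le_trans)
qed

fun seqs :: "ram_program list \<Rightarrow> ram_program" where
  "seqs [] = Const 12 0"
| "seqs [P] = P"
| "seqs (P # Q # Ps) = Seq P (seqs (Q # Ps))"

section \<open>The program that writes the encoded three-player game\<close>

text \<open>Register conventions: 0, 18, 19 and 24 hold the constants 1, 2, 4 and 0; registers 1, 2, 3 the
  parameters of the input; 4 the maximal priority; 5 a state counter and 6 the address of its block;
  7 to 10 the entries of the block; 13 the number of the state of the output game; 14 a level
  counter; 22 and 23 the priority and the class written for a gadget layer.\<close>

definition ram_copy :: ram_program where
  "ram_copy = Seq (Const 11 0) (WhileLess 11 10 (seqs [Load 12 6, Write 12, Add 6 6 0, Add 11 11 0]))"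

text \<open>Serves layer 1 and all even layers, which differ only in class and priority. Each run
  rescans the input from address 3, just behind the parameters, because random states repeat their
  original successor lists.\<close>

definition ram_layer :: ram_program where
  "ram_layer = seqs [Const 5 0, Const 6 3, WhileLess 5 1 (seqs [
     seqs [Load 7 6, Add 12 6 18, Add 12 12 0, Load 10 12, Add 6 6 19, Write 23, Write 3, Write 22],
     IfLess 0 7 (Seq (Write 10) ram_copy) (seqs [Write 0, Write 13, Add 6 6 10]),
     seqs [Add 5 5 0, Add 13 13 0]])]"

text \<open>Here every copy has two successors, the copies one layer below and in layer 1, so the
  blocks are written without reading the input.\<close>

definition ram_threshold_layer :: ram_program where
  "ram_threshold_layer = Seq (Const 5 0) (WhileLess 5 1 (seqs [Write 0, Write 3, Write 22, Write 18,
     Sub 12 13 1, Write 12, Add 12 1 5, Write 12, Add 5 5 0, Add 13 13 0]))"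

text \<open>Registers 21 and 20 hold \<open>3 * n\<close> and \<open>2 * n\<close>: the successors
  of a random state start in layer 3 and lie two layers apart.\<close>

definition ram_original :: ram_program where
  "ram_original = seqs [Const 5 0, Const 6 3, WhileLess 5 1 (seqs [
     seqs [Load 7 6, Write 7, Add 12 6 0, Load 8 12, Write 8, Add 12 12 0, Load 9 12, Write 9,
       Add 12 12 0, Load 10 12, Add 6 6 19],
     IfLess 0 7 (seqs [seqs [Write 17, Add 12 21 5, Const 11 0],
         WhileLess 11 17 (seqs [Write 12, Add 12 12 20, Add 11 11 0]), Add 6 6 10])
       (Seq (Write 10) ram_copy),
     Add 5 5 0])]"

text \<open>Finds the maximal priority, which bounds the thresholds to be generated. Registers 4 and
  5 start at the initial value 0 of all registers. \<open>Const 12 0\<close> serves as a no-op, and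
  adding register 24, which is 0, copies a register.\<close>

definition ram_scan :: ram_program where
  "ram_scan = Seq (Const 6 3) (WhileLess 5 1 (seqs [Add 12 6 18, Load 9 12, Add 12 12 0, Load 10 12,
     IfLess 4 9 (Add 4 9 24) (Const 12 0), Add 6 6 19, Add 6 6 10, Add 5 5 0]))"

definition ram_priority :: ram_program where
  "ram_priority = IfLess 4 14 (Add 22 4 24) (Add 22 14 24)"

definition ram_gadgets :: ram_program where
  "ram_gadgets = WhileLess 14 15 (seqs [ram_priority, ram_layer, Seq (Add 14 14 0) ram_priority,
     ram_threshold_layer, Add 14 14 0])"

text \<open>Without multiplication, the number of states \<open>(2 * D + 4) * n\<close> is obtained
  by starting from \<open>2 * n\<close> and adding \<open>n\<close> for each of the
  \<open>2 * D + 2\<close> gadget levels; this takes time linear in \<open>D\<close>.\<close>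

definition ram_main :: ram_program where
  "ram_main = seqs [
     seqs [Const 0 1, Const 18 2, Const 19 4, Const 12 0, Load 1 12, Load 2 0, Load 3 18],
     ram_scan,
     seqs [Add 17 4 0, Add 15 17 17, Add 20 1 1, Add 21 20 1, Add 16 1 1, Const 14 0],
     WhileLess 14 15 (Seq (Add 16 16 1) (Add 14 14 0)),
     seqs [Write 16, Write 2, Add 12 3 0, Write 12],
     ram_original,
     seqs [Add 13 1 24, Const 23 2, Add 22 4 24],
     ram_layer,
     seqs [Const 14 0, Const 23 1],
     ram_gadgets]"

section \<open>Output and cost of the subprograms\<close>

lemma ends_ram_copy:
  assumes "reg s 0 = 1"
  shows "ends ram_copy s (2 + 5 * reg s 10) (\<lambda>s'. memory s' = memory s \<and>
     written s' = written s @ map (memory s) [reg s 6..<reg s 6 + reg s 10] \<and>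
     reg s' 6 = reg s 6 + reg s 10 \<and> (\<forall>r. r \<notin> {6, 11, 12} \<longrightarrow> reg s' r = reg s r))"
proof -
  define I where "I i s' \<longleftrightarrow> memory s' = memory s \<and> reg s' 11 = i \<and>
     written s' = written s @ map (memory s) [reg s 6..<reg s 6 + i] \<and>
     reg s' 6 = reg s 6 + i \<and> (\<forall>r. r \<notin> {6, 11, 12} \<longrightarrow> reg s' r = reg s r)" for i and s' :: ram
  have "ends ram_copy s (2 + 5 * reg s 10) (I (reg s 10))"
    unfolding ram_copy_def
  proof (rule ends_run_Seq[where t' = "1 + 5 * reg s 10"])
    show "ends (WhileLess 11 10 (seqs [Load 12 6, Write 12, Add 6 6 0, Add 11 11 0])) (run (Const 11 0) s)
        (1 + 5 * reg s 10) (I (reg s 10))"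
    proof (rule ends_WhileLess[where c = "\<lambda>_. 4"])
      show "I 0 (run (Const 11 0) s)" by (simp add: I_def)
    next
      fix i s' assume "i < reg s 10" "I i s'"
      then show "reg s' 11 < reg s' 10 \<and>
          ends (seqs [Load 12 6, Write 12, Add 6 6 0, Add 11 11 0]) s' 4 (I (Suc i))"
        using assms by (auto intro!: ends_run simp: I_def)
    qed (auto simp: I_def)
  qed simp_all
  then show ?thesis by (simp add: I_def ends_def) blast
qed

text \<open>Separates the machine from the games: only the memory layout is assumed, with
  \<open>ptr s\<close> the address of the block of \<open>s\<close> and four header cells before its
  successor list.\<close>

locale encoding =
  fixes M :: "nat \<Rightarrow> nat" and n k l :: nat and cls ob pr :: "nat \<Rightarrow> nat" and succs :: "nat \<Rightarrow> nat list"
    and ptr :: "nat \<Rightarrow> nat"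
  assumes params: "M 0 = n" "M 1 = k" "M 2 = l"
    and ptr_0: "ptr 0 = 3"
    and ptr_Suc: "\<And>s. s < n \<Longrightarrow> ptr (Suc s) = ptr s + 4 + length (succs s)"
    and block: "\<And>s. s < n \<Longrightarrow> M (ptr s) = cls s" "\<And>s. s < n \<Longrightarrow> M (ptr s + 1) = ob s"
      "\<And>s. s < n \<Longrightarrow> M (ptr s + 2) = pr s" "\<And>s. s < n \<Longrightarrow> M (ptr s + 3) = length (succs s)"
      "\<And>s. s < n \<Longrightarrow> map M [ptr s + 4..<ptr s + 4 + length (succs s)] = succs s"
begin

definition max_priority :: nat where
  "max_priority = Max (insert 0 (pr ` {..<n}))"

abbreviation (input) "D \<equiv> max_priority"

definition original_block :: "nat \<Rightarrow> nat list" where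
  "original_block s = [cls s, ob s, pr s] @
     (if 1 < cls s then Suc D # map (\<lambda>i. (3 + 2 * i) * n + s) [0..<Suc D] else length (succs s) # succs s)"

definition layer_block :: "nat \<Rightarrow> nat \<Rightarrow> nat \<Rightarrow> nat \<Rightarrow> nat list" where
  "layer_block c q x s = [c, l, q] @ (if 1 < cls s then length (succs s) # succs s else [1, x])"

definition threshold_block :: "nat \<Rightarrow> nat \<Rightarrow> nat \<Rightarrow> nat list" where
  "threshold_block q x s = [1, l, q, 2, x - n, n + s]"

definition encoded_output :: "nat list" where
  "encoded_output = [(2 * D + 4) * n, k, l + 1] @ concat (map original_block [0..<n]) @
     concat (map (\<lambda>s. layer_block 2 D (n + s) s) [0..<n]) @
     concat (map (\<lambda>i. concat (map (\<lambda>s. layer_block 1 (min (2 * i) D) ((2 + 2 * i) * n + s) s) [0..<n]) @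
       concat (map (\<lambda>s. threshold_block (min (2 * i + 1) D) ((3 + 2 * i) * n + s) s) [0..<n])) [0..<Suc D])"

definition env :: "ram \<Rightarrow> bool" where
  "env s \<longleftrightarrow> memory s = M \<and> reg s 0 = 1 \<and> reg s 1 = n \<and> reg s 2 = k \<and> reg s 3 = l \<and> reg s 4 = D \<and>
     reg s 15 = 2 * D + 2 \<and> reg s 17 = Suc D \<and> reg s 18 = 2 \<and> reg s 19 = 4 \<and> reg s 20 = 2 * n \<and>
     reg s 21 = 3 * n \<and> reg s 24 = 0"

lemma block_Suc:
  "s < n \<Longrightarrow> M (Suc (ptr s)) = ob s" "s < n \<Longrightarrow> M (Suc (Suc (ptr s))) = pr s"
  "s < n \<Longrightarrow> M (Suc (Suc (Suc (ptr s)))) = length (succs s)"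
  "s < n \<Longrightarrow> M (Suc (ptr s + 2)) = length (succs s)"
  using block[of s] by (simp_all add: numeral_2_eq_2 numeral_3_eq_3)

lemma ends_ram_layer:
  assumes s: "env s" "reg s 23 = c" "reg s 22 = q" "reg s 13 = x"
  shows "ends ram_layer s (3 + (\<Sum>i<n. 30 + 5 * length (succs i))) (\<lambda>s'. env s' \<and> reg s' 13 = x + n \<and>
     reg s' 14 = reg s 14 \<and> reg s' 23 = c \<and>
     written s' = written s @ concat (map (\<lambda>i. layer_block c q (x + i) i) [0..<n]))"
proof -
  \<comment> \<open>Two indices, because within an iteration the block of a state is completed
    before the state counter and the output number advance.\<close>
  define J where "J i y s' \<longleftrightarrow> env s' \<and> reg s' 5 = i \<and> reg s' 6 = ptr y \<and> reg s' 13 = x + i \<and>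
     reg s' 14 = reg s 14 \<and> reg s' 22 = q \<and> reg s' 23 = c \<and>
     written s' = written s @ concat (map (\<lambda>i. layer_block c q (x + i) i) [0..<y])" for i y and s' :: ram
  define I where "I i = J i i" for i
  have "ends ram_layer s (3 + (\<Sum>i<n. 30 + 5 * length (succs i))) (I n)"
    unfolding ram_layer_def seqs.simps
  proof (rule ends_run_Seq[where t' = "2 + (\<Sum>i<n. 30 + 5 * length (succs i))"], simp,
      rule ends_run_Seq[where t' = "1 + (\<Sum>i<n. 30 + 5 * length (succs i))"], simp,
      rule ends_WhileLess[where c = "\<lambda>i. 29 + 5 * length (succs i)"])
    show "I 0 (run (Const 6 3) (run (Const 5 0) s))"
      using s by (simp add: I_def J_def env_def ptr_0)
  next
    fix i s1 assume i: "i < n" and I: "I i s1"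
    define s2 where "s2 = run (seqs [Load 7 6, Add 12 6 18, Add 12 12 0, Load 10 12, Add 6 6 19,
      Write 23, Write 3, Write 22]) s1"
    have s2: "env s2" "reg s2 5 = i" "reg s2 6 = ptr i + 4" "reg s2 13 = x + i" "reg s2 14 = reg s 14"
      "reg s2 22 = q" "reg s2 23 = c" "reg s2 7 = cls i" "reg s2 10 = length (succs i)" "reg s2 0 = 1"
      "memory s2 = M"
      "written s2 = written s @ concat (map (\<lambda>i. layer_block c q (x + i) i) [0..<i]) @ [c, l, q]"
      using I i by (simp_all add: s2_def I_def J_def env_def block block_Suc)
    have J2: "ends (IfLess 0 7 (Seq (Write 10) ram_copy) (Seq (Write 0) (Seq (Write 13) (Add 6 6 10)))) s2
        (10 + 5 * length (succs i)) (J i (Suc i))"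
    proof (rule ends_IfLess[where t = "9 + 5 * length (succs i)"])
      assume "reg s2 0 < reg s2 7"
      then have c1: "1 < cls i" using s2 by simp
      define s3 where "s3 = run (Write 10) s2"
      have s3: "reg s3 0 = 1" "reg s3 10 = length (succs i)" "reg s3 6 = ptr i + 4" "memory s3 = M"
        "written s3 = written s2 @ [length (succs i)]" "reg s3 = reg s2"
        using s2 by (simp_all add: s3_def)
      show "ends (Seq (Write 10) ram_copy) s2 (9 + 5 * length (succs i)) (J i (Suc i))"
      proof (rule ends_run_Seq[where t' = "2 + 5 * length (succs i)"])
        have "ends ram_copy s3 (2 + 5 * length (succs i)) (\<lambda>s'. memory s' = memory s3 \<and>
           written s' = written s3 @ map (memory s3) [reg s3 6..<reg s3 6 + reg s3 10] \<and>
           reg s' 6 = reg s3 6 + reg s3 10 \<and> (\<forall>r. r \<notin> {6, 11, 12} \<longrightarrow> reg s' r = reg s3 r))"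
          using ends_ram_copy[OF s3(1)] unfolding s3(2) .
        moreover have "J i (Suc i) s'" if "memory s' = memory s3 \<and>
           written s' = written s3 @ map (memory s3) [reg s3 6..<reg s3 6 + reg s3 10] \<and>
           reg s' 6 = reg s3 6 + reg s3 10 \<and> (\<forall>r. r \<notin> {6, 11, 12} \<longrightarrow> reg s' r = reg s3 r)" for s'
          using that s2 c1 unfolding J_def s3 env_def
          by (simp add: ptr_Suc[OF i] layer_block_def block(5)[OF i])
        ultimately show "ends ram_copy (run (Write 10) s2) (2 + 5 * length (succs i)) (J i (Suc i))"
          unfolding ends_def s3_def[symmetric] by blast
      qed simp_all
    next
      assume "\<not> reg s2 0 < reg s2 7"
      then have c1: "\<not> 1 < cls i" using s2 by simp
      show "ends (Seq (Write 0) (Seq (Write 13) (Add 6 6 10))) s2 (9 + 5 * length (succs i)) (J i (Suc i))"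
        by (rule ends_run) (use s2 c1 in \<open>simp_all add: J_def env_def ptr_Suc[OF i] layer_block_def\<close>)
    qed simp
    have "ends (Seq (Seq (Load 7 6) (Seq (Add 12 6 18) (Seq (Add 12 12 0) (Seq (Load 10 12) (Seq (Add 6 6 19)
          (Seq (Write 23) (Seq (Write 3) (Write 22)))))))) (Seq (IfLess 0 7 (Seq (Write 10) ram_copy)
          (Seq (Write 0) (Seq (Write 13) (Add 6 6 10)))) (Seq (Add 5 5 0) (Add 13 13 0)))) s1
        (29 + 5 * length (succs i)) (I (Suc i))"
    proof (rule ends_run_Seq[where t' = "12 + 5 * length (succs i)"])
      show "ends (Seq (IfLess 0 7 (Seq (Write 10) ram_copy)
          (Seq (Write 0) (Seq (Write 13) (Add 6 6 10)))) (Seq (Add 5 5 0) (Add 13 13 0)))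
        (run (Seq (Load 7 6) (Seq (Add 12 6 18) (Seq (Add 12 12 0) (Seq (Load 10 12) (Seq (Add 6 6 19)
          (Seq (Write 23) (Seq (Write 3) (Write 22)))))))) s1) (12 + 5 * length (succs i)) (I (Suc i))"
        unfolding s2_def[unfolded seqs.simps, symmetric]
      proof (rule ends_Seq[OF J2])
        fix s4 assume "J i (Suc i) s4"
        then show "ends (Seq (Add 5 5 0) (Add 13 13 0)) s4 2 (I (Suc i))"
          by (intro ends_run) (simp_all add: J_def I_def env_def)
      qed simp
    qed simp_all
    then show "reg s1 5 < reg s1 1 \<and> ends (Seq (Seq (Load 7 6) (Seq (Add 12 6 18) (Seq (Add 12 12 0) (Seq (Load 10 12) (Seq (Add 6 6 19)
          (Seq (Write 23) (Seq (Write 3) (Write 22)))))))) (Seq (IfLess 0 7 (Seq (Write 10) ram_copy)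
          (Seq (Write 0) (Seq (Write 13) (Add 6 6 10)))) (Seq (Add 5 5 0) (Add 13 13 0)))) s1
        (29 + 5 * length (succs i)) (I (Suc i))"
      using I i by (simp add: I_def J_def env_def)
  qed (auto simp: I_def J_def env_def)
  then show ?thesis unfolding ends_def I_def J_def by blast
qed

lemma ends_ram_threshold_layer:
  assumes s: "env s" "reg s 22 = q" "reg s 13 = x"
  shows "ends ram_threshold_layer s (2 + 11 * n) (\<lambda>s'. env s' \<and> reg s' 13 = x + n \<and>
     reg s' 14 = reg s 14 \<and> reg s' 23 = reg s 23 \<and>
     written s' = written s @ concat (map (\<lambda>i. threshold_block q (x + i) i) [0..<n]))"
proof -
  define I where "I i s' \<longleftrightarrow> env s' \<and> reg s' 5 = i \<and> reg s' 13 = x + i \<and>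
     reg s' 14 = reg s 14 \<and> reg s' 22 = q \<and> reg s' 23 = reg s 23 \<and>
     written s' = written s @ concat (map (\<lambda>i. threshold_block q (x + i) i) [0..<i])" for i and s' :: ram
  have "ends ram_threshold_layer s (2 + 11 * n) (I n)"
    unfolding ram_threshold_layer_def
  proof (rule ends_run_Seq[where t' = "1 + 11 * n"])
    show "ends (WhileLess 5 1 (seqs [Write 0, Write 3, Write 22, Write 18,
     Sub 12 13 1, Write 12, Add 12 1 5, Write 12, Add 5 5 0, Add 13 13 0])) (run (Const 5 0) s) (1 + 11 * n) (I n)"
    proof (rule ends_WhileLess[where c = "\<lambda>_. 10"])
      show "I 0 (run (Const 5 0) s)" using s by (simp add: I_def env_def)
    next
      fix i s' assume "i < n" "I i s'"
      then show "reg s' 5 < reg s' 1 \<and> ends (seqs [Write 0, Write 3, Write 22, Write 18,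
         Sub 12 13 1, Write 12, Add 12 1 5, Write 12, Add 5 5 0, Add 13 13 0]) s' 10 (I (Suc i))"
        by (intro conjI ends_run) (simp_all add: I_def env_def threshold_block_def)
    qed (auto simp: I_def env_def)
  qed simp_all
  then show ?thesis unfolding ends_def I_def by blast
qed

lemma ends_ram_original:
  assumes s: "env s"
  shows "ends ram_original s (3 + (\<Sum>i<n. 40 + 4 * D + 5 * length (succs i))) (\<lambda>s'. env s' \<and>
     written s' = written s @ concat (map original_block [0..<n]))"
proof -
  define J where "J i y s' \<longleftrightarrow> env s' \<and> reg s' 5 = i \<and> reg s' 6 = ptr y \<and>
     written s' = written s @ concat (map original_block [0..<y])" for i y and s' :: ram
  define I where "I i = J i i" for i
  let ?head = "seqs [Load 7 6, Write 7, Add 12 6 0, Load 8 12, Write 8, Add 12 12 0, Load 9 12, Write 9,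
       Add 12 12 0, Load 10 12, Add 6 6 19]"
  let ?loop = "WhileLess 11 17 (seqs [Write 12, Add 12 12 20, Add 11 11 0])"
  let ?random = "seqs [seqs [Write 17, Add 12 21 5, Const 11 0], ?loop, Add 6 6 10]"
  let ?rest = "Seq (IfLess 0 7 ?random (Seq (Write 10) ram_copy)) (Add 5 5 0)"
  have body: "reg s1 5 < reg s1 1 \<and> ends (Seq ?head ?rest) s1 (39 + 4 * D + 5 * length (succs i)) (I (Suc i))"
    if i: "i < n" and I: "I i s1" for i s1
  proof -
    define s2 where "s2 = run ?head s1"
    have s2: "env s2" "reg s2 5 = i" "reg s2 6 = ptr i + 4" "reg s2 7 = cls i"
      "reg s2 10 = length (succs i)" "reg s2 0 = 1" "memory s2 = M"
      "written s2 = written s @ concat (map original_block [0..<i]) @ [cls i, ob i, pr i]"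
      using I i by (simp_all add: s2_def I_def J_def env_def block block_Suc)
    have J2: "ends (IfLess 0 7 ?random (Seq (Write 10) ram_copy)) s2
        (20 + 4 * D + 5 * length (succs i)) (J i (Suc i))"
    proof (rule ends_IfLess[where t = "15 + 4 * D + 5 * length (succs i)"])
      assume "reg s2 0 < reg s2 7"
      then have c1: "1 < cls i" using s2 by simp
      define K where "K j s' \<longleftrightarrow> env s' \<and> reg s' 5 = i \<and> reg s' 6 = ptr i + 4 \<and> reg s' 10 = length (succs i) \<and>
         reg s' 11 = j \<and> reg s' 12 = (3 + 2 * j) * n + i \<and>
         written s' = written s2 @ Suc D # map (\<lambda>j. (3 + 2 * j) * n + i) [0..<j]" for j and s' :: ram
      have loop: "ends ?loop s3 (1 + 4 * Suc D) (K (Suc D))" if "K 0 s3" for s3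
      proof (rule ends_WhileLess[where c = "\<lambda>_. 3"])
        show "K 0 s3" by fact
      next
        fix j s' assume "j < Suc D" "K j s'"
        then show "reg s' 11 < reg s' 17 \<and> ends (seqs [Write 12, Add 12 12 20, Add 11 11 0]) s' 3 (K (Suc j))"
          by (intro conjI ends_run) (simp_all add: K_def env_def algebra_simps)
      qed (auto simp: K_def env_def)
      have K0: "K 0 (run (seqs [Write 17, Add 12 21 5, Const 11 0]) s2)"
        using s2 by (simp add: K_def env_def)
      show "ends ?random s2 (15 + 4 * D + 5 * length (succs i)) (J i (Suc i))"
        unfolding seqs.simps(3)[of "seqs [Write 17, Add 12 21 5, Const 11 0]"]
      proof (rule ends_run_Seq[where t' = "6 + 4 * D"])
        show "ends (seqs [?loop, Add 6 6 10]) (run (seqs [Write 17, Add 12 21 5, Const 11 0]) s2)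
            (6 + 4 * D) (J i (Suc i))"
          unfolding seqs.simps(3)[of ?loop] seqs.simps(2)[of "Add 6 6 10"]
        proof (rule ends_Seq[OF loop[OF K0]])
          fix s' assume "K (Suc D) s'"
          then show "ends (Add 6 6 10) s' 1 (J i (Suc i))"
            using s2 c1 by (intro ends_run)
              (simp_all add: K_def J_def env_def ptr_Suc[OF i] original_block_def del: upt_Suc add: upt_Suc[of 0 i])
        qed simp
      qed simp_all
    next
      assume "\<not> reg s2 0 < reg s2 7"
      then have c1: "\<not> 1 < cls i" using s2 by simp
      define s3 where "s3 = run (Write 10) s2"
      have s3: "reg s3 0 = 1" "reg s3 10 = length (succs i)" "reg s3 6 = ptr i + 4" "memory s3 = M"
        "written s3 = written s2 @ [length (succs i)]" "reg s3 = reg s2"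
        using s2 by (simp_all add: s3_def)
      show "ends (Seq (Write 10) ram_copy) s2 (15 + 4 * D + 5 * length (succs i)) (J i (Suc i))"
      proof (rule ends_run_Seq[where t' = "2 + 5 * length (succs i)"])
        have "ends ram_copy s3 (2 + 5 * length (succs i)) (\<lambda>s'. memory s' = memory s3 \<and>
           written s' = written s3 @ map (memory s3) [reg s3 6..<reg s3 6 + reg s3 10] \<and>
           reg s' 6 = reg s3 6 + reg s3 10 \<and> (\<forall>r. r \<notin> {6, 11, 12} \<longrightarrow> reg s' r = reg s3 r))"
          using ends_ram_copy[OF s3(1)] unfolding s3(2) .
        moreover have "J i (Suc i) s'" if "memory s' = memory s3 \<and>
           written s' = written s3 @ map (memory s3) [reg s3 6..<reg s3 6 + reg s3 10] \<and>
           reg s' 6 = reg s3 6 + reg s3 10 \<and> (\<forall>r. r \<notin> {6, 11, 12} \<longrightarrow> reg s' r = reg s3 r)" for s'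
          using that s2 c1 unfolding J_def s3 env_def
          by (simp add: ptr_Suc[OF i] original_block_def block(5)[OF i])
        ultimately show "ends ram_copy (run (Write 10) s2) (2 + 5 * length (succs i)) (J i (Suc i))"
          unfolding ends_def s3_def[symmetric] by blast
      qed simp_all
    qed simp
    have "ends (Seq ?head ?rest) s1 (39 + 4 * D + 5 * length (succs i)) (I (Suc i))"
    proof (rule ends_run_Seq[where t' = "21 + 4 * D + 5 * length (succs i)"])
      show "ends ?rest (run ?head s1) (21 + 4 * D + 5 * length (succs i)) (I (Suc i))"
        unfolding s2_def[symmetric]
      proof (rule ends_Seq[OF J2])
        fix s4 assume "J i (Suc i) s4"
        then show "ends (Add 5 5 0) s4 1 (I (Suc i))"
          by (intro ends_run) (simp_all add: J_def I_def env_def)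
      qed simp
    qed simp_all
    then show ?thesis using I i by (simp add: I_def J_def env_def)
  qed
  have "ends ram_original s (3 + (\<Sum>i<n. 40 + 4 * D + 5 * length (succs i))) (I n)"
    unfolding ram_original_def seqs.simps(3)[of "Const 5 0"] seqs.simps(3)[of "Const 6 3"]
      seqs.simps(2)[of "WhileLess 5 1 P" for P] seqs.simps(3)[of ?head] seqs.simps(3)[of "IfLess a b P Q" for a b P Q]
      seqs.simps(2)[of "Add 5 5 0"]
  proof (rule ends_run_Seq[where t' = "2 + (\<Sum>i<n. 40 + 4 * D + 5 * length (succs i))"], simp,
      rule ends_run_Seq[where t' = "1 + (\<Sum>i<n. 40 + 4 * D + 5 * length (succs i))"], simp,
      rule ends_WhileLess[where c = "\<lambda>i. 39 + 4 * D + 5 * length (succs i)"], rule_tac [2] body)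
    show "I 0 (run (Const 6 3) (run (Const 5 0) s))"
      using s by (simp add: I_def J_def env_def ptr_0)
  qed (auto simp: I_def J_def env_def add.assoc)
  then show ?thesis unfolding ends_def I_def J_def by blast
qed

lemma ends_ram_scan:
  assumes s: "memory s = M" "reg s 0 = 1" "reg s 1 = n" "reg s 2 = k" "reg s 3 = l" "reg s 4 = 0"
    "reg s 5 = 0" "reg s 18 = 2" "reg s 19 = 4" "reg s 24 = 0" "written s = []"
  shows "ends ram_scan s (2 + 12 * n) (\<lambda>s. memory s = M \<and> reg s 0 = 1 \<and> reg s 1 = n \<and> reg s 2 = k \<and>
     reg s 3 = l \<and> reg s 4 = D \<and> reg s 18 = 2 \<and> reg s 19 = 4 \<and> reg s 24 = 0 \<and> written s = [])"
proof -
  define mx where "mx i = Max (insert 0 (pr ` {..<i}))" for i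
  define I where "I i s \<longleftrightarrow> memory s = M \<and> reg s 0 = 1 \<and> reg s 1 = n \<and> reg s 2 = k \<and>
     reg s 3 = l \<and> reg s 4 = mx i \<and> reg s 5 = i \<and> reg s 6 = ptr i \<and>
     reg s 18 = 2 \<and> reg s 19 = 4 \<and> reg s 24 = 0 \<and> written s = []" for i and s :: ram
  have mx_0: "mx 0 = 0" by (simp add: mx_def)
  have mx_Suc: "mx (Suc i) = max (pr i) (mx i)" for i
  proof -
    have "insert 0 (pr ` {..<Suc i}) = insert (pr i) (insert 0 (pr ` {..<i}))"
      by (simp add: lessThan_Suc insert_commute)
    then show ?thesis unfolding mx_def by (simp del: Max_insert add: Max_insert[of "insert 0 (pr ` {..<i})"])
  qed
  have "ends ram_scan s (2 + 12 * n) (I n)"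
    unfolding ram_scan_def
  proof (rule ends_run_Seq[where t' = "1 + 12 * n"], simp, rule ends_WhileLess[where c = "\<lambda>_. 11"])
    show "I 0 (run (Const 6 3) s)" using s by (simp add: I_def ptr_0 mx_0)
  next
    fix i s' assume i: "i < n" and I: "I i s'"
    let ?body = "seqs [Add 12 6 18, Load 9 12, Add 12 12 0, Load 10 12,
     IfLess 4 9 (Add 4 9 24) (Const 12 0), Add 6 6 19, Add 6 6 10, Add 5 5 0]"
    have I_run: "I (Suc i) (run ?body s')"
      using I i by (auto simp: I_def mx_Suc block block_Suc ptr_Suc max_def)
    have "ends ?body s' 11 (I (Suc i))"
      by (rule ends_run[where B = "I (Suc i)"]) (simp, simp, rule I_run)
    then show "reg s' 5 < reg s' 1 \<and> ends ?body s' 11 (I (Suc i))"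
      using I i by (simp add: I_def)
  qed (auto simp: I_def)
  then show ?thesis unfolding ends_def I_def max_priority_def mx_def by blast
qed

lemma ends_ram_gadgets:
  assumes s: "env s" "reg s 14 = 0" "reg s 23 = 1" "reg s 13 = 2 * n"
  shows "ends ram_gadgets s (1 + Suc D * (20 + 11 * n + (\<Sum>i<n. 30 + 5 * length (succs i))))
     (\<lambda>s'. written s' = written s @
       concat (map (\<lambda>i. concat (map (\<lambda>s. layer_block 1 (min (2 * i) D) ((2 + 2 * i) * n + s) s) [0..<n]) @
         concat (map (\<lambda>s. threshold_block (min (2 * i + 1) D) ((3 + 2 * i) * n + s) s) [0..<n])) [0..<Suc D]))"
proof -
  let ?W = "\<lambda>i. concat (map (\<lambda>s. layer_block 1 (min (2 * i) D) ((2 + 2 * i) * n + s) s) [0..<n]) @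
         concat (map (\<lambda>s. threshold_block (min (2 * i + 1) D) ((3 + 2 * i) * n + s) s) [0..<n])"
  let ?L = "\<Sum>i<n. 30 + 5 * length (succs i)"
  define I where "I i s' \<longleftrightarrow> env s' \<and> reg s' 14 = 2 * i \<and> reg s' 23 = 1 \<and> reg s' 13 = (2 + 2 * i) * n \<and>
     written s' = written s @ concat (map ?W [0..<i])" for i and s' :: ram
  have "ends ram_gadgets s (1 + Suc D * (20 + 11 * n + ?L)) (I (Suc D))"
    unfolding ram_gadgets_def
  proof (rule ends_WhileLess[where c = "\<lambda>_. 19 + 11 * n + ?L"])
    show "I 0 s" using s by (simp add: I_def)
  next
    fix i s1 assume i: "i < Suc D" and I: "I i s1"
    have "ends (Seq ram_priority (Seq ram_layer (Seq (Seq (Add 14 14 0) ram_priority)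
        (Seq ram_threshold_layer (Add 14 14 0))))) s1 (19 + 11 * n + ?L) (I (Suc i))"
    proof (rule ends_run_Seq[where t' = "16 + 11 * n + ?L"])
      let ?s2 = "run ram_priority s1"
      have s2: "env ?s2" "reg ?s2 23 = 1" "reg ?s2 22 = min (2 * i) D" "reg ?s2 13 = (2 + 2 * i) * n"
        "reg ?s2 14 = 2 * i" "written ?s2 = written s1"
        using I by (auto simp: ram_priority_def I_def env_def)
      show "ends (Seq ram_layer (Seq (Seq (Add 14 14 0) ram_priority)
        (Seq ram_threshold_layer (Add 14 14 0)))) ?s2 (16 + 11 * n + ?L) (I (Suc i))"
      proof (rule ends_Seq[OF ends_ram_layer[OF s2(1-4)], where t' = "12 + 11 * n"])
        fix s3 assume "env s3 \<and> reg s3 13 = (2 + 2 * i) * n + n \<and> reg s3 14 = reg ?s2 14 \<and> reg s3 23 = 1 \<and>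
          written s3 = written ?s2 @ concat (map (\<lambda>j. layer_block 1 (min (2 * i) D) ((2 + 2 * i) * n + j) j) [0..<n])"
        then have s3: "env s3" "reg s3 13 = (3 + 2 * i) * n" "reg s3 14 = 2 * i" "reg s3 23 = 1"
          "written s3 = written s1 @ concat (map (\<lambda>j. layer_block 1 (min (2 * i) D) ((2 + 2 * i) * n + j) j) [0..<n])"
          using s2 by (simp_all add: algebra_simps)
        show "ends (Seq (Seq (Add 14 14 0) ram_priority) (Seq ram_threshold_layer (Add 14 14 0))) s3
            (12 + 11 * n) (I (Suc i))"
        proof (rule ends_run_Seq[where t' = "4 + 11 * n"])
          let ?s4 = "run (Seq (Add 14 14 0) ram_priority) s3"
          have s4: "env ?s4" "reg ?s4 22 = min (2 * i + 1) D" "reg ?s4 13 = (3 + 2 * i) * n"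
            "reg ?s4 23 = 1" "reg ?s4 14 = 2 * i + 1" "written ?s4 = written s3"
            using s3 by (auto simp: ram_priority_def env_def)
          show "ends (Seq ram_threshold_layer (Add 14 14 0)) ?s4 (4 + 11 * n) (I (Suc i))"
          proof (rule ends_Seq[OF ends_ram_threshold_layer[OF s4(1-3)], where t' = 1])
            fix s5 assume s5: "env s5 \<and> reg s5 13 = (3 + 2 * i) * n + n \<and> reg s5 14 = reg ?s4 14 \<and>
              reg s5 23 = reg ?s4 23 \<and> written s5 = written ?s4 @
                concat (map (\<lambda>j. threshold_block (min (2 * i + 1) D) ((3 + 2 * i) * n + j) j) [0..<n])"
            have w: "written s5 = written s @ concat (map ?W [0..<Suc i])"
              using s5 s4(6) s3(5) I by (simp add: I_def)
            have "(3 + 2 * i) * n + n = (2 + 2 * Suc i) * n" by (simp add: algebra_simps)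
            then have "env s5" "reg s5 13 = (2 + 2 * Suc i) * n" "reg s5 14 = 2 * i + 1" "reg s5 23 = 1" "reg s5 0 = 1"
              using s5 s4 by (simp_all add: env_def)
            then show "ends (Add 14 14 0) s5 1 (I (Suc i))"
              using w by (intro ends_run) (simp_all add: I_def env_def)
          qed simp
        qed (simp_all add: ram_priority_def)
      qed simp
    qed (simp_all add: ram_priority_def)
    then show "reg s1 14 < reg s1 15 \<and> ends (seqs [ram_priority, ram_layer, Seq (Add 14 14 0) ram_priority,
     ram_threshold_layer, Add 14 14 0]) s1 (19 + 11 * n + ?L) (I (Suc i))"
      using I i by (simp add: I_def env_def)
  next
    show "1 + (\<Sum>i<Suc D. 1 + (19 + 11 * n + ?L)) \<le> 1 + Suc D * (20 + 11 * n + ?L)" by simp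
  qed (auto simp: I_def env_def)
  then show ?thesis unfolding ends_def I_def by blast
qed

lemma ends_ram_main:
  assumes s: "memory s = M" "reg s = (\<lambda>_. 0)" "written s = []"
  shows "ends ram_main s (60 + 12 * n + 3 * (2 * D + 2) + (\<Sum>i<n. 40 + 4 * D + 5 * length (succs i)) +
      (\<Sum>i<n. 30 + 5 * length (succs i)) +
      Suc D * (20 + 11 * n + (\<Sum>i<n. 30 + 5 * length (succs i)))) (\<lambda>s'. written s' = encoded_output)"
proof -
  let ?B = "\<lambda>s'. written s' = encoded_output"
  let ?O = "\<Sum>i<n. 40 + 4 * D + 5 * length (succs i)" and ?L = "\<Sum>i<n. 30 + 5 * length (succs i)"
  let ?G = "Suc D * (20 + 11 * n + ?L)"
  let ?init = "seqs [Const 0 1, Const 18 2, Const 19 4, Const 12 0, Load 1 12, Load 2 0, Load 3 18]"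
  let ?bounds = "seqs [Add 17 4 0, Add 15 17 17, Add 20 1 1, Add 21 20 1, Add 16 1 1, Const 14 0]"
  let ?count = "WhileLess 14 15 (Seq (Add 16 16 1) (Add 14 14 0))"
  let ?header = "seqs [Write 16, Write 2, Add 12 3 0, Write 12]"
  let ?pre = "seqs [Add 13 1 24, Const 23 2, Add 22 4 24]"
  let ?mid = "seqs [Const 14 0, Const 23 1]"
  let ?P1 = "Seq ?mid ram_gadgets"
  let ?P2 = "Seq ram_layer (Seq ?mid ram_gadgets)"
  \<comment> \<open>The program is treated from its end: each of the following claims covers
    everything from one phase to the final output, so that no description of the remaining output
    has to be carried along.\<close>
  have gadgets: "ends ?P1 s (3 + ?G) ?B"
    if s: "env s" "reg s 13 = n + n"
      "written s = [(2 * D + 4) * n, k, l + 1] @ concat (map original_block [0..<n]) @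
        concat (map (\<lambda>s. layer_block 2 D (n + s) s) [0..<n])" for s
  proof (rule ends_run_Seq[where t' = "1 + ?G"])
    let ?s = "run ?mid s"
    have s': "env ?s" "reg ?s 14 = 0" "reg ?s 23 = 1" "reg ?s 13 = 2 * n" "written ?s = written s"
      using s by (simp_all add: env_def)
    show "ends ram_gadgets ?s (1 + ?G) ?B"
      using ends_ram_gadgets[OF s'(1-4)] unfolding s'(5) s(3) encoded_output_def by simp
  qed simp_all
  have layer: "ends (Seq ?pre ?P2) s (9 + ?L + ?G) ?B"
    if s: "env s" "written s = [(2 * D + 4) * n, k, l + 1] @ concat (map original_block [0..<n])" for s
  proof (rule ends_run_Seq[where t' = "6 + ?L + ?G"])
    let ?s = "run ?pre s"
    have s': "env ?s" "reg ?s 23 = 2" "reg ?s 22 = D" "reg ?s 13 = n" "written ?s = written s"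
      using s by (simp_all add: env_def)
    show "ends ?P2 ?s (6 + ?L + ?G) ?B"
    proof (rule ends_Seq[OF ends_ram_layer[OF s'(1-4)], where t' = "3 + ?G"])
      fix s2 assume "env s2 \<and> reg s2 13 = n + n \<and> reg s2 14 = reg ?s 14 \<and> reg s2 23 = 2 \<and>
        written s2 = written ?s @ concat (map (\<lambda>i. layer_block 2 D (n + i) i) [0..<n])"
      then show "ends ?P1 s2 (3 + ?G) ?B"
        by (intro gadgets) (use s s'(5) in simp_all)
    qed simp
  qed simp_all
  have original: "ends (Seq ?header (Seq ram_original (Seq ?pre ?P2))) s
      (16 + ?O + ?L + ?G) ?B"
    if s: "env s" "reg s 16 = (2 * D + 4) * n" "written s = []" for s
  proof (rule ends_run_Seq[where t' = "12 + ?O + ?L + ?G"])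
    let ?s = "run ?header s"
    have s': "env ?s" "written ?s = [(2 * D + 4) * n, k, l + 1]"
      using s by (simp_all add: env_def)
    show "ends (Seq ram_original (Seq ?pre ?P2)) ?s
        (12 + ?O + ?L + ?G) ?B"
    proof (rule ends_Seq[OF ends_ram_original[OF s'(1)], where t' = "9 + ?L + ?G"])
      fix s2 assume "env s2 \<and> written s2 = written ?s @ concat (map original_block [0..<n])"
      then have "env s2" "written s2 = [(2 * D + 4) * n, k, l + 1] @ concat (map original_block [0..<n])"
        unfolding s'(2) by blast+
      then show "ends (Seq ?pre ?P2) s2 (9 + ?L + ?G)
          ?B" by (rule layer)
    qed simp
  qed simp_all
  define C where "C i s \<longleftrightarrow> env s \<and> reg s 14 = i \<and> reg s 16 = (2 + i) * n \<and> written s = []" for i and s :: ram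
  have count: "ends ?count s (1 + 3 * (2 * D + 2)) (C (2 * D + 2))" if "C 0 s" for s
  proof (rule ends_WhileLess[where c = "\<lambda>_. 2"])
    show "C 0 s" by fact
  next
    fix i s assume "i < 2 * D + 2" "C i s"
    then show "reg s 14 < reg s 15 \<and> ends (Seq (Add 16 16 1) (Add 14 14 0)) s 2 (C (Suc i))"
      by (intro conjI ends_run) (simp_all add: C_def env_def)
  qed (auto simp: C_def env_def)
  have counted: "ends (Seq ?bounds (Seq ?count (Seq ?header (Seq ram_original (Seq ?pre ?P2))))) s (23 + 3 * (2 * D + 2) + ?O + ?L + ?G) ?B"
    if s: "memory s = M \<and> reg s 0 = 1 \<and> reg s 1 = n \<and> reg s 2 = k \<and>
     reg s 3 = l \<and> reg s 4 = D \<and> reg s 18 = 2 \<and> reg s 19 = 4 \<and> reg s 24 = 0 \<and> written s = []" for s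
  proof (rule ends_run_Seq[where t' = "17 + 3 * (2 * D + 2) + ?O + ?L + ?G"])
    have "C 0 (run ?bounds s)" using s by (simp add: C_def env_def)
    from count[OF this]
    show "ends (Seq ?count (Seq ?header (Seq ram_original (Seq ?pre ?P2)))) (run ?bounds s) (17 + 3 * (2 * D + 2) + ?O + ?L + ?G) ?B"
    proof (rule ends_Seq[where t' = "16 + ?O + ?L + ?G"])
      fix s' assume "C (2 * D + 2) s'"
      then have "env s'" "reg s' 16 = (2 * D + 4) * n" "written s' = []" by (simp_all add: C_def algebra_simps)
      then show "ends (Seq ?header (Seq ram_original (Seq ?pre ?P2))) s'
        (16 + ?O + ?L + ?G) ?B" by (rule original)
    qed simp
  qed simp_all
  have "ends (Seq ?init (Seq ram_scan (Seq ?bounds (Seq ?count (Seq ?header (Seq ram_original (Seq ?pre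
      ?P2))))))) s
      (60 + 12 * n + 3 * (2 * D + 2) + ?O + ?L + ?G) ?B"
  proof (rule ends_run_Seq[where t' = "25 + 12 * n + 3 * (2 * D + 2) + ?O + ?L + ?G"])
    show "ends (Seq ram_scan (Seq ?bounds (Seq ?count (Seq ?header (Seq ram_original (Seq ?pre
      ?P2)))))) (run ?init s)
      (25 + 12 * n + 3 * (2 * D + 2) + ?O + ?L + ?G) ?B"
    proof (rule ends_Seq[OF ends_ram_scan counted])
      show "2 + 12 * n + (23 + 3 * (2 * D + 2) + ?O + ?L + ?G) \<le> 25 + 12 * n + 3 * (2 * D + 2) + ?O + ?L + ?G"
        by simp
    qed (use s params in simp_all)
  qed simp_all
  moreover have "ram_main = Seq ?init (Seq ram_scan (Seq ?bounds (Seq ?count (Seq ?header (Seq ram_original (Seq ?pre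
      ?P2))))))"
    by (simp add: ram_main_def)
  ultimately show ?thesis by simp
qed

end

section \<open>Correctness of the construction\<close>

definition succ_list ::
    "(nat, nat, nat, 'z) game_scheme \<Rightarrow> nat \<Rightarrow> (nat \<Rightarrow> nat list) \<Rightarrow> bool" where
  "succ_list G k succs \<longleftrightarrow> (\<forall>s\<in>S1 G. succs s = map (act G s) [0..<k]) \<and>
     (\<forall>s\<in>S2 G \<union> SX G. distinct (succs s) \<and> set (succs s) = {t. (s, t) \<in> E G})"

definition state_block ::
    "(nat, nat, nat, 'z) game_scheme \<Rightarrow> (nat \<Rightarrow> nat) \<Rightarrow> (nat \<Rightarrow> nat list) \<Rightarrow> nat \<Rightarrow> nat list" where
  "state_block G p succs s = [state_class G s, obs G s, p s, length (succs s)] @ succs s"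

lemma encodes_iff:
  "encodes xs G p \<longleftrightarrow> (\<exists>n k l succs. states G = {..<n} \<and> A1 G = {..<k} \<and> Obs G = {..<l} \<and>
     succ_list G k succs \<and> xs = [n, k, l] @ concat (map (state_block G p succs) [0..<n]))"
  unfolding encodes_def succ_list_def state_block_def by blast

section \<open>Lists and sums over states, regrouped by layers\<close>

lemma concat_map_grid:
  "concat (map f [0..<j * n]) = concat (map (\<lambda>i. concat (map (\<lambda>s. f (i * n + s)) [0..<n])) [0..<j])"
proof (induction j)
  case (Suc j)
  have "[0..<Suc j * n] = [0..<j * n] @ [j * n..<j * n + n]"
    using upt_add_eq_append[of 0 "j * n" n] by (simp add: add.commute)
  also have "[j * n..<j * n + n] = map (\<lambda>s. j * n + s) [0..<n]"
    using map_add_upt[of "j * n" n] by (simp add: add.commute)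
  finally have "concat (map f [0..<Suc j * n]) =
      concat (map f [0..<j * n]) @ concat (map f (map (\<lambda>s. j * n + s) [0..<n]))"
    by (simp del: mult_Suc)
  also have "\<dots> = concat (map f [0..<j * n]) @ concat (map (\<lambda>s. f (j * n + s)) [0..<n])"
    by (simp add: comp_def)
  finally show ?case unfolding Suc by (simp del: mult_Suc)
qed simp

lemma upt_double: "concat (map (\<lambda>i. f (2 * i) @ f (2 * i + 1)) [0..<j]) = concat (map f [0..<2 * j])"
  by (induction j) simp_all

lemma upt_add_two: "[0..<2 + m] = [0, 1] @ map (\<lambda>j. 2 + j) [0..<m]"
  by (induction m) (simp_all add: numeral_2_eq_2)

lemma sum_lessThan_grid:
  fixes f :: "nat \<Rightarrow> nat"
  shows "(\<Sum>x<j * n. f x) = (\<Sum>i<j. \<Sum>s<n. f (i * n + s))"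
proof (induction j)
  case (Suc j)
  have "{..<Suc j * n} = {..<j * n} \<union> (\<lambda>s. j * n + s) ` {..<n}"
  proof (intro equalityI subsetI)
    fix x assume x: "x \<in> {..<Suc j * n}"
    show "x \<in> {..<j * n} \<union> (\<lambda>s. j * n + s) ` {..<n}"
    proof (cases "x < j * n")
      case False
      then have "x = j * n + (x - j * n)" "x - j * n < n" using x by auto
      then show ?thesis by blast
    qed simp
  qed auto
  moreover have "{..<j * n} \<inter> (\<lambda>s. j * n + s) ` {..<n} = {}" by auto
  ultimately have "(\<Sum>x<Suc j * n. f x) = (\<Sum>x<j * n. f x) + sum f ((\<lambda>s. j * n + s) ` {..<n})"
    by (simp add: sum.union_disjoint)
  also have "sum f ((\<lambda>s. j * n + s) ` {..<n}) = (\<Sum>s<n. f (j * n + s))"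
    by (subst sum.reindex) (auto simp: inj_on_def)
  finally show ?case unfolding Suc by simp
qed simp

section \<open>The encoded game as input of the machine\<close>

locale encoded_game =
  fixes G :: "(nat, nat, nat) stochastic_game" and p :: "nat \<Rightarrow> nat" and n k l :: nat
    and succs :: "nat \<Rightarrow> nat list" and xs :: "nat list"
  assumes G: "stochastic_game G" and states_G: "states G = {..<n}" and A1_G: "A1 G = {..<k}"
    and Obs_G: "Obs G = {..<l}" and succ_list: "succ_list G k succs"
    and xs: "xs = [n, k, l] @ concat (map (state_block G p succs) [0..<n])"
begin

definition ptr :: "nat \<Rightarrow> nat" where
  "ptr s = 3 + (\<Sum>i<s. 4 + length (succs i))"

definition input_memory :: "nat \<Rightarrow> nat" where
  "input_memory i = (if i < length xs then xs ! i else 0)"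

lemma length_concat_blocks:
  "length (concat (map (state_block G p succs) [0..<s])) = (\<Sum>i<s. 4 + length (succs i))"
  by (induction s) (simp_all add: state_block_def)

lemma input_memory_block:
  assumes "s < n" "j < 4 + length (succs s)"
  shows "input_memory (ptr s + j) = state_block G p succs s ! j"
proof -
  have "[0..<n] = [0..<s] @ s # [Suc s..<n]"
    using assms(1) by (metis less_imp_le_nat upt_add_eq_append upt_conv_Cons zero_le le_add_diff_inverse)
  then have xs': "xs = ([n, k, l] @ concat (map (state_block G p succs) [0..<s])) @
      state_block G p succs s @ concat (map (state_block G p succs) [Suc s..<n])"
    unfolding xs by simp
  have len: "length ([n, k, l] @ concat (map (state_block G p succs) [0..<s])) = ptr s"
    using length_concat_blocks[of s] by (simp add: ptr_def)
  have lb: "length (state_block G p succs s) = 4 + length (succs s)" by (simp add: state_block_def)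
  have "ptr s + j < length xs"
    unfolding xs' length_append[of "[n, k, l] @ concat (map (state_block G p succs) [0..<s])"] len
    using assms(2) lb by simp
  moreover have "xs ! (ptr s + j) = state_block G p succs s ! j"
    unfolding xs' using assms(2) lb
    by (metis len nth_append nth_append_length_plus)
  ultimately show ?thesis by (simp add: input_memory_def)
qed

lemma encoding: "encoding input_memory n k l (state_class G) (obs G) p succs ptr"
proof
  show "input_memory 0 = n" "input_memory 1 = k" "input_memory 2 = l"
    unfolding input_memory_def by (simp_all add: xs nth_append)
  show "ptr 0 = 3" by (simp add: ptr_def)
  show "ptr (Suc s) = ptr s + 4 + length (succs s)" for s by (simp add: ptr_def)
  fix s assume s: "s < n"
  show "input_memory (ptr s) = state_class G s" "input_memory (ptr s + 1) = obs G s"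
    "input_memory (ptr s + 2) = p s" "input_memory (ptr s + 3) = length (succs s)"
    using input_memory_block[OF s, of 0] input_memory_block[OF s, of 1] input_memory_block[OF s, of 2]
      input_memory_block[OF s, of 3] by (simp_all add: state_block_def)
  show "map input_memory [ptr s + 4..<ptr s + 4 + length (succs s)] = succs s"
  proof (rule nth_equalityI)
    fix i assume "i < length (map input_memory [ptr s + 4..<ptr s + 4 + length (succs s)])"
    then have i: "i < length (succs s)" by simp
    have "input_memory (ptr s + (4 + i)) = succs s ! i"
      using input_memory_block[OF s, of "4 + i"] i by (simp add: state_block_def)
    then show "map input_memory [ptr s + 4..<ptr s + 4 + length (succs s)] ! i = succs s ! i"
      using i by (simp add: add.assoc)
  qed simp
qed

sublocale E: encoding input_memory n k l "state_class G" "obs G" p succs ptr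
  by (rule encoding)

abbreviation (input) "D \<equiv> E.max_priority"

lemma priority_le: "s < n \<Longrightarrow> p s \<le> D"
  unfolding E.max_priority_def by (intro Max_ge) auto

sublocale layered G p n l D succs
  by unfold_locales (use G states_G Obs_G succ_list priority_le in \<open>auto simp: succ_list_def\<close>)

lemma max_priority_le:
  assumes "\<forall>s\<in>states G. p s \<in> {0..d}"
  shows "D \<le> d"
  unfolding E.max_priority_def using assms states_G by (intro Max.boundedI) auto

lemma class_random: "s < n \<Longrightarrow> 1 < state_class G s \<longleftrightarrow> s \<in> SX G"
  using disjoint in_states[of s] by (auto simp: state_class_def)

lemma class_H:
  assumes "x < (2 * D + 4) * n"
  shows "state_class H x = (if x < n then state_class G x else if x div n = 1 then 2 else 1)"
proof (cases "x < n")
  case True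
  then show ?thesis by (simp add: state_class_def layered_game_def)
next
  case False
  then have "x \<notin> S1 G" "x \<notin> S2 G" "x \<notin> SX G" using in_states[of x] by blast+
  then show ?thesis using False assms by (simp add: state_class_def layered_game_def)
qed

text \<open>The numbering by \<open>j * n + s\<close> makes the order of states the order in which
  the program works through the layers. It remains to split off layers 0 and 1 and to pair the
  others by threshold.\<close>

lemma encodes_output: "encodes E.encoded_output H q"
proof -
  let ?b = "state_block H q (layer_successors G n D succs)"
  have dist: "distinct (succs s)" "set (succs s) = {t. (s, t) \<in> E G}" if "s \<in> S2 G \<union> SX G" for s
    using succ_list that by (auto simp: succ_list_def)
  have sl: "succ_list H k (layer_successors G n D succs)"
    unfolding succ_list_def
  proof (intro conjI ballI)
    fix s assume "s \<in> S1 H"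
    then have "s \<in> S1 G" "s < n" "s \<notin> SX G" using in_states[of s] disjoint by (auto simp: S1_H)
    then show "layer_successors G n D succs s = map (act H s) [0..<k]"
      using succ_list by (simp add: layer_successors_def succ_list_def act_H)
  next
    fix x assume x: "x \<in> S2 H \<union> SX H"
    then have xs: "x \<in> states H" "x \<notin> S1 H"
      using game_graph_H by (auto simp: states_def game_graph_def)
    then have x': "x < (2 * D + 4) * n" "x \<notin> S1 G" by (simp_all add: states_H S1_H)
    then show "set (layer_successors G n D succs x) = {t. (x, t) \<in> E H}"
      by (simp add: layered_game_def)
    define j where "j = x div n"
    define s where "s = x mod n"
    have s: "s < n" and xjs: "x = j * n + s" using n_pos by (simp_all add: s_def j_def)
    show "distinct (layer_successors G n D succs x)"
    proof (cases "x < n")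
      case True
      then have "x \<in> S2 G \<union> SX G" using x'(2) in_states[of x] by blast
      moreover have "inj_on (\<lambda>i. (3 + 2 * i) * n + x) {0..<Suc D}" using n_pos by (auto simp: inj_on_def)
      ultimately show ?thesis
        using True dist(1) by (auto simp: layer_successors_def distinct_map simp del: upt_Suc)
    next
      case False
      then have j1: "1 \<le> j" using xjs s by (cases j) auto
      have "(j - 1) * n + s \<noteq> n + s" if "odd j" "j \<noteq> 1"
      proof -
        have "2 \<le> j - 1" using that j1 by presburger
        then have "2 * n \<le> (j - 1) * n" by (rule mult_le_mono1)
        then show ?thesis using n_pos by linarith
      qed
      then show ?thesis unfolding xjs successors_gadget[OF s j1] using dist(1)[of s] by auto
    qed
  qed
  have b0: "?b (0 * n + s) = E.original_block s" if s: "s < n" for s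
  proof -
    have "s < (2 * D + 4) * n" using layer_less[OF s, of 0] by simp
    then show ?thesis
      using s class_random[OF s] class_H[of s] obs_H(1)[OF s] priority_layers(1)[OF s]
      by (simp add: state_block_def E.original_block_def layer_successors_def del: upt_Suc)
  qed
  have bj: "?b (j * n + s) = [if j = 1 then 2 else 1, l, q (j * n + s)] @
      length (layer_successors G n D succs (j * n + s)) # layer_successors G n D succs (j * n + s)"
    if s: "s < n" and j: "1 \<le> j" "j < 2 * D + 4" for s j
  proof -
    have "1 * n \<le> j * n" using j by (intro mult_le_mono1) simp
    then have ge: "\<not> j * n + s < n" by linarith
    show ?thesis
      using class_H[OF layer_less[OF s j(2)]] ge obs_H(2)[OF ge] layer_div(1)[OF s, of j]
      by (simp add: state_block_def)
  qed
  have b1: "?b (1 * n + s) = E.layer_block 2 D (n + s) s" if s: "s < n" for s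
    using bj[OF s, of 1] class_random[OF s] priority_layers(4)[OF s] successors_gadget[OF s, of 1]
    by (simp add: E.layer_block_def)
  have ba: "?b ((2 + 2 * i) * n + s) = E.layer_block 1 (min (2 * i) D) ((2 + 2 * i) * n + s) s"
    if s: "s < n" and i: "i < Suc D" for s i
  proof -
    have "layer_successors G n D succs ((2 + 2 * i) * n + s) =
        (if s \<in> SX G then succs s else [(2 + 2 * i) * n + s])"
      using successors_gadget[OF s, of "2 + 2 * i"] by simp
    then show ?thesis
      using bj[OF s, of "2 + 2 * i"] i class_random[OF s] priority_layers(3)[OF s, of i]
      by (simp add: E.layer_block_def)
  qed
  have bh: "?b ((3 + 2 * i) * n + s) = E.threshold_block (min (2 * i + 1) D) ((3 + 2 * i) * n + s) s"
    if s: "s < n" and i: "i < Suc D" for s i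
  proof -
    have "layer_successors G n D succs ((3 + 2 * i) * n + s) = [(2 + 2 * i) * n + s, n + s]"
      using successors_gadget[OF s, of "3 + 2 * i"] by simp
    moreover have "(3 + 2 * i) * n + s - n = (2 + 2 * i) * n + s" by (simp add: algebra_simps)
    ultimately show ?thesis
      using bj[OF s, of "3 + 2 * i"] i priority_layers(2)[OF s, of i]
      unfolding E.threshold_block_def by simp
  qed
  let ?layer = "\<lambda>j. concat (map (\<lambda>s. ?b (j * n + s)) [0..<n])"
  have "concat (map ?b [0..<(2 * D + 4) * n]) = concat (map ?layer [0..<2 * D + 4])"
    by (rule concat_map_grid)
  also have "[0..<2 * D + 4] = [0, 1] @ map (\<lambda>j. 2 + j) [0..<2 * Suc D]"
  proof -
    have e: "2 * D + 4 = 2 + 2 * Suc D" by simp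
    show ?thesis unfolding e by (rule upt_add_two)
  qed
  also have "concat (map ?layer ([0, 1] @ map (\<lambda>j. 2 + j) [0..<2 * Suc D])) =
      ?layer 0 @ ?layer 1 @ concat (map (\<lambda>j. ?layer (2 + j)) [0..<2 * Suc D])"
    by (simp only: map_append concat_append list.map concat.simps append_Nil2 append_assoc map_map
        comp_def append.simps)
  also have "concat (map (\<lambda>j. ?layer (2 + j)) [0..<2 * Suc D]) =
      concat (map (\<lambda>i. ?layer (2 + 2 * i) @ ?layer (2 + (2 * i + 1))) [0..<Suc D])"
    by (rule upt_double[symmetric])
  also have "?layer 0 = concat (map E.original_block [0..<n])"
    by (intro arg_cong[where f = concat] map_cong refl b0) simp
  also have "?layer 1 = concat (map (\<lambda>s. E.layer_block 2 D (n + s) s) [0..<n])"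
    by (intro arg_cong[where f = concat] map_cong refl b1) simp
  also have "concat (map (\<lambda>i. ?layer (2 + 2 * i) @ ?layer (2 + (2 * i + 1))) [0..<Suc D]) =
      concat (map (\<lambda>i. concat (map (\<lambda>s. E.layer_block 1 (min (2 * i) D) ((2 + 2 * i) * n + s) s) [0..<n]) @
       concat (map (\<lambda>s. E.threshold_block (min (2 * i + 1) D) ((3 + 2 * i) * n + s) s) [0..<n])) [0..<Suc D])"
  proof (intro arg_cong[where f = concat] map_cong refl)
    fix i assume "i \<in> set [0..<Suc D]"
    then have i: "i < Suc D" by (simp del: upt_Suc)
    have "2 + (2 * i + 1) = 3 + 2 * i" by simp
    then have "?layer (2 + (2 * i + 1)) = ?layer (3 + 2 * i)" by (simp only:)
    also have "\<dots> = concat (map (\<lambda>s. E.threshold_block (min (2 * i + 1) D) ((3 + 2 * i) * n + s) s) [0..<n])"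
      by (intro arg_cong[where f = concat] map_cong refl bh i) simp
    finally have 2: "?layer (2 + (2 * i + 1)) = \<dots>" .
    have 1: "?layer (2 + 2 * i) = concat (map (\<lambda>s. E.layer_block 1 (min (2 * i) D) ((2 + 2 * i) * n + s) s) [0..<n])"
      by (intro arg_cong[where f = concat] map_cong refl ba i) simp
    show "?layer (2 + 2 * i) @ ?layer (2 + (2 * i + 1)) =
       concat (map (\<lambda>s. E.layer_block 1 (min (2 * i) D) ((2 + 2 * i) * n + s) s) [0..<n]) @
       concat (map (\<lambda>s. E.threshold_block (min (2 * i + 1) D) ((3 + 2 * i) * n + s) s) [0..<n])"
      unfolding 1 2 ..
  qed
  finally have "E.encoded_output = [(2 * D + 4) * n, k, l + 1] @ concat (map ?b [0..<(2 * D + 4) * n])"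
    unfolding E.encoded_output_def by simp
  moreover have "A1 H = {..<k}" "Obs H = {..<l + 1}" by (simp_all add: layered_game_def A1_G)
  ultimately show ?thesis unfolding encodes_iff using sl states_H by blast
qed

section \<open>Size and running time\<close>

lemma sum_length_succs: "(\<Sum>s<n. length (succs s)) = num_transitions G"
proof -
  have fin: "finite (S1 G)" "finite (S2 G \<union> SX G)"
    using in_states by (auto intro: finite_subset[of _ "{..<n}"])
  have "E G = (SIGMA s:S2 G \<union> SX G. set (succs s))"
    using graph_G succ_list by (auto simp: game_graph_def succ_list_def)
  then have "card (E G) = (\<Sum>s\<in>S2 G \<union> SX G. card (set (succs s)))"
    using fin by simp
  also have "\<dots> = (\<Sum>s\<in>S2 G \<union> SX G. length (succs s))"
    by (intro sum.cong refl distinct_card) (use succ_list in \<open>auto simp: succ_list_def\<close>)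
  finally have 1: "card (E G) = (\<Sum>s\<in>S2 G \<union> SX G. length (succs s))" .
  have 2: "(\<Sum>s\<in>S1 G. length (succs s)) = card (S1 G) * card (A1 G)"
    using succ_list A1_G by (simp add: succ_list_def)
  have "{..<n} = S1 G \<union> (S2 G \<union> SX G)" using in_states by auto
  then have "(\<Sum>s<n. length (succs s)) = (\<Sum>s\<in>S1 G. length (succs s)) + (\<Sum>s\<in>S2 G \<union> SX G. length (succs s))"
    using fin disjoint by (simp add: sum.union_disjoint Int_Un_distrib)
  then show ?thesis unfolding num_transitions_def 1 2 .
qed

text \<open>Every state has a successor. This absorbs the gadget edges, whose number is proportional
  to the number of states, into a bound by transitions alone.\<close>

lemma states_le_transitions: "n \<le> num_transitions G"
proof -
  have "1 \<le> length (succs s)" if "s < n" for s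
  proof -
    have "succs s \<noteq> []"
    proof (cases "s \<in> S1 G")
      case True
      have "k \<noteq> 0" using graph_G A1_G by (auto simp: game_graph_def)
      then show ?thesis using True succ_list by (simp add: succ_list_def)
    next
      case False
      then have "s \<in> S2 G \<union> SX G" using that in_states by blast
      then have "{t. (s, t) \<in> E G} \<noteq> {}" using graph_G unfolding game_graph_def by blast
      moreover have "set (succs s) = {t. (s, t) \<in> E G}" by (rule set_succs) fact
      ultimately show ?thesis by force
    qed
    then show ?thesis by (cases "succs s") simp_all
  qed
  then have "(\<Sum>s<n. 1) \<le> (\<Sum>s<n. length (succs s))" by (intro sum_mono) simp
  then show ?thesis by (simp add: sum_length_succs)
qed

text \<open>In each layer a copy has at most two successors more than the original, and in layer 0
  at most \<open>D\<close> further ones for the thresholds. Summing up gives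
  \<open>7 * D + 13\<close> times the number of transitions, which is at most
  \<open>20 * Suc D\<close> times it.\<close>

lemma num_transitions_H: "num_transitions H \<le> 20 * (num_transitions G * Suc D)"
proof -
  let ?m = "num_transitions G" and ?s = "layer_successors G n D succs"
  have "E H \<subseteq> (SIGMA x:{..<(2 * D + 4) * n} - S1 G. set (?s x))"
    by (auto simp: layered_game_def)
  then have "card (E H) \<le> card (SIGMA x:{..<(2 * D + 4) * n} - S1 G. set (?s x))"
    by (intro card_mono) auto
  also have "\<dots> = (\<Sum>x\<in>{..<(2 * D + 4) * n} - S1 G. card (set (?s x)))" by simp
  also have "\<dots> \<le> (\<Sum>x<(2 * D + 4) * n. length (?s x))"
    by (intro order_trans[OF sum_mono sum_mono2]) (auto intro: card_length)
  also have "\<dots> = (\<Sum>j<2 * D + 4. \<Sum>s<n. length (?s (j * n + s)))" by (rule sum_lessThan_grid)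
  also have "\<dots> \<le> (\<Sum>j<2 * D + 4. ?m + (2 + (if j = 0 then D else 0)) * n)"
  proof (rule sum_mono)
    fix j
    have "length (?s (j * n + s)) \<le> length (succs s) + (2 + (if j = 0 then D else 0))" if s: "s < n" for s
    proof (cases "j = 0")
      case True
      then show ?thesis using s by (simp add: layer_successors_def)
    next
      case False
      then show ?thesis using successors_gadget[OF s, of j] by simp
    qed
    then have "(\<Sum>s<n. length (?s (j * n + s))) \<le> (\<Sum>s<n. length (succs s) + (2 + (if j = 0 then D else 0)))"
      by (intro sum_mono) simp
    also have "(\<Sum>s<n. length (succs s) + c) = ?m + c * n" for c
      by (simp add: sum.distrib sum_length_succs)
    finally show "(\<Sum>s<n. length (?s (j * n + s))) \<le> ?m + (2 + (if j = 0 then D else 0)) * n" .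
  qed
  also have "\<dots> = (2 * D + 4) * ?m + (2 * D + 4) * (2 * n) + D * n"
  proof -
    have "(\<Sum>j<2 * D + 4. ?m + (2 + (if j = 0 then D else 0)) * n) =
        (\<Sum>j<2 * D + 4. (?m + 2 * n) + (if j = 0 then D * n else 0))"
      by (intro sum.cong refl) (simp add: algebra_simps)
    also have "\<dots> = (2 * D + 4) * (?m + 2 * n) + D * n"
      by (simp add: sum.distrib del: sum.lessThan_Suc)
    finally show ?thesis by (simp add: algebra_simps)
  qed
  also have "\<dots> \<le> (2 * D + 4) * ?m + (2 * D + 4) * (2 * ?m) + D * ?m"
    using states_le_transitions by (intro add_mono mult_le_mono order_refl)
  finally have "card (E H) \<le> (2 * D + 4) * ?m + (2 * D + 4) * (2 * ?m) + D * ?m" .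
  moreover have "card (S1 H) * card (A1 H) \<le> ?m" by (simp add: layered_game_def num_transitions_def)
  ultimately have "num_transitions H \<le> ?m + ((2 * D + 4) * ?m + (2 * D + 4) * (2 * ?m) + D * ?m)"
    unfolding num_transitions_def[of H] by linarith
  also have "\<dots> \<le> 20 * (?m * Suc D)" by (simp add: algebra_simps)
  finally show ?thesis .
qed

lemma card_priorities: "card (q ` states H) \<le> D + 1"
proof -
  have "q x \<le> D" if "x < (2 * D + 4) * n" for x
  proof -
    have "x mod n < n" using n_pos by simp
    then show ?thesis using p_le[of "x mod n"] by (simp add: layered_priority_def gadget_priority_def)
  qed
  then have "q ` states H \<subseteq> {..D}" unfolding states_H by auto
  then have "card (q ` states H) \<le> card {..D}" by (intro card_mono) auto
  then show ?thesis by simp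
qed

text \<open>The cost expands to a polynomial in \<open>n\<close>, \<open>D\<close> and the number of
  transitions. Its terms without \<open>n\<close> are absorbed by \<open>1 \<le> n\<close>; the
  constant 400 is generous.\<close>

lemma computes_output:
  "\<exists>t\<le>400 * ((n + num_transitions G) * Suc D). computes_in ram_main xs E.encoded_output t"
proof -
  let ?s = "\<lparr>reg = (\<lambda>_. 0), memory = (\<lambda>i. if i < length xs then xs ! i else 0), written = []\<rparr>"
  let ?m = "num_transitions G"
  have "memory ?s = input_memory" by (simp add: input_memory_def[abs_def])
  then have "ends ram_main ?s (60 + 12 * n + 3 * (2 * D + 2) + (\<Sum>i<n. 40 + 4 * D + 5 * length (succs i)) +
      (\<Sum>i<n. 30 + 5 * length (succs i)) +
      Suc D * (20 + 11 * n + (\<Sum>i<n. 30 + 5 * length (succs i)))) (\<lambda>s'. written s' = E.encoded_output)"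
    by (intro E.ends_ram_main) simp_all
  then obtain t s' where t: "exec ram_main ?s t s'" "written s' = E.encoded_output"
    "t \<le> 60 + 12 * n + 3 * (2 * D + 2) + (\<Sum>i<n. 40 + 4 * D + 5 * length (succs i)) +
      (\<Sum>i<n. 30 + 5 * length (succs i)) + Suc D * (20 + 11 * n + (\<Sum>i<n. 30 + 5 * length (succs i)))"
    by (auto simp: ends_def)
  have sums: "(\<Sum>i<n. 40 + 4 * D + 5 * length (succs i)) = (40 + 4 * D) * n + 5 * ?m"
    "(\<Sum>i<n. 30 + 5 * length (succs i)) = 30 * n + 5 * ?m"
    by (simp_all add: sum.distrib sum_distrib_left[symmetric] sum_length_succs)
  have "1 \<le> n" using n_pos by simp
  then have D: "D \<le> D * n" by simp
  have "60 + 12 * n + 3 * (2 * D + 2) + ((40 + 4 * D) * n + 5 * ?m) + (30 * n + 5 * ?m) +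
      Suc D * (20 + 11 * n + (30 * n + 5 * ?m)) =
      86 + 123 * n + 26 * D + 45 * (D * n) + 15 * ?m + 5 * (D * ?m)"
    by (simp add: algebra_simps)
  also have "\<dots> \<le> 400 * n + 400 * ?m + 400 * (D * n) + 400 * (D * ?m)"
    using D \<open>1 \<le> n\<close> by linarith
  also have "\<dots> = 400 * ((n + ?m) * Suc D)" by (simp add: algebra_simps)
  finally have "t \<le> 400 * ((n + ?m) * Suc D)" using t(3) unfolding sums by linarith
  moreover have "computes_in ram_main xs E.encoded_output t"
    unfolding computes_in_def using t(1,2) by blast
  ultimately show ?thesis by blast
qed

lemma winning_iff:
  assumes s: "s \<in> states G"
  shows "(\<exists>T. transducer G T \<and> almost_sure_winning G p (transducer_strategy G T) s) \<longleftrightarrow>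
    (\<exists>T. transducer H T \<and> player3_sure_winning (fix_player1 H T) (q \<circ> fst) (initial_vertex H T s))"
proof -
  have sn: "s < n" using s states_G by simp
  show ?thesis
  proof
    assume "\<exists>T. transducer G T \<and> almost_sure_winning G p (transducer_strategy G T) s"
    then obtain T where T: "transducer G T" "almost_sure_winning G p (transducer_strategy G T) s" by blast
    show "\<exists>T. transducer H T \<and> player3_sure_winning (fix_player1 H T) (q \<circ> fst) (initial_vertex H T s)"
      by (rule player3_sure_winning_if[OF T(1) sn])
         (use not_almost_sure_winning_if[OF G T(1) s, where p = p] T(2) in blast)
  next
    assume "\<exists>T. transducer H T \<and> player3_sure_winning (fix_player1 H T) (q \<circ> fst) (initial_vertex H T s)"
    then obtain T where T: "transducer H T"
      "player3_sure_winning (fix_player1 H T) (q \<circ> fst) (initial_vertex H T s)" by blast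
    have T': "transducer G (simulating_transducer T s)" by (rule transducer_simulating[OF T(1)])
    have "almost_sure_winning G p (transducer_strategy G (simulating_transducer T s)) s"
      by (rule almost_sure_winning_if[OF G T' s])
         (rule simulating_no_odd_end_component[OF T(1) sn no_odd_end_component_if[OF T(1) sn T(2)]])
    then show "\<exists>T. transducer G T \<and> almost_sure_winning G p (transducer_strategy G T) s" using T' by blast
  qed
qed

end

theorem theorem1:
  "\<exists>(P :: ram_program) (c_time :: nat) (c_states :: nat) (c_trans :: nat).
     \<forall>(G :: (nat, nat, nat) stochastic_game) (p :: nat \<Rightarrow> nat) (d :: nat) (xs :: nat list).
       stochastic_game G \<and> 1 \<le> d \<and> (\<forall>s\<in>states G. p s \<in> {0..d}) \<and> encodes xs G p \<longrightarrow>
       (\<exists>(H :: (nat, nat, nat) game) (q :: nat \<Rightarrow> nat) (ys :: nat list) (t :: nat).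
          computes_in P xs ys t \<and>
          t \<le> c_time * ((card (states G) + num_transitions G) * d) \<and>
          encodes ys H q \<and>
          three_player_game H \<and>
          card (states H) \<le> c_states * (card (states G) * d) \<and>
          num_transitions H \<le> c_trans * (num_transitions G * d) \<and>
          card (q ` states H) \<le> d + 1 \<and>
          states G \<subseteq> states H \<and>
          (\<forall>s\<in>states G.
             (\<exists>T. transducer G T \<and> almost_sure_winning G p (transducer_strategy G T) s) \<longleftrightarrow>
             (\<exists>T. transducer H T \<and>
                player3_sure_winning (fix_player1 H T) (q \<circ> fst) (initial_vertex H T s))))"
\<comment> \<open>The earlier bounds are in terms of \<open>Suc D\<close>, for the largest occurring
  priority \<open>D\<close>. Since \<open>D \<le> d\<close> and \<open>1 \<le> d\<close>,
  \<open>Suc D \<le> 2 * d\<close> doubles the constants 400 and 20, and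
  \<open>2 * D + 4 \<le> 6 * d\<close> gives the 6.\<close>
proof (rule exI[of _ ram_main], rule exI[of _ 800], rule exI[of _ 6], rule exI[of _ 40], intro allI impI)
  fix G :: "(nat, nat, nat) stochastic_game" and p :: "nat \<Rightarrow> nat" and d :: nat and xs :: "nat list"
  assume A: "stochastic_game G \<and> 1 \<le> d \<and> (\<forall>s\<in>states G. p s \<in> {0..d}) \<and> encodes xs G p"
  then obtain n k l succs where "states G = {..<n}" "A1 G = {..<k}" "Obs G = {..<l}"
    "succ_list G k succs" "xs = [n, k, l] @ concat (map (state_block G p succs) [0..<n])"
    unfolding encodes_iff by blast
  then interpret encoded_game G p n k l succs xs
    using A by unfold_locales auto
  let ?D = "E.max_priority" and ?m = "num_transitions G"
  let ?H = "layered_game G n l ?D succs" and ?q = "layered_priority p n ?D"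
  have d: "1 \<le> d" "?D \<le> d" using A max_priority_le by blast+
  then have D: "Suc ?D \<le> 2 * d" "2 * ?D + 4 \<le> 6 * d" by simp_all
  obtain t where t: "t \<le> 400 * ((n + ?m) * Suc ?D)" "computes_in ram_main xs E.encoded_output t"
    using computes_output by blast
  have n: "card (states G) = n" by (simp add: states_G)
  have "400 * ((n + ?m) * Suc ?D) \<le> 400 * ((n + ?m) * (2 * d))"
    using D(1) by (intro mult_le_mono order_refl)
  then have time: "t \<le> 800 * ((card (states G) + ?m) * d)" using t(1) n by simp
  have "(2 * ?D + 4) * n \<le> 6 * d * n" using D(2) by (rule mult_le_mono1)
  then have st: "card (states ?H) \<le> 6 * (card (states G) * d)" by (simp add: states_H n ac_simps)
  have "20 * (?m * Suc ?D) \<le> 20 * (?m * (2 * d))"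
    using D(1) by (intro mult_le_mono order_refl)
  then have tr: "num_transitions ?H \<le> 40 * (?m * d)" using num_transitions_H by simp
  have "{..<n} \<subseteq> {..<(2 * ?D + 4) * n}"
    using layer_less[of _ 0] by auto
  then have sub: "states G \<subseteq> states ?H" unfolding states_H states_G .
  have pr: "card (?q ` states ?H) \<le> d + 1" using card_priorities d(2) by simp
  show "\<exists>(H :: (nat, nat, nat) game) (q :: nat \<Rightarrow> nat) (ys :: nat list) (t :: nat).
          computes_in ram_main xs ys t \<and>
          t \<le> 800 * ((card (states G) + num_transitions G) * d) \<and>
          encodes ys H q \<and>
          three_player_game H \<and>
          card (states H) \<le> 6 * (card (states G) * d) \<and>
          num_transitions H \<le> 40 * (num_transitions G * d) \<and>
          card (q ` states H) \<le> d + 1 \<and>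
          states G \<subseteq> states H \<and>
          (\<forall>s\<in>states G.
             (\<exists>T. transducer G T \<and> almost_sure_winning G p (transducer_strategy G T) s) \<longleftrightarrow>
             (\<exists>T. transducer H T \<and>
                player3_sure_winning (fix_player1 H T) (q \<circ> fst) (initial_vertex H T s)))"
    by (rule exI[of _ ?H], rule exI[of _ ?q], rule exI[of _ E.encoded_output], rule exI[of _ t],
        intro conjI ballI winning_iff t(2) time encodes_output game_graph_H st tr pr sub)
qed

end
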